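(* Let $\{U(t,x)\}_{t\ge0,x\in\mathbb{R}}$ be the solution of the Tricomi equation $\partial_{tt}U=t\,\partial_{xx}U+W$ on $t>0$, $x\in\mathbb{R}$, with zero initial data $U(0,x)=\partial_tU(0,x)=0$, driven by space-time Gaussian white noise $W$. For any $t>0$ the stochastic process $\{U(t,x)\}_{x\in\mathbb{R}}$ is second order stationary with expectation $$\mathbb{E}[U(t,x)]=0\quad\text{for all }x\in\mathbb{R}$$ and covariance $$\mathrm{cov}(U(t,x),U(t,y))=\frac{1}{2\pi^2}\int_0^{+\infty}\cos(\rho|x-y|)\int_0^t|C(t,s,\rho)|^2\,ds\,d\rho\quad\text{for all }x,y\in\mathbb{R}.$$ Moreover, the correlation function $$r_t(h):=\frac{\mathrm{cov}(U(t,x+h),U(t,x))}{\mathbb{V}[U(t,x)]},\qquad t>0,\ x,h\in\mathbb{R},$$ verifies $$r_t(h)=1-\alpha_t|h|+o(|h|)\quad\text{as }|h|\text{ tends to zero},\qquad\text{with}\qquad \alpha_t:=\frac{\pi}{2\int_0^{+\infty}\int_0^{t}\left|C(t,s,\rho)\right|^2\,ds\,d\rho}.$$ In particular, the stochastic process $\{U(t,x)\}_{x\in\mathbb{R}}$ admits a continuous modification.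
   Context: Let $\mathrm{Ai}$ and $\mathrm{Bi}$ denote the Airy functions. For $s,t\ge 0$ and $\rho>0$ define $$C(t,s,\rho):=-\frac{\pi}{\rho^{2/3}}\left[\mathrm{Bi}(-\rho^{2/3}t)\,\mathrm{Ai}(-\rho^{2/3}s)-\mathrm{Ai}(-\rho^{2/3}t)\,\mathrm{Bi}(-\rho^{2/3}s)\right],$$ and $C(t,s,0):=t-s$. Let $\{\psi_m\}_{m\ge1}$ be a fixed real, smooth orthonormal basis of $L^2([0,+\infty))$ (for instance, a Laguerre basis), let $\{\varphi_n\}_{n\ge1}$ be the orthonormal basis of $L^2(\mathbb{R})$ made of Hermite functions, and let $\{\mathtt{z}_{mn}\}_{m,n\ge1}$ be a family of independent standard Gaussian random variables defined on a common probability space $(\Omega,\mathcal{F},\mathbb{P})$. The space-time Gaussian white noise is represented by the formal series $W(t,x)=\sum_{m,n\ge1}\psi_m(t)\varphi_n(x)\mathtt{z}_{mn}$. For $N\ge1$ set $W_N(t,x):=\sum_{m,n=1}^N\psi_m(t)\varphi_n(x)\mathtt{z}_{mn}$. Let $U_N$ be the solution of $$\partial_{tt}U_N=t\,\partial_{xx}U_N+W_N\ \ (t>0,\ x\in\mathbb{R}),\qquad U_N(0,x)=0,\ \ \partial_tU_N(0,x)=0\ \ (x\in\mathbb{R}),$$ treated $\omega$-wise as a deterministic non-homogeneous Tricomi equation and represented by $$U_N(t,x)=\frac{1}{2\pi}\int_{\mathbb{R}}e^{i\xi x}\int_0^tC(t,s,|\xi|)\,\widehat{W_N}(s,\xi)\,ds\,d\xi,\qquad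 \widehat{W_N}(s,\xi)=\int_{\mathbb{R}}e^{-i\xi x}W_N(s,x)\,dx.$$ The solution of the stochastic Cauchy problem is by definition the random field $U(t,x):=\lim_{N\to+\infty}U_N(t,x)$, the limit being in $\mathbb{L}^2(\Omega,\mathcal{F},\mathbb{P})$ for all $t\ge0$, $x\in\mathbb{R}$ (this limit exists and is a Gaussian random field). $\mathbb{V}$ denotes variance. A process is second order stationary if it has finite second moments, constant mean, and covariance depending only on the difference of the parameters; hence $r_t(h)$ does not depend on $x$.
   Formalization: The covariance is proved with prefactor 1/π instead of the printed 1/(2π²): with the stated Fourier transform and the factor 1/(2π) in U_N, the variance equals (1/π) times the (positive) double integral, so the printed constant is false. All else is as stated. *)

theory Defs
  imports "HOL-Probability.Probability"
begin

section \<open>Airy functions\<close>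

text \<open>The Maclaurin series of the two Airy functions (DLMF 9.4.1 and 9.4.3), with the values and
  slopes at 0 from DLMF 9.2.3-9.2.6. Both series converge everywhere.\<close>

definition airy_f :: "real \<Rightarrow> real" where
  "airy_f x = (\<Sum>k. (\<Prod>j<k. 3 * real j + 1) / fact (3 * k) * x ^ (3 * k))"

definition airy_g :: "real \<Rightarrow> real" where
  "airy_g x = (\<Sum>k. (\<Prod>j<k. 3 * real j + 2) / fact (3 * k + 1) * x ^ (3 * k + 1))"

definition Ai :: "real \<Rightarrow> real" where
  "Ai x = airy_f x / (3 powr (2/3) * Gamma (2/3)) - airy_g x / (3 powr (1/3) * Gamma (1/3))"

definition Bi :: "real \<Rightarrow> real" where
  "Bi x = airy_f x / (3 powr (1/6) * Gamma (2/3)) + 3 powr (1/6) * airy_g x / Gamma (1/3)"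

definition tricomi_C :: "real \<Rightarrow> real \<Rightarrow> real \<Rightarrow> real" where
  "tricomi_C t s \<rho> =
     (if \<rho> = 0 then t - s
      else - (pi / \<rho> powr (2/3)) *
        (Bi (- (\<rho> powr (2/3)) * t) * Ai (- (\<rho> powr (2/3)) * s) -
         Ai (- (\<rho> powr (2/3)) * t) * Bi (- (\<rho> powr (2/3)) * s)))"

section \<open>Square integrable functions and orthonormal bases\<close>

definition square_integrable :: "'a measure \<Rightarrow> ('a \<Rightarrow> 'b :: {real_normed_vector, second_countable_topology}) \<Rightarrow> bool" where
  "square_integrable M f \<longleftrightarrow> f \<in> borel_measurable M \<and> integrable M (\<lambda>x. (norm (f x))\<^sup>2)"

definition tendsto_L2 :: "'a measure \<Rightarrow>
    (nat \<Rightarrow> 'a \<Rightarrow> 'b :: {real_normed_vector, second_countable_topology}) \<Rightarrow> ('a \<Rightarrow> 'b) \<Rightarrow> bool" where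
  "tendsto_L2 M F f \<longleftrightarrow>
     (\<forall>N. square_integrable M (F N)) \<and> square_integrable M f \<and>
     (\<lambda>N. LINT x|M. (norm (F N x - f x))\<^sup>2) \<longlonglongrightarrow> 0"

text \<open>Sequences are indexed by the positive integers; the value at index 0 is ignored.\<close>

definition orthonormal_basis_L2 :: "'a measure \<Rightarrow> (nat \<Rightarrow> 'a \<Rightarrow> real) \<Rightarrow> bool" where
  "orthonormal_basis_L2 M e \<longleftrightarrow>
     (\<forall>m\<ge>1. square_integrable M (e m)) \<and>
     (\<forall>m\<ge>1. \<forall>n\<ge>1. (LINT x|M. e m x * e n x) = (if m = n then 1 else 0)) \<and>
     (\<forall>f. square_integrable M f \<longrightarrow>
        tendsto_L2 M (\<lambda>N x. \<Sum>m=1..N. (LINT y|M. f y * e m y) * e m x) f)"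

text \<open>Smoothness up to the boundary: derivatives of all orders exist on the closed half-line,
  one-sided at 0.\<close>

definition smooth_halfline :: "(real \<Rightarrow> real) \<Rightarrow> bool" where
  "smooth_halfline f \<longleftrightarrow>
     (\<exists>D. (\<forall>x\<ge>0. D 0 x = f x) \<and>
        (\<forall>k. \<forall>x\<ge>0. (D k has_real_derivative D (Suc k) x) (at x within {0..})))"

section \<open>Hermite functions\<close>

fun hermite_poly :: "nat \<Rightarrow> real \<Rightarrow> real" where
  "hermite_poly 0 x = 1"
| "hermite_poly (Suc 0) x = 2 * x"
| "hermite_poly (Suc (Suc n)) x =
     2 * x * hermite_poly (Suc n) x - 2 * real (Suc n) * hermite_poly n x"

text \<open>The index is shifted: the basis element number n, for positive n, has degree n - 1.\<close>

definition hermite_basis :: "nat \<Rightarrow> real \<Rightarrow> real" where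
  "hermite_basis n x =
     hermite_poly (n - 1) x * exp (- x\<^sup>2 / 2) / sqrt (2 ^ (n - 1) * fact (n - 1) * sqrt pi)"

section \<open>Truncated noise and the approximate solutions\<close>

definition noise :: "(nat \<Rightarrow> real \<Rightarrow> real) \<Rightarrow> (nat \<Rightarrow> nat \<Rightarrow> 'w \<Rightarrow> real) \<Rightarrow>
    nat \<Rightarrow> 'w \<Rightarrow> real \<Rightarrow> real \<Rightarrow> real" where
  "noise \<psi> z N \<omega> t x = (\<Sum>m=1..N. \<Sum>n=1..N. \<psi> m t * hermite_basis n x * z m n \<omega>)"

definition noise_hat :: "(nat \<Rightarrow> real \<Rightarrow> real) \<Rightarrow> (nat \<Rightarrow> nat \<Rightarrow> 'w \<Rightarrow> real) \<Rightarrow>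
    nat \<Rightarrow> 'w \<Rightarrow> real \<Rightarrow> real \<Rightarrow> complex" where
  "noise_hat \<psi> z N \<omega> s \<xi> =
     (LINT x|lborel. exp (- (\<i> * of_real (\<xi> * x))) * of_real (noise \<psi> z N \<omega> s x))"

text \<open>The values are real numbers, but the representation formula yields them as elements of the
  complex plane.\<close>

definition approx_solution :: "(nat \<Rightarrow> real \<Rightarrow> real) \<Rightarrow> (nat \<Rightarrow> nat \<Rightarrow> 'w \<Rightarrow> real) \<Rightarrow>
    nat \<Rightarrow> real \<Rightarrow> real \<Rightarrow> 'w \<Rightarrow> complex" where
  "approx_solution \<psi> z N t x \<omega> =
     1 / (2 * of_real pi) *
     (LINT \<xi>|lborel. exp (\<i> * of_real (\<xi> * x)) *
        (LINT s:{0..t}|lborel. of_real (tricomi_C t s \<bar>\<xi>\<bar>) * noise_hat \<psi> z N \<omega> s \<xi>))"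

definition tricomi_solution :: "'w measure \<Rightarrow> (nat \<Rightarrow> real \<Rightarrow> real) \<Rightarrow> (nat \<Rightarrow> nat \<Rightarrow> 'w \<Rightarrow> real) \<Rightarrow>
    (real \<Rightarrow> real \<Rightarrow> 'w \<Rightarrow> real) \<Rightarrow> bool" where
  "tricomi_solution M \<psi> z U \<longleftrightarrow>
     (\<forall>t\<ge>0. \<forall>x. U t x \<in> borel_measurable M \<and>
        tendsto_L2 M (\<lambda>N. approx_solution \<psi> z N t x) (\<lambda>\<omega>. complex_of_real (U t x \<omega>)))"

section \<open>Second order processes\<close>

definition covariance :: "'w measure \<Rightarrow> ('w \<Rightarrow> real) \<Rightarrow> ('w \<Rightarrow> real) \<Rightarrow> real" where
  "covariance M X Y = (LINT \<omega>|M. (X \<omega> - integral\<^sup>L M X) * (Y \<omega> - integral\<^sup>L M Y))"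

definition second_order_stationary :: "'w measure \<Rightarrow> (real \<Rightarrow> 'w \<Rightarrow> real) \<Rightarrow> bool" where
  "second_order_stationary M X \<longleftrightarrow>
     (\<forall>x. square_integrable M (X x)) \<and>
     (\<exists>\<mu>. \<forall>x. integral\<^sup>L M (X x) = \<mu>) \<and>
     (\<exists>c. \<forall>x y. covariance M (X x) (X y) = c (x - y))"

definition continuous_modification ::
    "'w measure \<Rightarrow> (real \<Rightarrow> 'w \<Rightarrow> real) \<Rightarrow> (real \<Rightarrow> 'w \<Rightarrow> real) \<Rightarrow> bool" where
  "continuous_modification M X Y \<longleftrightarrow>
     (\<forall>x. Y x \<in> borel_measurable M) \<and>
     (\<forall>x. AE \<omega> in M. Y x \<omega> = X x \<omega>) \<and>
     (\<forall>\<omega>\<in>space M. continuous_on UNIV (\<lambda>x. Y x \<omega>))"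

definition correlation :: "'w measure \<Rightarrow> (real \<Rightarrow> real \<Rightarrow> 'w \<Rightarrow> real) \<Rightarrow>
    real \<Rightarrow> real \<Rightarrow> real \<Rightarrow> real" where
  "correlation M U t x h = covariance M (U t (x + h)) (U t x) / prob_space.variance M (U t x)"

definition tricomi_alpha :: "real \<Rightarrow> real" where
  "tricomi_alpha t =
     pi / (2 * (LINT \<rho>:{0..}|lborel. LINT s:{0..t}|lborel. \<bar>tricomi_C t s \<rho>\<bar>\<^sup>2))"

end

theory Submission
  imports Defs
begin

text \<open>
  Write \<open>f\<close> for \<^term>\<open>airy_f\<close> and \<open>E(\<xi>)\<close> for the integral of \<open>C(t,s,\<bar>\<xi>\<bar>)\<^sup>2\<close> over \<open>0 \<le> s \<le> t\<close>.

  The covariance. A Hermite function is an eigenfunction of the Fourier transform and is even or odd.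
  Hence the representation formula turns into a finite sum of the variables \<open>z\<^sub>m\<^sub>n\<close> whose real
  coefficients are, up to sign and the factor \<open>1 / sqrt (2 * pi)\<close>, the coefficients of
  \<open>(\<xi>, s) \<mapsto> (cos (\<xi> x) + sin (\<xi> x)) C(t,s,\<bar>\<xi>\<bar>)\<close> (cut off at \<open>s = t\<close>) in the product of the
  Hermite basis and the basis \<open>\<psi>\<close> (lemma \<open>approx_solution_eq\<close>). Parseval's identity for
  product bases (\<open>parseval_product\<close>) therefore evaluates the limits of all second moments. Since
  \<open>(cos a + sin a) (cos b + sin b) = cos (a - b) + sin (a + b)\<close> and \<open>E\<close> is even, the sine drops out
  and the covariance depends on \<open>x - y\<close> only. Parseval's identity needs the completeness of the
  Hermite functions (\<open>hermite_orthonormal_basis\<close>): a function orthogonal to all of them has, after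
  multiplication by the Gaussian weight, vanishing moments and hence a vanishing Fourier transform,
  so Levy's uniqueness theorem makes it zero.

  The behaviour at the origin. As a function of \<open>s\<close>, \<open>y = C(t,s,\<rho>)\<close> solves \<open>y'' = - \<rho>\<^sup>2 s y\<close> with
  \<open>y(t) = 0\<close>, \<open>y'(t) = -1\<close>, and then \<open>s y\<^sup>2 + y'\<^sup>2 / \<rho>\<^sup>2\<close> is an antiderivative of \<open>y\<^sup>2\<close>. This gives the
  closed form \<open>E(\<rho>) = (1 - f(- \<rho>\<^sup>2\<^sup>/\<^sup>3 t)\<^sup>2) / \<rho>\<^sup>2\<close> (\<open>tricomi_C_square_integral\<close>), and \<open>f\<close> tends to \<open>0\<close>
  at minus infinity (\<open>airy_f_decay\<close>). After the substitution \<open>\<rho> = v / h\<close>, the integral of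
  \<open>(1 - cos (\<rho> h)) E(\<rho>)\<close> over the line equals \<open>\<bar>h\<bar>\<close> times an integral of \<open>(1 - cos v) / v\<^sup>2\<close> against
  a weight between \<open>0\<close> and \<open>1\<close> that converges to \<open>1\<close> as \<open>h\<close> tends to \<open>0\<close>. The integral of
  \<open>(1 - cos v) / v\<^sup>2\<close> over the line is \<open>pi\<close>, whence the expansion of the correlation function.

  Continuity. The same formula bounds the variance of an increment by \<open>\<bar>x - y\<bar>\<close>. The truncated
  increments are Gaussian, so their fourth moments are three times the squared variances, and Fatou's
  lemma passes the bound \<open>3 (x - y)\<^sup>2\<close> to the limit. Kolmogorov's continuity criterion
  (\<open>kolmogorov_chentsov\<close>) then yields the continuous modification.
\<close>

section \<open>Airy functions and the fundamental solution\<close>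

text \<open>
  Maclaurin coefficients of the solution of \<open>y'' = x y\<close> with \<open>y(0) = p\<close> and \<open>y'(0) = q\<close>.
\<close>
fun airy_coeff :: "real \<Rightarrow> real \<Rightarrow> nat \<Rightarrow> real" where
  "airy_coeff p q 0 = p"
| "airy_coeff p q (Suc 0) = q"
| "airy_coeff p q (Suc (Suc 0)) = 0"
| "airy_coeff p q (Suc (Suc (Suc n))) = airy_coeff p q n / ((real n + 2) * (real n + 3))"

text \<open>
  Three steps in the index multiply the term by \<open>x\<^sup>3 / ((n + 2) (n + 3))\<close>, eventually by less
  than \<open>1 / 8\<close>; hence the terms are dominated by a multiple of \<open>2\<^sup>-\<^sup>n\<close>.
\<close>
lemma summable_airy_coeff: "summable (\<lambda>n. airy_coeff p q n * x ^ n)"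
proof -
  \<comment> \<open>The factor \<open>2 ^ n\<close> contributes \<open>8\<close> over three steps, still compensated once \<open>n\<close> is at least \<open>N\<close>.\<close>
  define e where "e n = \<bar>airy_coeff p q n * x ^ n\<bar> * 2 ^ n" for n
  obtain N :: nat where N: "8 * \<bar>x\<bar> ^ 3 \<le> real N" using real_arch_simple by blast
  have step: "e (n + 3) \<le> e n" if "N \<le> n" for n
  proof -
    have "8 * \<bar>x\<bar> ^ 3 \<le> real n" using N that by linarith
    also have "real n \<le> (real n + 2) * (real n + 3)" by (simp add: algebra_simps)
    finally have "8 * \<bar>x\<bar> ^ 3 / ((real n + 2) * (real n + 3)) \<le> 1"
      by (simp add: divide_simps)
    moreover have "e (n + 3) = e n * (8 * \<bar>x\<bar> ^ 3 / ((real n + 2) * (real n + 3)))"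
      by (simp add: e_def numeral_3_eq_3 abs_mult power_abs)
    moreover have "0 \<le> e n" by (simp add: e_def)
    ultimately show ?thesis using mult_left_le by (metis)
  qed
  define B where "B = Max (e ` {..N + 3})"
  have B: "e n \<le> B" for n
  proof (induction n rule: less_induct)
    case (less n)
    show ?case
    proof (cases "n \<le> N + 3")
      case True
      then show ?thesis unfolding B_def by (intro Max_ge) auto
    next
      case False
      then have "e ((n - 3) + 3) \<le> e (n - 3)" by (intro step) auto
      also have "\<dots> \<le> B" using False by (intro less) auto
      finally show ?thesis using False by simp
    qed
  qed
  show ?thesis
  proof (rule summable_comparison_test')
    show "summable (\<lambda>n. B * (1 / 2) ^ n)" by (intro summable_mult summable_geometric) auto
    show "norm (airy_coeff p q n * x ^ n) \<le> B * (1 / 2) ^ n" if "n \<ge> 0" for n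
      using B[of n] by (simp add: e_def field_simps)
  qed
qed

lemma airy_series_solution:
  fixes p q :: real
  defines "y \<equiv> \<lambda>x. \<Sum>n. airy_coeff p q n * x ^ n"
  shows "\<exists>y'. (\<forall>x. (y has_real_derivative y' x) (at x)) \<and>
              (\<forall>x. (y' has_real_derivative x * y x) (at x)) \<and> y 0 = p \<and> y' 0 = q"
proof (intro exI conjI allI)
  let ?c = "airy_coeff p q"
  let ?y' = "\<lambda>x. \<Sum>n. diffs ?c n * x ^ n"
  show "(y has_real_derivative ?y' x) (at x)" for x
    unfolding y_def by (rule termdiffs_strong_converges_everywhere) (rule summable_airy_coeff)
  have sum1: "summable (\<lambda>n. diffs ?c n * x ^ n)" for x
    by (rule termdiff_converges_all) (rule summable_airy_coeff)
  have sum2: "summable (\<lambda>n. diffs (diffs ?c) n * x ^ n)" for x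
    by (rule termdiff_converges_all) (rule sum1)
  have "(?y' has_real_derivative (\<Sum>n. diffs (diffs ?c) n * x ^ n)) (at x)" for x
    by (rule termdiffs_strong_converges_everywhere) (rule sum1)
  moreover have "(\<Sum>n. diffs (diffs ?c) n * x ^ n) = x * y x" for x
  proof -
    have c2: "diffs (diffs ?c) 0 = 0" and cS: "diffs (diffs ?c) (Suc n) = ?c n" for n
    proof -
      show "diffs (diffs ?c) 0 = 0" by (simp add: diffs_def)
      have "diffs (diffs ?c) (Suc n) = (real n + 2) * (real n + 3) * ?c (Suc (Suc (Suc n)))"
        by (simp add: diffs_def add_ac del: airy_coeff.simps)
      moreover have "(real n + 2) * (real n + 3) \<noteq> 0" by simp
      ultimately show "diffs (diffs ?c) (Suc n) = ?c n" by simp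
    qed
    have "(\<Sum>n. diffs (diffs ?c) n * x ^ n) = (\<Sum>n. diffs (diffs ?c) (Suc n) * x ^ (Suc n))"
      using suminf_split_head[OF sum2[of x]] c2 by simp
    also have "\<dots> = (\<Sum>n. x * (?c n * x ^ n))" by (simp add: cS mult_ac)
    also have "\<dots> = x * y x"
      unfolding y_def by (rule suminf_mult) (rule summable_airy_coeff)
    finally show ?thesis .
  qed
  ultimately show "(?y' has_real_derivative x * y x) (at x)" for x by simp
  show "y 0 = p" unfolding y_def using powser_zero[of ?c] by simp
  show "?y' 0 = q" using powser_zero[of "diffs ?c"] by (simp add: diffs_def)
qed

lemma airy_coeff_f: "airy_coeff 1 0 (3 * k) = (\<Prod>j<k. 3 * real j + 1) / fact (3 * k)"
proof (induction k)
  case (Suc k)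
  have *: "3 * Suc k = Suc (Suc (Suc (3 * k)))" by simp
  have f: "fact (Suc (Suc (Suc m))) = (real m + 3) * ((real m + 2) * ((real m + 1) * fact m))" for m
    by (simp add: fact_Suc add_ac)
  show ?case
    unfolding * airy_coeff.simps(4) Suc.IH f prod.lessThan_Suc by simp
qed simp

lemma airy_coeff_g: "airy_coeff 0 1 (3 * k + 1) = (\<Prod>j<k. 3 * real j + 2) / fact (3 * k + 1)"
proof (induction k)
  case (Suc k)
  have *: "3 * Suc k + 1 = Suc (Suc (Suc (3 * k + 1)))" by simp
  have f: "fact (Suc (Suc (Suc m))) = (real m + 3) * ((real m + 2) * ((real m + 1) * fact m))" for m
    by (simp add: fact_Suc add_ac)
  have r: "real (3 * k + 1) + 1 = 3 * real k + 2" by simp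
  show ?case
    unfolding * airy_coeff.simps(4) Suc.IH f prod.lessThan_Suc r by simp
qed simp

lemma airy_coeff_zero: "airy_coeff 1 0 (3 * k + 1) = 0" "airy_coeff 1 0 (3 * k + 2) = 0"
  "airy_coeff 0 1 (3 * k) = 0" "airy_coeff 0 1 (3 * k + 2) = 0"
proof (induction k)
  case (Suc k)
  have *: "3 * Suc k + 1 = Suc (Suc (Suc (3 * k + 1)))"
    "3 * Suc k + 2 = Suc (Suc (Suc (3 * k + 2)))" "3 * Suc k = Suc (Suc (Suc (3 * k)))" by simp_all
  show "airy_coeff 1 0 (3 * Suc k + 1) = 0" "airy_coeff 1 0 (3 * Suc k + 2) = 0"
    "airy_coeff 0 1 (3 * Suc k) = 0" "airy_coeff 0 1 (3 * Suc k + 2) = 0"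
    unfolding * airy_coeff.simps(4) using Suc by simp_all
qed (simp_all add: numeral_2_eq_2)

lemma residue_3_cases:
  obtains k where "n = 3 * k" | k where "n = 3 * k + 1" | k where "n = 3 * k + (2::nat)"
proof -
  define k r where "k = n div 3" and "r = n mod 3"
  have "n = 3 * k + r" "r < 3" by (simp_all add: k_def r_def)
  then consider "n = 3 * k" | "n = 3 * k + 1" | "n = 3 * k + 2" by linarith
  then show ?thesis using that by cases blast+
qed

lemma airy_f_series: "airy_f x = (\<Sum>n. airy_coeff 1 0 n * x ^ n)"
proof -
  have zero: "airy_coeff 1 0 n = 0" if "n \<notin> range ((*) 3)" for n
    using that by (cases n rule: residue_3_cases) (simp_all only: airy_coeff_zero rangeI simp_thms)
  have "(\<Sum>k. airy_coeff 1 0 (3 * k) * x ^ (3 * k)) = (\<Sum>n. airy_coeff 1 0 n * x ^ n)"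
    by (rule suminf_mono_reindex[where g = "(*) 3" and f = "\<lambda>n. airy_coeff 1 0 n * x ^ n"])
       (auto simp: strict_mono_def zero)
  then show ?thesis unfolding airy_f_def airy_coeff_f .
qed

lemma airy_g_series: "airy_g x = (\<Sum>n. airy_coeff 0 1 n * x ^ n)"
proof -
  have zero: "airy_coeff 0 1 n = 0" if "n \<notin> range (\<lambda>k. 3 * k + 1)" for n
    using that by (cases n rule: residue_3_cases) (simp_all only: airy_coeff_zero, blast)
  have "(\<Sum>k. airy_coeff 0 1 (3 * k + 1) * x ^ (3 * k + 1)) = (\<Sum>n. airy_coeff 0 1 n * x ^ n)"
    by (rule suminf_mono_reindex[where g = "\<lambda>k. 3 * k + 1" and f = "\<lambda>n. airy_coeff 0 1 n * x ^ n"])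
       (auto simp: strict_mono_def zero)
  then show ?thesis unfolding airy_g_def airy_coeff_g .
qed

definition airy_f' :: "real \<Rightarrow> real" where "airy_f' = deriv airy_f"
definition airy_g' :: "real \<Rightarrow> real" where "airy_g' = deriv airy_g"

lemma airy_f_ode:
  shows DERIV_airy_f: "(airy_f has_real_derivative airy_f' x) (at x)"
    and DERIV_airy_f': "(airy_f' has_real_derivative x * airy_f x) (at x)"
    and airy_f_0: "airy_f 0 = 1" and airy_f'_0: "airy_f' 0 = 0"
proof -
  obtain y' where y': "\<And>x. (airy_f has_real_derivative y' x) (at x)"
      "\<And>x. (y' has_real_derivative x * airy_f x) (at x)" "airy_f 0 = 1" "y' 0 = 0"
    using airy_series_solution[of 1 0, folded airy_f_series] by blast
  moreover have "airy_f' = y'" unfolding airy_f'_def using DERIV_imp_deriv[OF y'(1)] by auto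
  ultimately show "(airy_f has_real_derivative airy_f' x) (at x)"
    "(airy_f' has_real_derivative x * airy_f x) (at x)" "airy_f 0 = 1" "airy_f' 0 = 0" by auto
qed

lemma airy_g_ode:
  shows DERIV_airy_g: "(airy_g has_real_derivative airy_g' x) (at x)"
    and DERIV_airy_g': "(airy_g' has_real_derivative x * airy_g x) (at x)"
    and airy_g_0: "airy_g 0 = 0" and airy_g'_0: "airy_g' 0 = 1"
proof -
  obtain y' where y': "\<And>x. (airy_g has_real_derivative y' x) (at x)"
      "\<And>x. (y' has_real_derivative x * airy_g x) (at x)" "airy_g 0 = 0" "y' 0 = 1"
    using airy_series_solution[of 0 1, folded airy_g_series] by blast
  moreover have "airy_g' = y'" unfolding airy_g'_def using DERIV_imp_deriv[OF y'(1)] by auto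
  ultimately show "(airy_g has_real_derivative airy_g' x) (at x)"
    "(airy_g' has_real_derivative x * airy_g x) (at x)" "airy_g 0 = 0" "airy_g' 0 = 1" by auto
qed

lemmas DERIV_airy = DERIV_airy_f DERIV_airy_f' DERIV_airy_g DERIV_airy_g'

text \<open>
  The equation has no first order term, so the Wronskian is constant; its value is read off at
  \<open>0\<close>.
\<close>
lemma airy_wronskian: "airy_f x * airy_g' x - airy_f' x * airy_g x = 1"
proof -
  let ?W = "\<lambda>x. airy_f x * airy_g' x - airy_f' x * airy_g x"
  have "\<forall>x. (?W has_real_derivative 0) (at x)"
    by (auto intro!: derivative_eq_intros DERIV_airy simp: algebra_simps)
  then have "?W x = ?W 0" by (rule DERIV_isconst_all)
  then show ?thesis by (simp add: airy_f_0 airy_f'_0 airy_g_0 airy_g'_0)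
qed

lemma continuous_airy: "isCont airy_f x" "isCont airy_g x" "isCont airy_f' x"
  using DERIV_airy DERIV_isCont by blast+

lemma borel_measurable_airy [measurable]: 
  "airy_f \<in> borel_measurable borel" "airy_g \<in> borel_measurable borel"
  by (auto intro!: borel_measurable_continuous_onI continuous_at_imp_continuous_on continuous_airy)

lemma Gamma_third: "Gamma (1/3) * Gamma (2/3 :: real) = 2 * pi / sqrt 3"
proof -
  have "complex_of_real (Gamma (1/3) * Gamma (2/3)) = Gamma (1/3) * Gamma (1 - 1/3)"
    by (simp flip: Gamma_complex_of_real)
  also have "\<dots> = of_real pi / sin (of_real pi * (1/3))"
    by (rule Gamma_reflection_complex)
  also have "of_real pi * (1/3) = complex_of_real (pi / 3)" by simp
  also have "sin (complex_of_real (pi / 3)) = complex_of_real (sqrt 3 / 2)"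
    by (simp only: sin_of_real sin_60)
  also have "of_real pi / complex_of_real (sqrt 3 / 2) = complex_of_real (2 * pi / sqrt 3)"
    by simp
  finally show ?thesis by (simp only: of_real_eq_iff)
qed

text \<open>
  In \<open>Bi a Ai b - Ai a Bi b\<close> the diagonal terms cancel, and the constants combine to
  \<open>2 sqrt 3 / (3 Gamma(1/3) Gamma(2/3))\<close>, which the reflection formula evaluates to \<open>1 / pi\<close>. This
  rids the fundamental solution of all Gamma factors.
\<close>
lemma Airy_cross: "pi * (Bi a * Ai b - Ai a * Bi b) = airy_g a * airy_f b - airy_f a * airy_g b"
proof -
  define A where "A = 3 powr (2/3) * Gamma (2/3 :: real)"
  define B where "B = 3 powr (1/3) * Gamma (1/3 :: real)"
  have pos: "Gamma (2/3 :: real) > 0" "Gamma (1/3 :: real) > 0" by (auto intro: Gamma_real_pos)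
  have AB: "A * B = 2 * pi * sqrt 3"
  proof -
    have "A * B = (3 powr (2/3) * 3 powr (1/3)) * (Gamma (1/3) * Gamma (2/3 :: real))"
      by (simp add: A_def B_def)
    also have "\<dots> = 3 * (2 * pi / sqrt 3)"
      by (simp only: Gamma_third) (simp flip: powr_add)
    also have "\<dots> = 2 * pi * sqrt 3" by (simp add: field_simps)
    finally show ?thesis .
  qed
  have A0: "A > 0" "B > 0" using pos by (simp_all add: A_def B_def)
  have s3: "sqrt 3 = 3 powr (1/2::real)" by (simp add: powr_half_sqrt)
  have e1: "3 powr (2/3) = 3 powr (1/6) * sqrt (3::real)"
    unfolding s3 by (simp flip: powr_add)
  have e2: "sqrt (3::real) = 3 powr (1/6) * 3 powr (1/3)"
    unfolding s3 by (simp flip: powr_add)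
  have Bi: "Bi x = sqrt 3 * (airy_f x / A + airy_g x / B)" for x
  proof -
    have "airy_f x / (3 powr (1/6) * Gamma (2/3)) = sqrt 3 * (airy_f x / A)"
      unfolding A_def e1 using pos by (simp add: field_simps)
    moreover have "3 powr (1/6) * airy_g x / Gamma (1/3) = sqrt 3 * (airy_g x / B)"
      unfolding B_def e2 using pos by (simp add: field_simps)
    ultimately show ?thesis by (simp add: Bi_def distrib_left)
  qed
  have Ai: "Ai x = airy_f x / A - airy_g x / B" for x by (simp add: Ai_def A_def B_def)
  have "Bi a * Ai b - Ai a * Bi b = 2 * sqrt 3 / (A * B) * (airy_g a * airy_f b - airy_f a * airy_g b)"
    unfolding Bi Ai using A0 by (simp add: field_simps)
  also have "2 * sqrt 3 / (A * B) = 1 / pi" unfolding AB by simp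
  finally show ?thesis by simp
qed

lemma tricomi_C_airy:
  assumes "\<rho> > 0"
  shows "tricomi_C t s \<rho> = (airy_f (- (\<rho> powr (2/3)) * t) * airy_g (- (\<rho> powr (2/3)) * s)
          - airy_g (- (\<rho> powr (2/3)) * t) * airy_f (- (\<rho> powr (2/3)) * s)) / \<rho> powr (2/3)"
proof -
  have "tricomi_C t s \<rho> = - (pi * (Bi (- (\<rho> powr (2/3)) * t) * Ai (- (\<rho> powr (2/3)) * s) -
         Ai (- (\<rho> powr (2/3)) * t) * Bi (- (\<rho> powr (2/3)) * s))) / \<rho> powr (2/3)"
    using assms by (simp add: tricomi_C_def)
  then show ?thesis unfolding Airy_cross by (simp add: field_simps)
qed

lemma continuous_tricomi_C: 
  assumes "\<rho> \<ge> 0"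
  shows "continuous_on UNIV (\<lambda>s. tricomi_C t s \<rho>)"
proof (cases "\<rho> = 0")
  case True
  then show ?thesis by (auto simp: tricomi_C_def intro!: continuous_intros)
next
  case False
  have f: "continuous_on UNIV airy_f" "continuous_on UNIV airy_g"
    by (auto intro!: continuous_at_imp_continuous_on continuous_airy)
  from False assms show ?thesis
    by (auto simp: tricomi_C_airy intro!: continuous_intros continuous_on_compose2[OF f(1)]
      continuous_on_compose2[OF f(2)])
qed

text \<open>
  With \<open>y(s) = C(t,s,\<rho>)\<close> one has \<open>y'' = - \<rho>\<^sup>2 s y\<close>, so the derivative of
  \<open>s y\<^sup>2 + y'\<^sup>2 / \<rho>\<^sup>2\<close> is exactly \<open>y\<^sup>2\<close>. At \<open>s = t\<close> this antiderivative is \<open>1 / \<rho>\<^sup>2\<close>, because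
  \<open>y'(t) = -1\<close> is the Wronskian; at \<open>s = 0\<close> only \<open>y'(0) = - f(- \<rho>\<^sup>2\<^sup>/\<^sup>3 t)\<close> survives.
\<close>
lemma tricomi_C_square_integral:
  assumes \<rho>: "\<rho> > 0" and t: "t \<ge> 0"
  shows "(LINT s:{0..t}|lborel. (tricomi_C t s \<rho>)\<^sup>2) = (1 - (airy_f (- (\<rho> powr (2/3)) * t))\<^sup>2) / \<rho>\<^sup>2"
proof -
  define l where "l = \<rho> powr (2/3)"
  have l0: "l > 0" using \<rho> by (simp add: l_def)
  have l3: "l ^ 3 = \<rho>\<^sup>2"
  proof -
    have "l ^ 3 = l powr 3" using l0 by (simp flip: powr_numeral)
    also have "\<dots> = \<rho> powr 2" by (simp add: l_def powr_powr)
    finally show ?thesis using \<rho> by simp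
  qed
  define a b where "a = airy_f (- l * t)" and "b = airy_g (- l * t)"
  define y where "y s = (a * airy_g (- l * s) - b * airy_f (- l * s)) / l" for s
  define y' where "y' s = b * airy_f' (- l * s) - a * airy_g' (- l * s)" for s
  have y: "tricomi_C t s \<rho> = y s" for s
    using tricomi_C_airy[OF \<rho>] by (simp add: y_def l_def a_def b_def)
  have lin: "((\<lambda>s. - l * s) has_real_derivative - l) (at s)" for s
    by (auto intro!: derivative_eq_intros)
  have Dy: "(y has_real_derivative y' s) (at s)" for s
  proof -
    have "(y has_real_derivative (a * (airy_g' (- l * s) * - l) - b * (airy_f' (- l * s) * - l)) / l) (at s)"
      unfolding y_def
      by (intro DERIV_cdivide DERIV_diff DERIV_cmult DERIV_chain2[OF DERIV_airy_g lin]
          DERIV_chain2[OF DERIV_airy_f lin])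
    also have "(a * (airy_g' (- l * s) * - l) - b * (airy_f' (- l * s) * - l)) / l = y' s"
    proof -
      have "(a * (p * - l) - b * (q * - l)) / l = b * q - a * p" for p q :: real
        using l0 by (simp add: diff_divide_distrib)
      then show ?thesis by (simp only: y'_def)
    qed
    finally show ?thesis .
  qed
  have Dy': "(y' has_real_derivative - \<rho>\<^sup>2 * s * y s) (at s)" for s
  proof -
    have "(y' has_real_derivative b * ((- l * s * airy_f (- l * s)) * - l)
        - a * ((- l * s * airy_g (- l * s)) * - l)) (at s)"
      unfolding y'_def
      by (intro DERIV_diff DERIV_cmult DERIV_chain2[OF DERIV_airy_f' lin]
          DERIV_chain2[OF DERIV_airy_g' lin])
    also have "b * ((- l * s * airy_f (- l * s)) * - l) - a * ((- l * s * airy_g (- l * s)) * - l)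
        = - \<rho>\<^sup>2 * s * y s"
    proof -
      have "b * ((- l * s * p) * - l) - a * ((- l * s * q) * - l) = - (l ^ 3) * s * ((a * q - b * p) / l)"
        for p q :: real
      proof -
        have "l ^ 3 * s * ((a * q - b * p) / l) = l * l * s * (a * q - b * p)"
          using l0 by (simp add: power3_eq_cube)
        then have "- (l ^ 3) * s * ((a * q - b * p) / l) = - (l * l * s * (a * q - b * p))"
          by (simp only: mult_minus_left)
        then show ?thesis by (simp only:) (simp add: algebra_simps)
      qed
      then show ?thesis by (simp only: y_def l3)
    qed
    finally show ?thesis .
  qed
  define F where "F s = s * (y s)\<^sup>2 + (y' s)\<^sup>2 / \<rho>\<^sup>2" for s
  have DF: "(F has_real_derivative (y s)\<^sup>2) (at s)" for s
  proof -
    have "(F has_real_derivative (s * (real 2 * (y' s * y s ^ (2 - Suc 0))) + 1 * (y s)\<^sup>2)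
        + (real 2 * ((- \<rho>\<^sup>2 * s * y s) * y' s ^ (2 - Suc 0))) / \<rho>\<^sup>2) (at s)"
      unfolding F_def
      by (intro DERIV_add DERIV_mult' DERIV_ident DERIV_cdivide DERIV_power Dy Dy')
    then show ?thesis using \<rho> by (simp add: mult_ac)
  qed
  have cont: "isCont (\<lambda>s. (y s)\<^sup>2) s" for s using DERIV_isCont[OF Dy] by (intro continuous_intros)
  have "(LINT s:{0..t}|lborel. (y s)\<^sup>2) = F t - F 0"
  proof -
    have "(F has_vector_derivative (y s)\<^sup>2) (at s within {0..t})" for s
      using DF[of s] by (simp add: has_real_derivative_iff_has_vector_derivative has_vector_derivative_at_within)
    moreover have "continuous_on {0..t} (\<lambda>s. (y s)\<^sup>2)"
      by (rule continuous_at_imp_continuous_on) (use cont in blast)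
    ultimately have "(LINT s|lborel. indicator {0..t} s *\<^sub>R (y s)\<^sup>2) = F t - F 0"
      using t by (intro integral_FTC_atLeastAtMost)
    then show ?thesis by (simp only: set_lebesgue_integral_def)
  qed
  moreover have "y t = 0" by (simp add: y_def a_def b_def)
  moreover have "y' t = -1" using airy_wronskian[of "- l * t"] by (simp add: y'_def a_def b_def algebra_simps)
  moreover have "y' 0 = - a" by (simp add: y'_def airy_f'_0 airy_g'_0)
  ultimately show ?thesis unfolding y by (simp add: F_def a_def l_def diff_divide_distrib)
qed

text \<open>
  For \<open>\<rho> = 1\<close> the preceding closed form equals an integral of a square, hence is nonnegative.
\<close>
lemma airy_f_le_1:
  assumes "x \<ge> 0" shows "\<bar>airy_f (- x)\<bar> \<le> 1"
proof -
  have "0 \<le> (LINT s:{0..x}|lborel. (tricomi_C x s 1)\<^sup>2)"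
    unfolding set_lebesgue_integral_def by (rule integral_nonneg_AE) simp
  then have "(airy_f (- x))\<^sup>2 \<le> 1" using tricomi_C_square_integral[of 1 x] assms by simp
  then show ?thesis by (simp add: abs_square_le_1)
qed

text \<open>
  Integrate \<open>u'' = - x u\<close>, \<open>u(x) = f(-x)\<close>, twice from \<open>0\<close>, using \<open>u \<le> 1\<close>.
\<close>
lemma airy_f_near_0:
  assumes "x \<ge> 0" shows "1 - airy_f (- x) \<le> x ^ 3 / 6"
proof -
  have 1: "airy_f' (- x) \<le> x\<^sup>2 / 2" if "x \<ge> 0" for x
  proof -
    have "0\<^sup>2 / 2 - airy_f' (- 0) \<le> x\<^sup>2 / 2 - airy_f' (- x)"
    proof (rule DERIV_nonneg_imp_nondecreasing[OF that], intro exI conjI)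
      fix y :: real assume y: "0 \<le> y" "y \<le> x"
      show "((\<lambda>x. x\<^sup>2 / 2 - airy_f' (- x)) has_real_derivative y * (1 - airy_f (- y))) (at y)"
        by (auto intro!: derivative_eq_intros DERIV_chain2[OF DERIV_airy_f'] simp: algebra_simps)
      show "0 \<le> y * (1 - airy_f (- y))" using y airy_f_le_1[of y] by (intro mult_nonneg_nonneg) auto
    qed
    then show ?thesis by (simp add: airy_f'_0)
  qed
  have "0 ^ 3 / 6 + airy_f (- 0) \<le> x ^ 3 / 6 + airy_f (- x)"
  proof (rule DERIV_nonneg_imp_nondecreasing[OF assms], intro exI conjI)
    fix y :: real assume y: "0 \<le> y" "y \<le> x"
    show "((\<lambda>x. x ^ 3 / 6 + airy_f (- x)) has_real_derivative y\<^sup>2 / 2 - airy_f' (- y)) (at y)"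
      by (auto intro!: derivative_eq_intros DERIV_chain2[OF DERIV_airy_f] simp: algebra_simps)
    show "0 \<le> y\<^sup>2 / 2 - airy_f' (- y)" using 1[of y] y by simp
  qed
  then show ?thesis by (simp add: airy_f_0)
qed

text \<open>
  For \<open>u(x) = f(-x)\<close> the adiabatic energy \<open>P = x\<^sup>1\<^sup>/\<^sup>2 u\<^sup>2 + x\<^sup>-\<^sup>1\<^sup>/\<^sup>2 u'\<^sup>2\<close> is almost conserved. Adding
  the correction \<open>u u' / (2 x\<^sup>3\<^sup>/\<^sup>2)\<close> cancels the terms of \<open>P'\<close> of order \<open>P / x\<close> and leaves a remainder
  of order \<open>x\<^sup>-\<^sup>5\<^sup>/\<^sup>2 P\<close>, which is integrable. So \<open>P\<close> stays bounded and \<open>u\<^sup>2 = O(x\<^sup>-\<^sup>1\<^sup>/\<^sup>2)\<close>.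
\<close>
lemma airy_f_decay: "((\<lambda>x. airy_f (- x)) \<longlongrightarrow> 0) at_top"
proof -
  define u where "u x = airy_f (- x)" for x
  define v where "v x = - airy_f' (- x)" for x
  have Du: "(u has_real_derivative v x) (at x)" for x
    unfolding u_def v_def using DERIV_airy_f[of "- x"] by (simp add: DERIV_mirror)
  have Dv: "(v has_real_derivative - x * u x) (at x)" for x
    unfolding u_def v_def by (auto intro!: derivative_eq_intros DERIV_chain2[OF DERIV_airy_f'])
  define P where "P x = sqrt x * (u x)\<^sup>2 + (v x)\<^sup>2 / sqrt x" for x
  define H where "H x = P x + u x * v x / (2 * x * sqrt x)" for x
  \<comment> \<open>The exponent is chosen so that its derivative is \<open>- 1 / (2 x\<^sup>5\<^sup>/\<^sup>2)\<close>, which absorbs the remainder in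
      the derivative of \<open>H\<close> and makes \<open>T\<close> nonincreasing.\<close>
  define T where "T x = H x * exp (1 / (3 * (x * sqrt x)))" for x
  have amgm: "\<bar>u x * v x\<bar> \<le> P x / 2" if "x > 0" for x
  proof -
    define q where "q = sqrt (sqrt x)"
    have q: "q > 0" "q\<^sup>2 = sqrt x" using that by (auto simp: q_def)
    have "0 \<le> (q * \<bar>u x\<bar> - \<bar>v x\<bar> / q)\<^sup>2" by simp
    also have "\<dots> = P x - 2 * \<bar>u x * v x\<bar>"
      unfolding P_def q(2)[symmetric] using q(1) by (simp add: power2_eq_square field_simps abs_mult)
    finally show ?thesis by simp
  qed
  have HP: "3 / 4 * P x \<le> H x" if "x \<ge> 1" for x
  proof -
    have x: "x * sqrt x \<ge> 1" using that by (metis mult_mono' mult_1 real_sqrt_ge_one zero_le_one)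
    have "\<bar>u x * v x / (2 * x * sqrt x)\<bar> = \<bar>u x * v x\<bar> / (2 * (x * sqrt x))"
      using that by (simp add: abs_mult mult.assoc)
    also have "\<dots> \<le> \<bar>u x * v x\<bar> / (2 * 1)"
      using x by (intro divide_left_mono mult_left_mono) auto
    finally have "\<bar>u x * v x / (2 * x * sqrt x)\<bar> \<le> P x / 4" using amgm[of x] that by simp
    then have "- (P x / 4) \<le> u x * v x / (2 * x * sqrt x)" by linarith
    then show ?thesis unfolding H_def by linarith
  qed
  have T_dec: "T x \<le> T 1" if "x \<ge> 1" for x
  proof (rule DERIV_nonpos_imp_nonincreasing[OF that], intro exI conjI)
    fix y :: real assume y: "1 \<le> y" "y \<le> x"
    define r where "r = sqrt y"
    have r: "r > 0" "y = r\<^sup>2" using y by (auto simp: r_def)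
    let ?E = "exp (1 / (3 * (y * sqrt y)))"
    have Ds: "(sqrt has_real_derivative 1 / (2 * r)) (at y)"
      using DERIV_real_sqrt[of y] y by (simp add: r_def field_simps)
    have y0: "y \<noteq> 0" "sqrt y = r" using y by (auto simp: r_def)
    have DP: "((\<lambda>y. sqrt y * (u y)\<^sup>2 + (v y)\<^sup>2 / sqrt y) has_real_derivative
        (sqrt y * (real 2 * (v y * u y ^ (2 - Suc 0))) + 1 / (2 * r) * (u y)\<^sup>2)
        + ((real 2 * ((- y * u y) * v y ^ (2 - Suc 0))) * sqrt y - (v y)\<^sup>2 * (1 / (2 * r)))
          / (sqrt y * sqrt y)) (at y)"
      by (intro DERIV_add DERIV_mult' DERIV_divide DERIV_power Du Dv Ds) (use y in simp)
    have DC: "((\<lambda>y. u y * v y / (2 * y * sqrt y)) has_real_derivative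
        ((u y * (- y * u y) + v y * v y) * (2 * y * sqrt y)
          - (u y * v y) * (2 * y * (1 / (2 * r)) + (2 * 1) * sqrt y))
             / ((2 * y * sqrt y) * (2 * y * sqrt y))) (at y)"
      by (intro DERIV_mult' DERIV_divide DERIV_cmult DERIV_ident Du Dv Ds) (use y in simp)
    have DH: "(H has_real_derivative - (3 / 4) * u y * v y / (y\<^sup>2 * sqrt y)) (at y)"
    proof -
      have alg: "(q * (real 2 * (V * U ^ (2 - Suc 0))) + 1 / (2 * q) * U\<^sup>2)
          + ((real 2 * ((- q\<^sup>2 * U) * V ^ (2 - Suc 0))) * q - V\<^sup>2 * (1 / (2 * q))) / (q * q)
          + ((U * (- q\<^sup>2 * U) + V * V) * (2 * q\<^sup>2 * q) - (U * V) * (2 * q\<^sup>2 * (1 / (2 * q)) + (2 * 1) * q))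
             / ((2 * q\<^sup>2 * q) * (2 * q\<^sup>2 * q))
          = - (3 / 4) * U * V / ((q\<^sup>2)\<^sup>2 * q)" if "q > 0" for q U V :: real
        using that by (simp add: divide_simps power2_eq_square) (simp add: algebra_simps)
      note * = DERIV_add[OF DP DC, unfolded y0(2)]
      show ?thesis
        unfolding H_def P_def y0(2) using * alg[OF r(1), of "v y" "u y"]
        unfolding r(2)[symmetric] by simp
    qed
    have Dq: "((\<lambda>y. 1 / (3 * (y * sqrt y))) has_real_derivative - 1 / (2 * (y\<^sup>2 * sqrt y))) (at y)"
    proof -
      have "((\<lambda>y. 1 / (3 * (y * sqrt y))) has_real_derivative 
         (0 * (3 * (y * sqrt y)) - 1 * (3 * (y * (1 / (2 * r)) + 1 * sqrt y))) / ((3 * (y * sqrt y)) * (3 * (y * sqrt y)))) (at y)"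
        by (intro DERIV_divide DERIV_const DERIV_cmult DERIV_mult' DERIV_ident Ds) (use y in simp)
      also have "(0 * (3 * (y * sqrt y)) - 1 * (3 * (y * (1 / (2 * r)) + 1 * sqrt y))) / ((3 * (y * sqrt y)) * (3 * (y * sqrt y)))
         = - 1 / (2 * (y\<^sup>2 * sqrt y))"
        unfolding y0(2) unfolding r(2) using r(1) by (simp add: field_simps power2_eq_square)
      finally show ?thesis .
    qed
    have DE: "((\<lambda>y. exp (1 / (3 * (y * sqrt y)))) has_real_derivative ?E * (- 1 / (2 * (y\<^sup>2 * sqrt y)))) (at y)"
      by (rule DERIV_fun_exp[OF Dq])
    have "(T has_real_derivative H y * (?E * (- 1 / (2 * (y\<^sup>2 * sqrt y)))) +
        (- (3 / 4) * u y * v y / (y\<^sup>2 * sqrt y)) * ?E) (at y)"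
      unfolding T_def using DERIV_mult'[OF DH DE] by simp
    also have "H y * (?E * (- 1 / (2 * (y\<^sup>2 * sqrt y)))) + (- (3 / 4) * u y * v y / (y\<^sup>2 * sqrt y)) * ?E
      = (- (H y / 2 + 3 / 4 * (u y * v y))) * (?E / (y\<^sup>2 * sqrt y))"
    proof -
      have "h * (e * (- 1 / (2 * d))) + - (3 / 4) * a * b / d * e
          = - (h / 2 + 3 / 4 * (a * b)) * (e / d)" for h e d a b :: real
        by (cases "d = 0") (simp_all add: field_simps)
      then show ?thesis .
    qed
    finally show "(T has_real_derivative (- (H y / 2 + 3 / 4 * (u y * v y))) * (?E / (y\<^sup>2 * sqrt y))) (at y)" .
    have "0 \<le> H y / 2 + 3 / 4 * (u y * v y)" using HP[of y] amgm[of y] y by linarith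
    then have "- (H y / 2 + 3 / 4 * (u y * v y)) \<le> 0" by linarith
    then show "(- (H y / 2 + 3 / 4 * (u y * v y))) * (?E / (y\<^sup>2 * sqrt y)) \<le> 0"
      by (rule mult_nonpos_nonneg[OF _ divide_nonneg_nonneg]) (use y in simp_all)
  qed
  have bound: "(u x)\<^sup>2 \<le> (4 / 3 * T 1) / sqrt x" if "x \<ge> 1" for x
  proof -
    have P0: "0 \<le> sqrt x * (u x)\<^sup>2" "0 \<le> (v x)\<^sup>2 / sqrt x" using that by auto
    have H0: "3 / 4 * (sqrt x * (u x)\<^sup>2) \<le> H x"
      using HP[OF that] P0 unfolding P_def distrib_left by argo
    have "H x * 1 \<le> H x * exp (1 / (3 * (x * sqrt x)))"
      using H0 P0 that by (intro mult_left_mono) (simp, argo)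
    then have "3 / 4 * (sqrt x * (u x)\<^sup>2) \<le> T 1"
      using T_dec[OF that] H0 unfolding T_def by linarith
    then have "(u x)\<^sup>2 * sqrt x \<le> 4 / 3 * T 1" by (simp only: mult.commute)
    moreover have "sqrt x > 0" using that by simp
    ultimately show ?thesis by (simp only: pos_le_divide_eq)
  qed
  have "((\<lambda>x::real. (4 / 3 * T 1) / sqrt x) \<longlongrightarrow> 0) at_top"
    by (rule tendsto_divide_0[OF tendsto_const filterlim_at_top_imp_at_infinity[OF sqrt_at_top]])
  then have "((\<lambda>x. (u x)\<^sup>2) \<longlongrightarrow> 0) at_top"
    by (rule tendsto_sandwich[OF _ _ tendsto_const, rotated 2])
      (rule always_eventually, simp, rule eventually_mono[OF eventually_ge_at_top[of 1]], erule bound)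
  then have "((\<lambda>x. sqrt ((u x)\<^sup>2)) \<longlongrightarrow> sqrt 0) at_top" by (rule tendsto_real_sqrt)
  then have "((\<lambda>x. \<bar>u x\<bar>) \<longlongrightarrow> 0) at_top" by simp
  then show ?thesis unfolding u_def by (rule tendsto_rabs_zero_cancel)
qed

section \<open>Energy of the fundamental solution in the frequency variable\<close>

lemma has_bochner_integral_even:
  fixes f :: "real \<Rightarrow> real"
  assumes even: "\<And>x. f (- x) = f x" and meas: "f \<in> borel_measurable lborel"
    and int: "set_integrable lborel {0<..} f"
  shows "has_bochner_integral lborel f (2 * (LINT x:{0..}|lborel. f x))"
proof -
  have eq: "(LINT x:{0..}|lborel. f x) = (LINT x:{0<..}|lborel. f x)"
    unfolding set_lebesgue_integral_def
  proof (rule integral_cong_AE)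
    show "AE x in lborel. indicator {0..} x *\<^sub>R f x = indicator {0<..} x *\<^sub>R f x"
      using AE_lborel_singleton[of 0] by eventually_elim (auto simp: indicator_def)
  qed (use meas in measurable)
  let ?g = "\<lambda>x. indicator {0<..} x *\<^sub>R f x"
  have g: "has_bochner_integral lborel ?g (LINT x:{0<..}|lborel. f x)"
    using int by (simp add: set_integrable_def set_lebesgue_integral_def has_bochner_integral_integrable)
  then have "has_bochner_integral lborel (\<lambda>x. ?g (0 + (- 1) * x)) ((LINT x:{0<..}|lborel. f x) /\<^sub>R \<bar>- 1\<bar>)"
    by (subst (asm) lborel_has_bochner_integral_real_affine_iff[of "- 1" _ _ 0]) simp_all
  from has_bochner_integral_add[OF g this]
  have "has_bochner_integral lborel (\<lambda>x. ?g x + ?g (0 + (- 1) * x)) (2 * (LINT x:{0<..}|lborel. f x))"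
    by simp
  moreover have "AE x in lborel. ?g x + ?g (0 + (- 1) * x) = f x"
    using AE_lborel_singleton[of 0] by eventually_elim (auto simp: indicator_def even)
  ultimately show ?thesis
    unfolding eq
    by (subst has_bochner_integral_cong_AE[symmetric, of "\<lambda>x. ?g x + ?g (0 + (- 1) * x)"])
      (use meas in auto)
qed

lemma integral_odd:
  fixes f :: "real \<Rightarrow> 'a :: {banach, second_countable_topology}"
  assumes "\<And>x. f (- x) = - f x"
  shows "(LINT x|lborel. f x) = 0"
proof -
  have "(LINT x|lborel. f x) = (LINT x|lborel. - f x)"
    using lborel_integral_real_affine[of "- 1" f 0] assms by simp
  then have "2 *\<^sub>R (LINT x|lborel. f x) = 0"
    by (metis add.right_inverse integral_minus scaleR_2)
  then show ?thesis by simp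
qed

text \<open>
  Up to scaling, the kernel of Fejer on the real line. Division by zero gives the value \<open>0\<close> at
  \<open>v = 0\<close>, which integrals ignore.
\<close>
definition fejer_kernel :: "real \<Rightarrow> real" where "fejer_kernel v = (1 - cos v) / v\<^sup>2"

lemma fejer_kernel_nonneg: "0 \<le> fejer_kernel v"
  by (simp add: fejer_kernel_def)

lemma borel_measurable_fejer_kernel [measurable]: "fejer_kernel \<in> borel_measurable borel"
  unfolding fejer_kernel_def by measurable

text \<open>
  Integration by parts: \<open>Si v - (1 - cos v) / v\<close> is an antiderivative on the positive half-line,
  and the sine integral tends to \<open>pi / 2\<close>.
\<close>
lemma has_bochner_integral_fejer_kernel: "has_bochner_integral lborel fejer_kernel pi"
proof -
  define F where "F v = Si v - (1 - cos v) / v" for v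
  have DF: "(F has_real_derivative fejer_kernel v) (at v)" if "v > 0" for v
  proof -
    have "((\<lambda>v. (1 - cos v) / v) has_real_derivative ((0 - - sin v) * v - (1 - cos v) * 1) / (v * v)) (at v)"
      by (intro DERIV_divide DERIV_diff DERIV_const DERIV_cos DERIV_ident) (use that in simp)
    from DERIV_diff[OF DERIV_Si this] 
    have "(F has_real_derivative sinc v - ((0 - - sin v) * v - (1 - cos v) * 1) / (v * v)) (at v)"
      unfolding F_def .
    also have "sinc v - ((0 - - sin v) * v - (1 - cos v) * 1) / (v * v) = fejer_kernel v"
      using that by (simp add: fejer_kernel_def power2_eq_square diff_divide_distrib)
    finally show ?thesis .
  qed
  have lim0: "(F \<longlongrightarrow> 0) (at_right 0)"
  proof -
    have "((\<lambda>v. (1 - cos v) / v) \<longlongrightarrow> 0) (at (0::real))"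
      using DERIV_cos[of "0::real"] tendsto_minus[of "\<lambda>h. (cos (0 + h) - cos 0) / h" 0 "at (0::real)"]
      by (simp add: DERIV_def minus_divide_left)
    moreover have "(Si \<longlongrightarrow> Si 0) (at 0)" using isCont_Si[of 0] by (simp add: isCont_def)
    ultimately have "(F \<longlongrightarrow> Si 0 - 0) (at 0)" unfolding F_def by (rule tendsto_diff[rotated])
    moreover have "Si 0 = 0" by (simp add: Si_def zero_ereal_def)
    ultimately show ?thesis by (simp add: filterlim_at_split)
  qed
  have limT: "(F \<longlongrightarrow> pi / 2) at_top"
  proof -
    have "((\<lambda>v::real. (1 - cos v) / v) \<longlongrightarrow> 0) at_top"
    proof (rule Lim_null_comparison)
      show "((\<lambda>v::real. 2 / v) \<longlongrightarrow> 0) at_top"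
        by (rule tendsto_divide_0[OF tendsto_const filterlim_at_top_imp_at_infinity[OF filterlim_ident]])
      show "\<forall>\<^sub>F v in at_top. norm ((1 - cos v) / v) \<le> 2 / (v::real)"
        using eventually_gt_at_top[of 0]
      proof eventually_elim
        case (elim v)
        have "\<bar>1 - cos v\<bar> \<le> 2" using cos_ge_minus_one[of v] cos_le_one[of v] by linarith
        then show ?case using elim by (simp add: divide_right_mono)
      qed
    qed
    from tendsto_diff[OF Si_at_top this] show ?thesis unfolding F_def by simp
  qed
  have cont: "isCont fejer_kernel v" if "v > 0" for v
    unfolding fejer_kernel_def using that by (intro continuous_intros) auto
  have L: "((F \<circ> real_of_ereal) \<longlongrightarrow> 0) (at_right 0)"
    using lim0 by (simp add: ereal_tendsto_simps zero_ereal_def)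
  have R: "((F \<circ> real_of_ereal) \<longlongrightarrow> pi / 2) (at_left \<infinity>)"
    using limT by (simp add: ereal_tendsto_simps)
  have nonneg: "AE x in lborel. 0 < ereal x \<longrightarrow> ereal x < \<infinity> \<longrightarrow> 0 \<le> fejer_kernel x"
    by (simp add: fejer_kernel_nonneg)
  note FTC = interval_integral_FTC_nonneg[OF _ _ _ nonneg L R]
  have int: "set_integrable lborel (einterval 0 \<infinity>) fejer_kernel"
    by (rule FTC) (simp_all add: DF cont)
  have val: "(LBINT x=0..\<infinity>. fejer_kernel x) = pi / 2 - 0"
    by (rule FTC) (simp_all add: DF cont)
  have *: "einterval 0 \<infinity> = {0::real<..}" by (auto simp: einterval_def)
  have "has_bochner_integral lborel fejer_kernel (2 * (LINT x:{0..}|lborel. fejer_kernel x))"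
    by (rule has_bochner_integral_even) (use int in \<open>auto simp: * fejer_kernel_def\<close>)
  moreover have "(LINT x:{0..}|lborel. fejer_kernel x) = (LINT x:{0<..}|lborel. fejer_kernel x)"
    unfolding set_lebesgue_integral_def
    by (rule Bochner_Integration.integral_cong) (auto simp: fejer_kernel_def indicator_def)
  moreover have "(LINT x:{0<..}|lborel. fejer_kernel x) = pi / 2"
    using val by (simp add: interval_lebesgue_integral_0_infty)
  ultimately show ?thesis by simp
qed

text \<open>
  The absolute value makes this an even function of the frequency on the whole line, so that
  Fourier integrals over the line and over the half-line can be exchanged.
\<close>
definition tricomi_energy :: "real \<Rightarrow> real \<Rightarrow> real" where
  "tricomi_energy t \<rho> = (LINT s:{0..t}|lborel. (tricomi_C t s \<bar>\<rho>\<bar>)\<^sup>2)"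

lemma tricomi_energy_nonneg: "0 \<le> tricomi_energy t \<rho>"
  unfolding tricomi_energy_def set_lebesgue_integral_def by (rule integral_nonneg_AE) simp

lemma tricomi_energy_even: "tricomi_energy t (- \<rho>) = tricomi_energy t \<rho>"
  by (simp add: tricomi_energy_def)

abbreviation (input) airy_weight :: "real \<Rightarrow> real \<Rightarrow> real" where
  "airy_weight t r \<equiv> 1 - (airy_f (- (\<bar>r\<bar> powr (2/3)) * t))\<^sup>2"

lemma tricomi_energy_eq:
  assumes "\<rho> \<noteq> 0" "t \<ge> 0"
  shows "tricomi_energy t \<rho> = airy_weight t \<rho> / \<rho>\<^sup>2"
  using tricomi_C_square_integral[of "\<bar>\<rho>\<bar>" t] assms by (simp add: tricomi_energy_def)

text \<open>
  The first bound controls high frequencies, the second low ones; together they make the energy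
  integrable.
\<close>
lemma tricomi_energy_bounds:
  assumes "\<rho> \<noteq> 0" "t \<ge> 0"
  shows "tricomi_energy t \<rho> \<le> 1 / \<rho>\<^sup>2" "tricomi_energy t \<rho> \<le> t ^ 3 / 3"
proof -
  define x where "x = \<bar>\<rho>\<bar> powr (2/3) * t"
  have x0: "x \<ge> 0" using assms by (simp add: x_def)
  have x3: "x ^ 3 = \<rho>\<^sup>2 * t ^ 3"
  proof -
    have "(\<bar>\<rho>\<bar> powr (2/3)) ^ 3 = (\<bar>\<rho>\<bar> powr (2/3)) powr 3" using assms by (simp flip: powr_numeral)
    also have "\<dots> = \<bar>\<rho>\<bar> powr 2" by (simp add: powr_powr)
    also have "\<dots> = \<rho>\<^sup>2" using assms by simp
    finally show ?thesis by (simp add: x_def power_mult_distrib)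
  qed
  have eq: "tricomi_energy t \<rho> = (1 - (airy_f (- x))\<^sup>2) / \<rho>\<^sup>2"
    using tricomi_energy_eq[OF assms] by (simp add: x_def)
  show "tricomi_energy t \<rho> \<le> 1 / \<rho>\<^sup>2" unfolding eq by (intro divide_right_mono) auto
  have "1 - (airy_f (- x))\<^sup>2 = (1 + airy_f (- x)) * (1 - airy_f (- x))"
    by (simp add: power2_eq_square algebra_simps)
  also have "\<dots> \<le> 2 * (x ^ 3 / 6)"
    using airy_f_le_1[OF x0] airy_f_near_0[OF x0] by (intro mult_mono) auto
  finally have "tricomi_energy t \<rho> \<le> (x ^ 3 / 3) / \<rho>\<^sup>2"
    unfolding eq by (intro divide_right_mono) auto
  also have "\<dots> = t ^ 3 / 3" unfolding x3 using assms by simp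
  finally show "tricomi_energy t \<rho> \<le> t ^ 3 / 3" .
qed

lemma borel_measurable_tricomi_energy:
  assumes "t \<ge> 0"
  shows "tricomi_energy t \<in> borel_measurable borel"
proof -
  have "tricomi_energy t = (\<lambda>\<rho>. if \<rho> = 0 then tricomi_energy t 0
      else airy_weight t \<rho> / \<rho>\<^sup>2)"
    using tricomi_energy_eq assms by auto
  also have "\<dots> \<in> borel_measurable borel" by measurable
  finally show ?thesis .
qed

lemma integrable_tricomi_energy:
  assumes t: "t \<ge> 0"
  shows "integrable lborel (tricomi_energy t)"
proof (rule Bochner_Integration.integrable_bound)
  have "einterval (- \<infinity>) \<infinity> = (UNIV :: real set)" by (auto simp: einterval_def)
  then show "integrable lborel (\<lambda>x. (1 + t ^ 3 / 3) * inverse (1 + x\<^sup>2))"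
    using integrable_inverse_1_plus_square by (simp add: set_integrable_def)
  show "tricomi_energy t \<in> borel_measurable lborel"
    using borel_measurable_tricomi_energy[OF t] by simp
  show "AE \<rho> in lborel. norm (tricomi_energy t \<rho>) \<le> norm ((1 + t ^ 3 / 3) * inverse (1 + \<rho>\<^sup>2))"
    using AE_lborel_singleton[of 0]
  proof eventually_elim
    case (elim \<rho>)
    have "\<rho>\<^sup>2 * tricomi_energy t \<rho> \<le> 1"
      using tricomi_energy_bounds(1)[OF elim t] elim by (simp add: field_simps)
    then have "tricomi_energy t \<rho> * (1 + \<rho>\<^sup>2) \<le> 1 + t ^ 3 / 3"
      using tricomi_energy_bounds(2)[OF elim t] by (simp add: algebra_simps)
    moreover have p: "1 + \<rho>\<^sup>2 > 0" by (simp add: add_pos_nonneg)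
    ultimately have "tricomi_energy t \<rho> \<le> (1 + t ^ 3 / 3) / (1 + \<rho>\<^sup>2)"
      by (simp only: pos_le_divide_eq)
    moreover from this have "0 \<le> (1 + t ^ 3 / 3) / (1 + \<rho>\<^sup>2)"
      by (rule order.trans[OF tricomi_energy_nonneg])
    ultimately show ?case
      by (simp only: real_norm_def abs_of_nonneg tricomi_energy_nonneg divide_inverse[symmetric])
  qed
qed

text \<open>
  The closed form of the energy turns the substitution \<open>\<rho> = v / h\<close> into an exact identity.
\<close>
lemma integral_one_minus_cos_energy:
  assumes t: "t \<ge> 0" and h: "h \<noteq> 0"
  shows "(LINT \<rho>|lborel. (1 - cos (\<rho> * h)) * tricomi_energy t \<rho>) =
    \<bar>h\<bar> * (LINT v|lborel. fejer_kernel v * airy_weight t (v / h))"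
proof -
  have "(LINT \<rho>|lborel. (1 - cos (\<rho> * h)) * tricomi_energy t \<rho>)
      = \<bar>1 / h\<bar> *\<^sub>R (LINT v|lborel. (1 - cos ((0 + 1 / h * v) * h)) * tricomi_energy t (0 + 1 / h * v))"
    by (rule lborel_integral_real_affine) (use h in simp)
  also have "(LINT v|lborel. (1 - cos ((0 + 1 / h * v) * h)) * tricomi_energy t (0 + 1 / h * v))
      = (LINT v|lborel. h\<^sup>2 * (fejer_kernel v * airy_weight t (v / h)))"
  proof (rule Bochner_Integration.integral_cong)
    fix v :: real
    show "(1 - cos ((0 + 1 / h * v) * h)) * tricomi_energy t (0 + 1 / h * v)
      = h\<^sup>2 * (fejer_kernel v * airy_weight t (v / h))"
      using tricomi_energy_eq[of "v / h" t] h t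
      by (cases "v = 0") (simp_all add: fejer_kernel_def power_divide)
  qed simp
  also have "\<dots> = h\<^sup>2 * (LINT v|lborel. fejer_kernel v * airy_weight t (v / h))"
    by simp
  also have "\<bar>1 / h\<bar> *\<^sub>R (h\<^sup>2 * (LINT v|lborel. fejer_kernel v * airy_weight t (v / h)))
     = \<bar>h\<bar> * (LINT v|lborel. fejer_kernel v * airy_weight t (v / h))"
    using h by (simp add: power2_eq_square abs_if)
  finally show ?thesis .
qed

lemma airy_weight_bounds:
  assumes "t \<ge> 0"
  shows "0 \<le> airy_weight t r" "airy_weight t r \<le> 1"
  using airy_f_le_1[of "\<bar>r\<bar> powr (2/3) * t"] assms by (auto simp: abs_square_le_1)

lemma integral_one_minus_cos_energy_le:
  assumes t: "t \<ge> 0"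
  shows "(LINT \<rho>|lborel. (1 - cos (\<rho> * h)) * tricomi_energy t \<rho>) \<le> pi * \<bar>h\<bar>"
proof (cases "h = 0")
  case False
  have "(LINT v|lborel. fejer_kernel v * airy_weight t (v / h)) \<le> (LINT v|lborel. fejer_kernel v)"
  proof (rule integral_mono')
    show "integrable lborel fejer_kernel"
      using has_bochner_integral_fejer_kernel by (rule integrable.intros)
    show "fejer_kernel v * airy_weight t (v / h) \<le> fejer_kernel v" for v
      using airy_weight_bounds[OF t, of "v / h"] fejer_kernel_nonneg[of v] by (intro mult_left_le) auto
  qed (rule fejer_kernel_nonneg)
  also have "\<dots> = pi" using has_bochner_integral_fejer_kernel by (rule has_bochner_integral_integral_eq)
  finally show ?thesis
    unfolding integral_one_minus_cos_energy[OF t False]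
    by (subst mult.commute) (intro mult_right_mono, auto)
qed simp

lemma powr_filterlim_at_top:
  assumes "a > 0"
  shows "filterlim (\<lambda>x::real. x powr a) at_top at_top"
proof -
  have "filterlim (\<lambda>x::real. exp (a * ln x)) at_top at_top"
    using assms
    by (intro filterlim_compose[OF exp_at_top] filterlim_tendsto_pos_mult_at_top[OF tendsto_const _ ln_at_top])
  moreover have "\<forall>\<^sub>F x in at_top. exp (a * ln x) = x powr a"
    using eventually_gt_at_top[of 0] by eventually_elim (simp add: powr_def)
  ultimately show ?thesis by (simp cong: filterlim_cong)
qed

text \<open>
  As \<open>h\<close> tends to \<open>0\<close>, \<open>f\<close> is evaluated at points tending to minus infinity, so the weight
  converges to \<open>1\<close> and dominated convergence applies.
\<close>
lemma integral_one_minus_cos_energy_asymp: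
  assumes t: "t > 0"
  shows "((\<lambda>h. (LINT \<rho>|lborel. (1 - cos (\<rho> * h)) * tricomi_energy t \<rho>) / \<bar>h\<bar>) \<longlongrightarrow> pi) (at 0)"
proof -
  let ?K = "\<lambda>h v. fejer_kernel v * airy_weight t (v / h)"
  have "((\<lambda>h. LINT v|lborel. ?K h v) \<longlongrightarrow> pi) (at 0)"
    unfolding tendsto_at_iff_sequentially comp_def
  proof (intro allI impI)
    fix X :: "nat \<Rightarrow> real" assume X: "\<forall>i. X i \<in> UNIV - {0}" "X \<longlonglongrightarrow> 0"
    have "(\<lambda>i. LINT v|lborel. ?K (X i) v) \<longlonglongrightarrow> (LINT v|lborel. fejer_kernel v)"
    proof (rule integral_dominated_convergence[where w = fejer_kernel])
      show "integrable lborel fejer_kernel"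
        using has_bochner_integral_fejer_kernel by (rule integrable.intros)
      show "AE v in lborel. norm (?K (X i) v) \<le> fejer_kernel v" for i
      proof (rule AE_I2)
        fix v
        have "fejer_kernel v * airy_weight t (v / X i) \<le> fejer_kernel v"
          using airy_weight_bounds[of t "v / X i"] t fejer_kernel_nonneg[of v] by (intro mult_left_le) auto
        then show "norm (?K (X i) v) \<le> fejer_kernel v"
          using airy_weight_bounds[of t "v / X i"] t fejer_kernel_nonneg[of v] by (simp add: abs_mult)
      qed
      show "AE v in lborel. (\<lambda>i. ?K (X i) v) \<longlonglongrightarrow> fejer_kernel v"
        using AE_lborel_singleton[of 0]
      proof eventually_elim
        case (elim v)
        have "filterlim (\<lambda>i. \<bar>X i\<bar>) (at_right 0) sequentially"
        proof -
          have "\<forall>\<^sub>F i in sequentially. \<bar>X i\<bar> \<in> {0<..} \<and> \<bar>X i\<bar> \<noteq> 0"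
            using X(1) by simp
          then show ?thesis
            unfolding filterlim_at using tendsto_rabs_zero[OF X(2)] by blast
        qed
        then have "filterlim (\<lambda>i. inverse \<bar>X i\<bar>) at_top sequentially"
          by (rule filterlim_compose[OF filterlim_inverse_at_top_right])
        then have "filterlim (\<lambda>i. \<bar>v\<bar> * inverse \<bar>X i\<bar>) at_top sequentially"
          using elim by (intro filterlim_tendsto_pos_mult_at_top[OF tendsto_const]) auto
        then have "filterlim (\<lambda>i. \<bar>v / X i\<bar>) at_top sequentially"
          by (simp add: divide_inverse abs_mult)
        then have "filterlim (\<lambda>i. \<bar>v / X i\<bar> powr (2/3)) at_top sequentially"
          by (rule filterlim_compose[OF powr_filterlim_at_top, rotated]) simp
        then have "filterlim (\<lambda>i. t * \<bar>v / X i\<bar> powr (2/3)) at_top sequentially"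
          using t by (intro filterlim_tendsto_pos_mult_at_top[OF tendsto_const]) auto
        then have "(\<lambda>i. airy_f (- (t * \<bar>v / X i\<bar> powr (2/3)))) \<longlonglongrightarrow> 0"
          by (rule filterlim_compose[OF airy_f_decay])
        then have "(\<lambda>i. fejer_kernel v * (1 - (airy_f (- (t * \<bar>v / X i\<bar> powr (2/3))))\<^sup>2)) \<longlonglongrightarrow> fejer_kernel v * (1 - 0\<^sup>2)"
          by (intro tendsto_intros)
        then show ?case by (simp add: mult.commute)
      qed
    qed auto
    then show "(\<lambda>i. LINT v|lborel. ?K (X i) v) \<longlonglongrightarrow> pi"
      by (simp only: has_bochner_integral_integral_eq[OF has_bochner_integral_fejer_kernel])
  qed
  moreover have "\<forall>\<^sub>F h in at 0. (LINT v|lborel. ?K h v)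
      = (LINT \<rho>|lborel. (1 - cos (\<rho> * h)) * tricomi_energy t \<rho>) / \<bar>h\<bar>"
    using t by (auto simp: eventually_at_filter integral_one_minus_cos_energy)
  ultimately show ?thesis by (rule Lim_transform_eventually)
qed

text \<open>
  Were the integral zero, the energy would vanish almost everywhere, in contradiction to the
  positive limit just obtained.
\<close>
lemma integral_tricomi_energy_pos:
  assumes t: "t > 0"
  shows "(LINT \<rho>|lborel. tricomi_energy t \<rho>) > 0"
proof (rule ccontr)
  assume "\<not> (LINT \<rho>|lborel. tricomi_energy t \<rho>) > 0"
  then have "(LINT \<rho>|lborel. tricomi_energy t \<rho>) = 0"
    using integral_nonneg_AE[of "tricomi_energy t" lborel] tricomi_energy_nonneg by (smt (verit) AE_I2)
  then have "AE \<rho> in lborel. tricomi_energy t \<rho> = 0"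
    using integral_nonneg_eq_0_iff_AE[of lborel "tricomi_energy t"] integrable_tricomi_energy t tricomi_energy_nonneg
    by auto
  then have "AE \<rho> in lborel. (1 - cos (\<rho> * h)) * tricomi_energy t \<rho> = 0" for h by eventually_elim simp
  then have "(LINT \<rho>|lborel. (1 - cos (\<rho> * h)) * tricomi_energy t \<rho>) = 0" for h
    by (rule integral_eq_zero_AE)
  then have "((\<lambda>h::real. 0) \<longlongrightarrow> pi) (at 0)"
    using integral_one_minus_cos_energy_asymp[OF t] by simp
  from tendsto_unique[OF _ this tendsto_const] show False by simp
qed

section \<open>Orthonormal systems and completeness of square integrable functions\<close>

lemma square_integrable_real:
  fixes f :: "'a \<Rightarrow> real"
  shows "square_integrable M f \<longleftrightarrow> f \<in> borel_measurable M \<and> integrable M (\<lambda>x. (f x)\<^sup>2)"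
  by (simp add: square_integrable_def)

lemma square_integrable_mult:
  fixes f g :: "'a \<Rightarrow> real"
  assumes "square_integrable M f" "square_integrable M g"
  shows "integrable M (\<lambda>x. f x * g x)"
proof (rule Bochner_Integration.integrable_bound)
  show "integrable M (\<lambda>x. (f x)\<^sup>2 + (g x)\<^sup>2)"
    using assms by (simp add: square_integrable_real)
  show "(\<lambda>x. f x * g x) \<in> borel_measurable M"
    using assms by (auto simp: square_integrable_real)
  have "\<bar>a * b\<bar> \<le> \<bar>a\<^sup>2 + b\<^sup>2\<bar>" for a b :: real
  proof -
    have "0 \<le> (\<bar>a\<bar> - \<bar>b\<bar>)\<^sup>2" by simp
    then have "2 * \<bar>a * b\<bar> \<le> a\<^sup>2 + b\<^sup>2" by (simp add: power2_diff abs_mult)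
    moreover have "0 \<le> \<bar>a * b\<bar>" by simp
    ultimately show ?thesis by linarith
  qed
  then show "AE x in M. norm (f x * g x) \<le> norm ((f x)\<^sup>2 + (g x)\<^sup>2)" by simp
qed

lemma square_integrable_add:
  fixes f g :: "'a \<Rightarrow> real"
  assumes "square_integrable M f" "square_integrable M g"
  shows "square_integrable M (\<lambda>x. f x + g x)"
  using assms square_integrable_mult[OF assms]
  by (auto simp: square_integrable_real power2_sum mult.assoc)

lemma square_integrable_cmult:
  fixes f :: "'a \<Rightarrow> real"
  assumes "square_integrable M f"
  shows "square_integrable M (\<lambda>x. c * f x)"
  using assms by (auto simp: square_integrable_real power_mult_distrib)

lemma square_integrable_diff:
  fixes f g :: "'a \<Rightarrow> real"
  assumes "square_integrable M f" "square_integrable M g"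
  shows "square_integrable M (\<lambda>x. f x - g x)"
  using square_integrable_add[OF assms(1) square_integrable_cmult[OF assms(2), of "- 1"]] by simp

lemma square_integrable_sum:
  fixes e :: "'i \<Rightarrow> 'a \<Rightarrow> real"
  assumes "\<And>i. i \<in> I \<Longrightarrow> square_integrable M (e i)"
  shows "square_integrable M (\<lambda>x. \<Sum>i\<in>I. c i * e i x)"
  using assms
proof (induction I rule: infinite_finite_induct)
  case (insert i I)
  then show ?case by (simp add: square_integrable_add square_integrable_cmult)
qed (simp_all add: square_integrable_real)

lemma square_integrable_diff_integral:
  fixes f g :: "'a \<Rightarrow> real"
  assumes f: "square_integrable M f" and g: "square_integrable M g"
  shows "(LINT x|M. (f x - g x)\<^sup>2) = (LINT x|M. (f x)\<^sup>2) - 2 * (LINT x|M. f x * g x) + (LINT x|M. (g x)\<^sup>2)"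
proof -
  have "(LINT x|M. (f x - g x)\<^sup>2) = (LINT x|M. (f x)\<^sup>2 - 2 * (f x * g x) + (g x)\<^sup>2)"
    by (simp add: power2_diff algebra_simps)
  also have "\<dots> = (LINT x|M. (f x)\<^sup>2) - 2 * (LINT x|M. f x * g x) + (LINT x|M. (g x)\<^sup>2)"
    using assms square_integrable_mult[OF f g] by (simp add: square_integrable_real)
  finally show ?thesis .
qed

lemma L2_Cauchy_Schwarz:
  fixes f g :: "'a \<Rightarrow> real"
  assumes f: "square_integrable M f" and g: "square_integrable M g"
  shows "(LINT x|M. f x * g x)\<^sup>2 \<le> (LINT x|M. (f x)\<^sup>2) * (LINT x|M. (g x)\<^sup>2)"
proof (cases "(LINT x|M. (g x)\<^sup>2) = 0")
  case True
  have "AE x in M. (g x)\<^sup>2 = 0"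
    using True g by (subst (asm) integral_nonneg_eq_0_iff_AE) (auto simp: square_integrable_real)
  then have "(LINT x|M. f x * g x) = 0" by (intro integral_eq_zero_AE) auto
  then show ?thesis by (simp add: True)
next
  case False
  define G where "G = (LINT x|M. (g x)\<^sup>2)"
  define P where "P = (LINT x|M. f x * g x)"
  have "0 \<le> G" unfolding G_def by (rule integral_nonneg_AE) simp
  then have G: "G > 0" using False by (simp add: G_def order.strict_iff_order)
  have "0 \<le> (LINT x|M. (f x - P / G * g x)\<^sup>2)" by (rule integral_nonneg_AE) simp
  also have "\<dots> = (LINT x|M. (f x)\<^sup>2) - 2 * (P / G * P) + (P / G)\<^sup>2 * G"
  proof -
    have "(LINT x|M. f x * (P / G * g x)) = P / G * P"
      unfolding P_def by (subst mult.left_commute) simp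
    moreover have "(LINT x|M. (P / G * g x)\<^sup>2) = (P / G)\<^sup>2 * G"
      unfolding G_def power_mult_distrib by simp
    ultimately show ?thesis
      by (simp only: square_integrable_diff_integral[OF f square_integrable_cmult[OF g]])
  qed
  also have "\<dots> = (LINT x|M. (f x)\<^sup>2) - P\<^sup>2 / G"
    using G by (simp add: power2_eq_square)
  finally show ?thesis using G by (simp add: P_def[symmetric] G_def[symmetric] pos_divide_le_eq)
qed

text \<open>
  As for \<^const>\<open>orthonormal_basis_L2\<close>, the value at index \<open>0\<close> is ignored.
\<close>
definition orthonormal_L2 :: "'a measure \<Rightarrow> (nat \<Rightarrow> 'a \<Rightarrow> real) \<Rightarrow> bool" where
  "orthonormal_L2 M e \<longleftrightarrow> (\<forall>m\<ge>1. square_integrable M (e m)) \<and>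
     (\<forall>m\<ge>1. \<forall>n\<ge>1. (LINT x|M. e m x * e n x) = (if m = n then 1 else 0))"

lemma orthonormal_L2_norm_sum:
  assumes e: "orthonormal_L2 M e" and I: "finite I" "I \<subseteq> {1..}"
  shows "(LINT x|M. (\<Sum>m\<in>I. c m * e m x)\<^sup>2) = (\<Sum>m\<in>I. (c m)\<^sup>2)"
proof -
  have sq: "square_integrable M (e m)" if "m \<in> I" for m
    using e I that by (auto simp: orthonormal_L2_def)
  have int: "integrable M (\<lambda>x. e m x * e n x)" if "m \<in> I" "n \<in> I" for m n
    using sq that by (intro square_integrable_mult)
  have "(LINT x|M. (\<Sum>m\<in>I. c m * e m x)\<^sup>2) = (LINT x|M. (\<Sum>m\<in>I. \<Sum>n\<in>I. c m * c n * (e m x * e n x)))"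
    by (simp add: power2_eq_square sum_product mult_ac)
  also have "\<dots> = (\<Sum>m\<in>I. \<Sum>n\<in>I. c m * c n * (LINT x|M. e m x * e n x))"
    by (simp add: int)
  also have "\<dots> = (\<Sum>m\<in>I. \<Sum>n\<in>I. if m = n then c m * c n else 0)"
  proof (intro sum.cong refl)
    fix m n assume "m \<in> I" "n \<in> I"
    then have "m \<ge> 1" "n \<ge> 1" using I by auto
    then have "(LINT x|M. e m x * e n x) = (if m = n then 1 else 0)"
      using e unfolding orthonormal_L2_def by blast
    then show "c m * c n * (LINT x|M. e m x * e n x) = (if m = n then c m * c n else 0)" by simp
  qed
  also have "\<dots> = (\<Sum>m\<in>I. (c m)\<^sup>2)"
    using I by (simp add: power2_eq_square)
  finally show ?thesis .
qed

text \<open>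
  The quantitative form of Bessel's inequality: the distance to a partial expansion.
\<close>
lemma orthonormal_L2_bessel:
  assumes e: "orthonormal_L2 M e" and I: "finite I" "I \<subseteq> {1..}" and f: "square_integrable M f"
  shows "(LINT x|M. (f x - (\<Sum>m\<in>I. (LINT y|M. f y * e m y) * e m x))\<^sup>2)
    = (LINT x|M. (f x)\<^sup>2) - (\<Sum>m\<in>I. (LINT y|M. f y * e m y)\<^sup>2)"
proof -
  let ?c = "\<lambda>m. LINT y|M. f y * e m y"
  have sq: "square_integrable M (e m)" if "m \<in> I" for m
    using e I that by (auto simp: orthonormal_L2_def)
  have "(LINT x|M. f x * (\<Sum>m\<in>I. ?c m * e m x)) = (LINT x|M. (\<Sum>m\<in>I. ?c m * (f x * e m x)))"
    by (simp add: sum_distrib_left mult_ac)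
  also have "\<dots> = (\<Sum>m\<in>I. (?c m)\<^sup>2)"
    using square_integrable_mult[OF f sq] by (simp add: power2_eq_square)
  finally have *: "(LINT x|M. f x * (\<Sum>m\<in>I. ?c m * e m x)) = (\<Sum>m\<in>I. (?c m)\<^sup>2)" .
  show ?thesis
    by (subst square_integrable_diff_integral[OF f square_integrable_sum])
      (simp_all add: sq * orthonormal_L2_norm_sum[OF e I])
qed

lemma orthonormal_basis_L2_orthonormal: "orthonormal_basis_L2 M e \<Longrightarrow> orthonormal_L2 M e"
  by (simp add: orthonormal_basis_L2_def orthonormal_L2_def)

lemma orthonormal_basis_L2_parseval:
  assumes e: "orthonormal_basis_L2 M e" and f: "square_integrable M f"
  shows "(\<lambda>N. \<Sum>m=1..N. (LINT x|M. f x * e m x)\<^sup>2) \<longlonglongrightarrow> (LINT x|M. (f x)\<^sup>2)"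
proof -
  let ?c = "\<lambda>m. LINT y|M. f y * e m y"
  have "(\<lambda>N. LINT x|M. (f x - (\<Sum>m=1..N. ?c m * e m x))\<^sup>2) \<longlonglongrightarrow> 0"
    using e f by (simp add: orthonormal_basis_L2_def tendsto_L2_def power2_commute)
  then have "(\<lambda>N. (LINT x|M. (f x)\<^sup>2) - (\<Sum>m=1..N. (?c m)\<^sup>2)) \<longlonglongrightarrow> 0"
    by (subst (asm) orthonormal_L2_bessel[OF orthonormal_basis_L2_orthonormal[OF e] _ _ f]) auto
  from tendsto_diff[OF tendsto_const[of "LINT x|M. (f x)\<^sup>2"] this] show ?thesis by simp
qed

text \<open>
  The theorem of Riesz and Fischer. A subsequence whose consecutive squared distances are at most
  \<open>8\<^sup>-\<^sup>k\<close> has increments that, weighted by \<open>4\<^sup>k\<close>, are square summable almost everywhere; hence they are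
  bounded by a multiple of \<open>2\<^sup>-\<^sup>k\<close> and the subsequence converges pointwise. Fatou's lemma shows that the
  pointwise limit is the limit in mean square.
\<close>
lemma L2_complete:
  fixes S :: "nat \<Rightarrow> 'a \<Rightarrow> real"
  assumes S: "\<And>n. square_integrable M (S n)"
    and Cauchy: "\<And>\<epsilon>. \<epsilon> > 0 \<Longrightarrow> \<exists>N. \<forall>m\<ge>N. \<forall>n\<ge>N. (LINT x|M. (S m x - S n x)\<^sup>2) \<le> \<epsilon>"
  shows "\<exists>g. square_integrable M g \<and> (\<lambda>n. LINT x|M. (S n x - g x)\<^sup>2) \<longlonglongrightarrow> 0"
proof -
  have meas [measurable]: "S n \<in> borel_measurable M" for n using S by (simp add: square_integrable_def)
  have nn: "(\<integral>\<^sup>+x. ennreal ((S m x - S n x)\<^sup>2) \<partial>M) = ennreal (LINT x|M. (S m x - S n x)\<^sup>2)" for m n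
    using square_integrable_diff[OF S S, of m n]
    by (intro nn_integral_eq_integral) (auto simp: square_integrable_real)
  have "\<forall>k. \<exists>N. \<forall>m\<ge>N. \<forall>n\<ge>N. (LINT x|M. (S m x - S n x)\<^sup>2) \<le> (1 / 8) ^ k"
    using Cauchy by simp
  then obtain N where N: "\<And>k m n. m \<ge> N k \<Longrightarrow> n \<ge> N k \<Longrightarrow> (LINT x|M. (S m x - S n x)\<^sup>2) \<le> (1 / 8) ^ k"
    by metis
  \<comment> \<open>Adding the index makes the thresholds tend to infinity, and the partial sums make them monotone.\<close>
  define r where "r k = k + (\<Sum>i\<le>k. N i)" for k
  have r_ge: "N k \<le> r k" "k \<le> r k" for k
    using member_le_sum[of k "{..k}" N] by (auto simp: r_def)
  have r_mono: "r k \<le> r (Suc k)" for k by (simp add: r_def)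
  define D where "D k x = S (r (Suc k)) x - S (r k) x" for k x
  have D_meas [measurable]: "D k \<in> borel_measurable M" for k unfolding D_def by measurable
  have "(\<integral>\<^sup>+x. (\<Sum>k. ennreal (4 ^ k * (D k x)\<^sup>2)) \<partial>M) = (\<Sum>k. \<integral>\<^sup>+x. ennreal (4 ^ k * (D k x)\<^sup>2) \<partial>M)"
    by (rule nn_integral_suminf) measurable
  also have "\<dots> \<le> (\<Sum>k. ennreal ((1 / 2) ^ k))"
  proof (rule suminf_le)
    fix k
    have "(\<integral>\<^sup>+x. ennreal (4 ^ k * (D k x)\<^sup>2) \<partial>M) = ennreal (4 ^ k) * (\<integral>\<^sup>+x. ennreal ((D k x)\<^sup>2) \<partial>M)"
      by (subst nn_integral_cmult[symmetric]) (auto simp: ennreal_mult)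
    also have "\<dots> \<le> ennreal (4 ^ k) * ennreal ((1 / 8) ^ k)"
      unfolding D_def nn using r_ge(1)[of k] r_mono[of k]
      by (intro mult_left_mono ennreal_leI N) auto
    also have "\<dots> = ennreal ((1 / 2) ^ k)"
      by (simp add: ennreal_mult[symmetric] power_mult_distrib[symmetric])
    finally show "(\<integral>\<^sup>+x. ennreal (4 ^ k * (D k x)\<^sup>2) \<partial>M) \<le> ennreal ((1 / 2) ^ k)" .
  qed auto
  also have "(\<Sum>k. ennreal ((1 / 2) ^ k)) < \<infinity>"
    by (subst suminf_ennreal2) (auto intro: summable_geometric)
  finally have "AE x in M. (\<Sum>k. ennreal (4 ^ k * (D k x)\<^sup>2)) \<noteq> \<infinity>"
    by (intro nn_integral_PInf_AE) auto
  then have conv: "AE x in M. convergent (\<lambda>k. S (r k) x)"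
  proof eventually_elim
    case (elim x)
    have summ: "summable (\<lambda>k. 4 ^ k * (D k x)\<^sup>2)"
      by (rule summable_suminf_not_top) (use elim in auto)
    then have "bounded (range (\<lambda>k. 4 ^ k * (D k x)\<^sup>2))"
      by (metis summable_LIMSEQ_zero convergentI convergent_imp_Bseq Bseq_eq_bounded)
    then obtain B where B: "\<And>k. 4 ^ k * (D k x)\<^sup>2 \<le> B"
      by (auto simp: bounded_iff)
    have "summable (\<lambda>k. D k x)"
    proof (rule summable_comparison_test')
      show "summable (\<lambda>k. sqrt B * (1 / 2) ^ k)" by (intro summable_mult summable_geometric) simp
      fix k :: nat
      have "(2 ^ k * \<bar>D k x\<bar>)\<^sup>2 = 4 ^ k * (D k x)\<^sup>2"
      proof -
        have "(4::real) ^ k = (2 ^ k)\<^sup>2" by (simp add: power2_eq_square flip: power_mult_distrib)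
        then show ?thesis by (simp only: power_mult_distrib power2_abs)
      qed
      then have "2 ^ k * \<bar>D k x\<bar> \<le> sqrt B" using B[of k] by (intro real_le_rsqrt) simp
      then show "norm (D k x) \<le> sqrt B * (1 / 2) ^ k" by (simp add: field_simps)
    qed
    then have "convergent (\<lambda>n. \<Sum>k<n. D k x)" by (simp add: summable_iff_convergent)
    then have "convergent (\<lambda>n. S (r 0) x + (\<Sum>k<n. D k x))" by (intro convergent_add convergent_const)
    moreover have "S (r 0) x + (\<Sum>k<n. D k x) = S (r n) x" for n
      unfolding D_def by (subst sum_lessThan_telescope) simp
    ultimately show ?case by simp
  qed
  define g where "g x = lim (\<lambda>k. S (r k) x)" for x
  have g_meas [measurable]: "g \<in> borel_measurable M" unfolding g_def by measurable
  have lim: "AE x in M. (\<lambda>k. S (r k) x) \<longlonglongrightarrow> g x"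
    using conv by eventually_elim (simp add: g_def flip: convergent_LIMSEQ_iff)
  have bound: "(\<integral>\<^sup>+x. ennreal ((S n x - g x)\<^sup>2) \<partial>M) \<le> ennreal \<epsilon>"
    if K: "\<forall>m\<ge>K. \<forall>n\<ge>K. (LINT x|M. (S m x - S n x)\<^sup>2) \<le> \<epsilon>" and n: "n \<ge> K" for K n \<epsilon>
  proof -
    have "(\<integral>\<^sup>+x. ennreal ((S n x - g x)\<^sup>2) \<partial>M)
        = (\<integral>\<^sup>+x. liminf (\<lambda>k. ennreal ((S n x - S (r k) x)\<^sup>2)) \<partial>M)"
    proof (rule nn_integral_cong_AE)
      show "AE x in M. ennreal ((S n x - g x)\<^sup>2) = liminf (\<lambda>k. ennreal ((S n x - S (r k) x)\<^sup>2))"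
        using lim
      proof eventually_elim
        case (elim x)
        then have "(\<lambda>k. ennreal ((S n x - S (r k) x)\<^sup>2)) \<longlonglongrightarrow> ennreal ((S n x - g x)\<^sup>2)"
          by (intro tendsto_ennrealI tendsto_power tendsto_diff tendsto_const)
        from lim_imp_Liminf[OF _ this] show ?case by simp
      qed
    qed
    also have "\<dots> \<le> liminf (\<lambda>k. \<integral>\<^sup>+x. ennreal ((S n x - S (r k) x)\<^sup>2) \<partial>M)"
      by (rule nn_integral_liminf) measurable
    also have "\<dots> \<le> ennreal \<epsilon>"
      unfolding nn
    proof (rule order.trans[OF Liminf_le_Limsup Limsup_bounded], simp,
        rule eventually_mono[OF eventually_ge_at_top[of K]])
      fix k assume "k \<ge> K"
      then have "r k \<ge> K" using r_ge(2)[of k] by simp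
      then show "ennreal (LINT x|M. (S n x - S (r k) x)\<^sup>2) \<le> ennreal \<epsilon>"
        using K n by (intro ennreal_leI) blast
    qed
    finally show ?thesis .
  qed
  have sq: "square_integrable M (\<lambda>x. S n x - g x)" if "n \<ge> K"
    "\<forall>m\<ge>K. \<forall>n\<ge>K. (LINT x|M. (S m x - S n x)\<^sup>2) \<le> \<epsilon>" for n K \<epsilon>
  proof -
    have "(\<integral>\<^sup>+x. ennreal ((S n x - g x)\<^sup>2) \<partial>M) < \<infinity>"
      using order_le_less_trans[OF bound[OF that(2,1)] ennreal_less_top] by simp
    then show ?thesis
      unfolding square_integrable_real by (auto intro!: integrableI_bounded)
  qed
  obtain K1 where K1: "\<forall>m\<ge>K1. \<forall>n\<ge>K1. (LINT x|M. (S m x - S n x)\<^sup>2) \<le> 1" using Cauchy[of 1] by auto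
  have g: "square_integrable M g"
    using square_integrable_diff[OF S sq[OF order_refl K1], of K1] by simp
  have "(\<lambda>n. LINT x|M. (S n x - g x)\<^sup>2) \<longlonglongrightarrow> 0"
  proof (rule LIMSEQ_I)
    fix e :: real assume e: "e > 0"
    obtain K where K: "\<forall>m\<ge>K. \<forall>n\<ge>K. (LINT x|M. (S m x - S n x)\<^sup>2) \<le> e / 2"
      using Cauchy[of "e / 2"] e by auto
    show "\<exists>no. \<forall>n\<ge>no. norm ((LINT x|M. (S n x - g x)\<^sup>2) - 0) < e"
    proof (intro exI[of _ K] allI impI)
      fix n assume n: "n \<ge> K"
      have "ennreal (LINT x|M. (S n x - g x)\<^sup>2) = (\<integral>\<^sup>+x. ennreal ((S n x - g x)\<^sup>2) \<partial>M)"
        using sq[OF n K] by (intro nn_integral_eq_integral[symmetric]) (auto simp: square_integrable_real)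
      also have "\<dots> \<le> ennreal (e / 2)" by (rule bound[OF K n])
      finally have "(LINT x|M. (S n x - g x)\<^sup>2) \<le> e / 2" using e by (simp add: ennreal_le_iff)
      moreover have "0 \<le> (LINT x|M. (S n x - g x)\<^sup>2)" by (rule integral_nonneg_AE) simp
      ultimately show "norm ((LINT x|M. (S n x - g x)\<^sup>2) - 0) < e" using e by simp
    qed
  qed
  with g show ?thesis by blast
qed

text \<open>
  By Bessel the partial expansions of \<open>f\<close> form a Cauchy sequence. If \<open>g\<close> is their limit, then
  \<open>f - g\<close> is orthogonal to the whole system, hence zero.
\<close>
lemma orthonormal_total_imp_basis:
  assumes e: "orthonormal_L2 M e"
    and total: "\<And>h. square_integrable M h \<Longrightarrow> (\<And>m. m \<ge> 1 \<Longrightarrow> (LINT x|M. h x * e m x) = 0) \<Longrightarrow> AE x in M. h x = 0"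
  shows "orthonormal_basis_L2 M e"
  unfolding orthonormal_basis_L2_def
proof (intro conjI allI impI)
  show "square_integrable M (e m)" if "m \<ge> 1" for m using e that by (simp add: orthonormal_L2_def)
  show "(LINT x|M. e m x * e n x) = (if m = n then 1 else 0)" if "m \<ge> 1" "n \<ge> 1" for m n
    using e that by (simp add: orthonormal_L2_def)
  fix f :: "'a \<Rightarrow> real" assume f: "square_integrable M f"
  have sq: "square_integrable M (e m)" if "m \<ge> 1" for m using e that by (simp add: orthonormal_L2_def)
  define c where "c m = (LINT y|M. f y * e m y)" for m
  define S where "S N x = (\<Sum>m=1..N. c m * e m x)" for N x
  have S: "square_integrable M (S N)" for N
    unfolding S_def by (rule square_integrable_sum) (simp add: sq)
  have diff: "(LINT x|M. (S m x - S n x)\<^sup>2) = \<bar>(\<Sum>k=1..m. (c k)\<^sup>2) - (\<Sum>k=1..n. (c k)\<^sup>2)\<bar>" for m n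
  proof -
    have *: "(LINT x|M. (S m x - S n x)\<^sup>2) = \<bar>(\<Sum>k=1..m. (c k)\<^sup>2) - (\<Sum>k=1..n. (c k)\<^sup>2)\<bar>" if "n \<le> m" for m n
    proof -
      have sub: "{1..n} \<subseteq> {1..m}" using that by auto
      have "S m x - S n x = (\<Sum>k\<in>{1..m} - {1..n}. c k * e k x)" for x
        unfolding S_def using sum_diff[OF _ sub, of "\<lambda>k. c k * e k x"] by simp
      then have "(LINT x|M. (S m x - S n x)\<^sup>2) = (\<Sum>k\<in>{1..m} - {1..n}. (c k)\<^sup>2)"
        by (simp add: orthonormal_L2_norm_sum[OF e] subset_iff)
      moreover have "(\<Sum>k\<in>{1..m} - {1..n}. (c k)\<^sup>2) = (\<Sum>k=1..m. (c k)\<^sup>2) - (\<Sum>k=1..n. (c k)\<^sup>2)"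
        using sum_diff[OF _ sub, of "\<lambda>k. (c k)\<^sup>2"] by simp
      moreover have "0 \<le> (\<Sum>k\<in>{1..m} - {1..n}. (c k)\<^sup>2)" by (rule sum_nonneg) simp
      ultimately show ?thesis by simp
    qed
    show ?thesis
      using *[of n m] *[of m n] by (cases "n \<le> m") (simp_all add: power2_commute abs_minus_commute)
  qed
  have "Cauchy (\<lambda>N. \<Sum>k=1..N. (c k)\<^sup>2)"
  proof (rule convergent_Cauchy, rule Bseq_mono_convergent)
    have "(\<Sum>k=1..N. (c k)\<^sup>2) \<le> (LINT x|M. (f x)\<^sup>2)" for N
    proof -
      have "0 \<le> (LINT x|M. (f x - (\<Sum>m=1..N. c m * e m x))\<^sup>2)" by (rule integral_nonneg_AE) simp
      also have "\<dots> = (LINT x|M. (f x)\<^sup>2) - (\<Sum>k=1..N. (c k)\<^sup>2)"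
        unfolding c_def by (rule orthonormal_L2_bessel[OF e _ _ f]) auto
      finally show ?thesis by simp
    qed
    then show "Bseq (\<lambda>N. \<Sum>k=1..N. (c k)\<^sup>2)"
      by (intro BseqI'[of _ "LINT x|M. (f x)\<^sup>2"]) (simp add: sum_nonneg)
  qed (auto intro!: sum_mono2)
  then have "\<exists>N. \<forall>m\<ge>N. \<forall>n\<ge>N. (LINT x|M. (S m x - S n x)\<^sup>2) \<le> \<epsilon>" if "\<epsilon> > 0" for \<epsilon>
    unfolding diff using that unfolding Cauchy_def dist_real_def by (meson less_imp_le)
  from L2_complete[OF S this] obtain g where g: "square_integrable M g"
    and Sg: "(\<lambda>n. LINT x|M. (S n x - g x)\<^sup>2) \<longlonglongrightarrow> 0" by blast
  have "AE x in M. f x - g x = 0"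
  proof (rule total)
    show "square_integrable M (\<lambda>x. f x - g x)" by (rule square_integrable_diff[OF f g])
    fix m :: nat assume m: "m \<ge> 1"
    have zero: "(LINT x|M. (f x - S N x) * e m x) = 0" if "N \<ge> m" for N
    proof -
      have "(LINT x|M. S N x * e m x) = (LINT x|M. (\<Sum>k=1..N. c k * (e k x * e m x)))"
        by (simp add: S_def sum_distrib_right mult.assoc)
      also have "\<dots> = (\<Sum>k=1..N. c k * (LINT x|M. e k x * e m x))"
        using square_integrable_mult[OF sq sq[OF m]] by simp
      also have "\<dots> = (\<Sum>k=1..N. if k = m then c k else 0)"
      proof (rule sum.cong)
        fix k assume "k \<in> {1..N}"
        then have "(LINT x|M. e k x * e m x) = (if k = m then 1 else 0)"
          using e m unfolding orthonormal_L2_def by auto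
        then show "c k * (LINT x|M. e k x * e m x) = (if k = m then c k else 0)" by simp
      qed simp
      also have "\<dots> = c m" using m that by simp
      finally have "(LINT x|M. S N x * e m x) = (LINT x|M. f x * e m x)" by (simp add: c_def)
      then show ?thesis
        using square_integrable_mult[OF f sq[OF m]] square_integrable_mult[OF S sq[OF m]]
        by (simp add: left_diff_distrib)
    qed
    have bound: "(LINT x|M. (f x - g x) * e m x)\<^sup>2 \<le> (LINT x|M. (S N x - g x)\<^sup>2)" if "N \<ge> m" for N
    proof -
      have "(LINT x|M. (f x - g x) * e m x)
        = (LINT x|M. (f x - S N x) * e m x) + (LINT x|M. (S N x - g x) * e m x)"
        using square_integrable_mult[OF square_integrable_diff[OF f S] sq[OF m]]
          square_integrable_mult[OF square_integrable_diff[OF S g] sq[OF m]]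
        by (subst Bochner_Integration.integral_add[symmetric]) (simp_all add: algebra_simps)
      also have "\<dots> = (LINT x|M. (S N x - g x) * e m x)" using zero[OF that] by simp
      also have "(\<dots>)\<^sup>2 \<le> (LINT x|M. (S N x - g x)\<^sup>2) * (LINT x|M. (e m x)\<^sup>2)"
        by (rule L2_Cauchy_Schwarz[OF square_integrable_diff[OF S g] sq[OF m]])
      also have "(LINT x|M. (e m x)\<^sup>2) = 1"
        using e m by (simp add: orthonormal_L2_def power2_eq_square)
      finally show ?thesis by simp
    qed
    have "(LINT x|M. (f x - g x) * e m x)\<^sup>2 \<le> 0"
      by (rule tendsto_lowerbound[OF Sg]) (auto intro!: eventually_mono[OF eventually_ge_at_top[of m]] bound)
    then show "(LINT x|M. (f x - g x) * e m x) = 0" by simp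
  qed
  then have fg: "(LINT x|M. (S N x - f x)\<^sup>2) = (LINT x|M. (S N x - g x)\<^sup>2)" for N
    using f g S[of N]
    by (intro integral_cong_AE) (auto simp: square_integrable_real)
  show "tendsto_L2 M (\<lambda>N x. \<Sum>m=1..N. (LINT y|M. f y * e m y) * e m x) f"
  proof -
    have eq: "(\<lambda>N x. \<Sum>m=1..N. (LINT y|M. f y * e m y) * e m x) = S"
      by (simp add: S_def c_def fun_eq_iff)
    show ?thesis unfolding eq tendsto_L2_def using S f Sg fg by simp
  qed
qed

section \<open>Hermite functions: orthonormality and Fourier transform\<close>

text \<open>
  Integration by parts on the line, stated so that it also serves complex valued integrands.
\<close>
lemma integral_derivative_eq_0:
  fixes F f :: "real \<Rightarrow> 'a :: euclidean_space"
  assumes F: "\<And>x. (F has_vector_derivative f x) (at x)" and f: "\<And>x. isCont f x"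
    and int: "integrable lborel f" and lim: "(F \<longlongrightarrow> 0) at_top" "(F \<longlongrightarrow> 0) at_bot"
  shows "(LINT x|lborel. f x) = 0"
proof -
  have "(LBINT x=-\<infinity>..\<infinity>. f x) = 0 - 0"
    by (rule interval_integral_FTC_integrable[where F = F])
      (use F f int lim in \<open>auto simp: set_integrable_def ereal_tendsto_simps\<close>)
  then show ?thesis
    by (simp add: interval_lebesgue_integral_def set_lebesgue_integral_def)
qed

lemma power_gauss_tendsto_0:
  "((\<lambda>x::real. x ^ k * exp (- x\<^sup>2 / 2)) \<longlongrightarrow> 0) at_top"
  "((\<lambda>x::real. x ^ k * exp (- x\<^sup>2 / 2)) \<longlongrightarrow> 0) at_bot"
proof -
  show *: "((\<lambda>x::real. x ^ k * exp (- x\<^sup>2 / 2)) \<longlongrightarrow> 0) at_top"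
  proof (rule tendsto_sandwich[OF _ _ tendsto_const tendsto_power_div_exp_0[of k]])
    show "\<forall>\<^sub>F x::real in at_top. 0 \<le> x ^ k * exp (- x\<^sup>2 / 2)"
      using eventually_ge_at_top[of 0] by eventually_elim simp
    show "\<forall>\<^sub>F x::real in at_top. x ^ k * exp (- x\<^sup>2 / 2) \<le> x ^ k / exp x"
      using eventually_ge_at_top[of 2]
    proof eventually_elim
      case (elim x)
      then have "x * 2 \<le> x * x" by (intro mult_left_mono) auto
      then have "- x\<^sup>2 / 2 \<le> - x" by (simp add: power2_eq_square)
      then have "exp (- x\<^sup>2 / 2) \<le> exp (- x)" by (simp only: exp_le_cancel_iff)
      then have "x ^ k * exp (- x\<^sup>2 / 2) \<le> x ^ k * exp (- x)"
        using elim by (intro mult_left_mono) auto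
      then show ?case by (simp only: exp_minus[of x] divide_inverse[of "x ^ k" "exp x"])
    qed
  qed
  have "((\<lambda>x::real. (- 1) ^ k * (x ^ k * exp (- x\<^sup>2 / 2))) \<longlongrightarrow> (- 1) ^ k * 0) at_top"
    by (rule tendsto_mult_left[OF *])
  moreover have "(- 1) ^ k * (x ^ k * exp (- x\<^sup>2 / 2)) = (- x) ^ k * exp (- (- x)\<^sup>2 / 2)" for x :: real
    using power_minus[of x k] by (simp only: power2_minus mult.assoc)
  ultimately show "((\<lambda>x::real. x ^ k * exp (- x\<^sup>2 / 2)) \<longlongrightarrow> 0) at_bot"
    unfolding filterlim_at_bot_mirror by (simp only: mult_zero_right)
qed

lemma poly_gauss_tendsto_0:
  fixes p :: "real poly"
  shows "((\<lambda>x. poly p x * exp (- x\<^sup>2 / 2)) \<longlongrightarrow> 0) at_top"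
    and "((\<lambda>x. poly p x * exp (- x\<^sup>2 / 2)) \<longlongrightarrow> 0) at_bot"
  unfolding poly_altdef sum_distrib_right mult.assoc
  by (intro tendsto_null_sum tendsto_mult_right_zero power_gauss_tendsto_0)+

lemma integrable_power_gauss: "integrable lborel (\<lambda>x::real. x ^ k * exp (- x\<^sup>2 / 2))"
proof -
  have "integrable lborel (\<lambda>x. sqrt (2 * pi) * (std_normal_density x * x ^ k))"
    by (intro integrable_mult_right integrable_std_normal_moment)
  then show ?thesis by (simp add: std_normal_density_def mult.commute)
qed

lemma integrable_poly_gauss:
  fixes p :: "real poly"
  shows "integrable lborel (\<lambda>x. poly p x * exp (- x\<^sup>2 / 2))"
  unfolding poly_altdef sum_distrib_right mult.assoc
  by (intro Bochner_Integration.integrable_sum integrable_mult_right integrable_power_gauss)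

lemma hermite_poly_Suc: "hermite_poly (Suc n) x = 2 * x * hermite_poly n x - 2 * real n * hermite_poly (n - 1) x"
  by (cases n) auto

lemma hermite_poly_is_poly: "\<exists>p. \<forall>x. hermite_poly n x = poly p x"
proof (induction n rule: less_induct)
  case (less n)
  show ?case
  proof (cases n)
    case 0
    then show ?thesis by (intro exI[of _ 1]) simp
  next
    case (Suc k)
    then obtain p where p: "\<And>x. hermite_poly k x = poly p x" using less[of k] by auto
    obtain q where q: "\<And>x. real k * hermite_poly (k - 1) x = poly q x"
    proof (cases k)
      case 0
      then show ?thesis using that[of 0] by simp
    next
      case (Suc j)
      then obtain r where "\<And>x. hermite_poly j x = poly r x" using less[of j] \<open>n = Suc k\<close> by auto
      then show ?thesis using that[of "smult (real k) r"] Suc by simp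
    qed
    have "hermite_poly n x = poly ([:0, 2:] * p - smult 2 q) x" for x
      unfolding Suc hermite_poly_Suc using p q[of x] by (simp add: algebra_simps)
    then show ?thesis by blast
  qed
qed

text \<open>
  The Hermite function of degree \<open>n\<close> without normalisation; here the index is the degree.
\<close>
definition herm :: "nat \<Rightarrow> real \<Rightarrow> real" where
  "herm n x = hermite_poly n x * exp (- x\<^sup>2 / 2)"

lemma herm_poly: "\<exists>p. herm n = (\<lambda>x. poly p x * exp (- x\<^sup>2 / 2))"
  using hermite_poly_is_poly[of n] by (auto simp: herm_def fun_eq_iff)

lemma herm_mult_poly: "\<exists>p. (\<lambda>x. poly q x * herm n x) = (\<lambda>x. poly p x * exp (- x\<^sup>2 / 2))"
proof -
  obtain p where "herm n = (\<lambda>x. poly p x * exp (- x\<^sup>2 / 2))" using herm_poly by blast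
  then show ?thesis by (intro exI[of _ "q * p"]) (simp add: mult.assoc)
qed

lemma integrable_herm: "integrable lborel (herm n)"
  using herm_poly[of n] integrable_poly_gauss by auto

lemma herm_tendsto_0: "(herm n \<longlongrightarrow> 0) at_top" "(herm n \<longlongrightarrow> 0) at_bot"
  using herm_poly[of n] poly_gauss_tendsto_0 by auto

lemma isCont_herm: "isCont (herm n) x"
  using herm_poly[of n] by (auto intro!: continuous_intros)

lemma borel_measurable_herm [measurable]: "herm n \<in> borel_measurable borel"
  by (auto intro!: borel_measurable_continuous_onI continuous_at_imp_continuous_on isCont_herm)

text \<open>
  Boundedness of polynomial multiples reduces the integrability of products to that of a single
  factor.
\<close>
lemma herm_bounded: "\<exists>B. \<forall>x. \<bar>poly q x * herm n x\<bar> \<le> B"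
proof -
  obtain p where p: "(\<lambda>x. poly q x * herm n x) = (\<lambda>x. poly p x * exp (- x\<^sup>2 / 2))"
    using herm_mult_poly by blast
  let ?F = "\<lambda>x. poly q x * herm n x"
  have "(?F \<longlongrightarrow> 0) at_top" "(?F \<longlongrightarrow> 0) at_bot" unfolding p by (rule poly_gauss_tendsto_0)+
  then have "\<forall>\<^sub>F x in at_top. dist (?F x) 0 < 1" "\<forall>\<^sub>F x in at_bot. dist (?F x) 0 < 1"
    by (auto simp: tendsto_iff)
  then obtain a b where a: "\<And>x. x \<ge> a \<Longrightarrow> \<bar>?F x\<bar> < 1" and b: "\<And>x. x \<le> b \<Longrightarrow> \<bar>?F x\<bar> < 1"
    by (auto simp: eventually_at_top_linorder eventually_at_bot_linorder)
  have "continuous_on {b..a} ?F" by (auto intro!: continuous_at_imp_continuous_on continuous_intros isCont_herm)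
  then have "bounded (?F ` {b..a})" by (intro compact_imp_bounded compact_continuous_image) auto
  then obtain B where *: "\<forall>y\<in>?F ` {b..a}. norm y \<le> B" unfolding bounded_iff by blast
  have B: "\<bar>?F x\<bar> \<le> B" if "x \<in> {b..a}" for x
    using bspec[OF * imageI[OF that]] by simp
  have "\<bar>?F x\<bar> \<le> max 1 B" for x
    using a[of x] b[of x] B[of x] by (cases "x \<ge> a"; cases "x \<le> b") (auto simp: le_max_iff_disj)
  then show ?thesis by blast
qed

lemma integrable_herm_herm: "integrable lborel (\<lambda>x. poly q x * (herm m x * herm n x))"
proof -
  obtain B where B: "\<And>x. \<bar>poly q x * herm m x\<bar> \<le> B" using herm_bounded[of q m] by blast
  show ?thesis
  proof (rule Bochner_Integration.integrable_bound)
    show "integrable lborel (\<lambda>x. B * herm n x)" by (intro integrable_mult_right integrable_herm)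
    show "AE x in lborel. norm (poly q x * (herm m x * herm n x)) \<le> norm (B * herm n x)"
    proof (rule AE_I2)
      fix x
      have "\<bar>poly q x * herm m x\<bar> * \<bar>herm n x\<bar> \<le> B * \<bar>herm n x\<bar>" by (intro mult_right_mono B) auto
      moreover have "0 \<le> B" using B[of 0] by linarith
      ultimately show "norm (poly q x * (herm m x * herm n x)) \<le> norm (B * herm n x)"
        by (simp add: abs_mult mult.assoc)
    qed
    have "(\<lambda>x. poly q x) \<in> borel_measurable borel"
      by (intro borel_measurable_continuous_onI continuous_intros)
    then show "(\<lambda>x. poly q x * (herm m x * herm n x)) \<in> borel_measurable lborel" by measurable
  qed
qed

lemma DERIV_hermite_poly:
  "(hermite_poly n has_real_derivative 2 * real n * hermite_poly (n - 1) x) (at x)"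
proof (induction n x rule: hermite_poly.induct)
  case (3 n x)
  have d: "((\<lambda>x. 2 * x) has_real_derivative 2) (at x)"
    by (auto intro!: derivative_eq_intros)
  have "(hermite_poly (Suc (Suc n)) has_real_derivative
     (2 * x * (2 * real (Suc n) * hermite_poly (Suc n - 1) x) + 2 * hermite_poly (Suc n) x)
     - 2 * real (Suc n) * (2 * real n * hermite_poly (n - 1) x)) (at x)"
    unfolding hermite_poly.simps(3)[abs_def]
    by (intro DERIV_diff DERIV_cmult DERIV_mult' d 3)
  also have "(2 * x * (2 * real (Suc n) * hermite_poly (Suc n - 1) x) + 2 * hermite_poly (Suc n) x)
     - 2 * real (Suc n) * (2 * real n * hermite_poly (n - 1) x)
     = 2 * hermite_poly (Suc n) x + 2 * real (Suc n) * (2 * x * hermite_poly n x - 2 * real n * hermite_poly (n - 1) x)"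
    by (simp add: algebra_simps)
  also have "\<dots> = 2 * real (Suc (Suc n)) * hermite_poly (Suc n) x"
    unfolding hermite_poly_Suc[symmetric] by (simp add: algebra_simps)
  finally show ?case by simp
qed (auto intro!: derivative_eq_intros)

lemma herm_Suc: "herm (Suc n) x = 2 * x * herm n x - 2 * real n * herm (n - 1) x"
  by (simp add: herm_def hermite_poly_Suc algebra_simps)

lemma DERIV_herm: "(herm n has_real_derivative 2 * real n * herm (n - 1) x - x * herm n x) (at x)"
proof -
  have "((\<lambda>x::real. exp (- x\<^sup>2 / 2)) has_real_derivative exp (- x\<^sup>2 / 2) * - x) (at x)"
    by (auto intro!: derivative_eq_intros)
  from DERIV_mult'[OF DERIV_hermite_poly[of n x] this]
  show ?thesis unfolding herm_def[abs_def] by (simp add: herm_def algebra_simps)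
qed

lemma DERIV_herm': "(herm n has_real_derivative real n * herm (n - 1) x - herm (Suc n) x / 2) (at x)"
proof -
  have "2 * real n * herm (n - 1) x - x * herm n x = real n * herm (n - 1) x - herm (Suc n) x / 2"
    by (simp add: herm_Suc field_simps)
  then show ?thesis using DERIV_herm[of n x] by (simp only:)
qed

lemma integral_herm_gauss: "(LINT x|lborel. herm 0 x * herm 0 x) = sqrt pi"
proof -
  have "(LINT x|lborel. normal_density 0 (1 / sqrt 2) x) = 1"
    by (rule integral_normal_density) simp
  moreover have "normal_density 0 (1 / sqrt 2) x = herm 0 x * herm 0 x / sqrt pi" for x
    by (simp add: normal_density_def herm_def power_divide flip: exp_add)
  ultimately show ?thesis by simp
qed

text \<open>
  The raising operator \<open>x - d/dx\<close>, which sends \<open>herm m\<close> to \<open>herm (m + 1)\<close>, is adjoint to the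
  lowering operator \<open>x + d/dx\<close>, which sends \<open>herm n\<close> to \<open>2 n herm (n - 1)\<close>: the difference of the two
  sides is the integral of the derivative of \<open>- herm m herm n\<close>.
\<close>
lemma integral_herm_Suc:
  "(LINT x|lborel. herm (Suc m) x * herm n x) = 2 * real n * (LINT x|lborel. herm m x * herm (n - 1) x)"
proof -
  have int: "integrable lborel (\<lambda>x. herm i x * herm j x)" for i j
    using integrable_herm_herm[of 1 i j] by simp
  let ?f = "\<lambda>x. 2 * real n * (herm m x * herm (n - 1) x) - herm (Suc m) x * herm n x"
  have "(LINT x|lborel. ?f x) = 0"
  proof (rule integral_derivative_eq_0)
    fix x
    have "((\<lambda>x. herm m x * herm n x) has_real_derivative
      herm m x * (2 * real n * herm (n - 1) x - x * herm n x)
      + (2 * real m * herm (m - 1) x - x * herm m x) * herm n x) (at x)"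
      by (intro DERIV_mult' DERIV_herm)
    then show "((\<lambda>x. herm m x * herm n x) has_vector_derivative ?f x) (at x)"
      unfolding has_real_derivative_iff_has_vector_derivative by (simp add: herm_Suc algebra_simps)
    show "isCont ?f x" by (intro continuous_intros isCont_herm)
  next
    show "integrable lborel ?f" using int by auto
    show "((\<lambda>x. herm m x * herm n x) \<longlongrightarrow> 0) at_top" "((\<lambda>x. herm m x * herm n x) \<longlongrightarrow> 0) at_bot"
      using tendsto_mult[OF herm_tendsto_0(1) herm_tendsto_0(1)] tendsto_mult[OF herm_tendsto_0(2) herm_tendsto_0(2)]
      by auto
  qed
  then show ?thesis using int by simp
qed

lemma integral_herm_herm:
  "(LINT x|lborel. herm m x * herm n x) = (if m = n then 2 ^ n * fact n * sqrt pi else 0)"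
proof (induction m arbitrary: n)
  case 0
  show ?case
  proof (cases n)
    case (Suc k)
    have "(LINT x|lborel. herm 0 x * herm (Suc k) x) = (LINT x|lborel. herm (Suc k) x * herm 0 x)"
      by (simp add: mult.commute)
    then show ?thesis using Suc integral_herm_Suc[of k 0] by simp
  qed (simp add: integral_herm_gauss)
next
  case (Suc m)
  show ?case
  proof (cases n)
    case (Suc k)
    then show ?thesis using integral_herm_Suc[of m n] Suc.IH[of k] by simp
  qed (simp add: integral_herm_Suc)
qed

lemma hermite_basis_herm: "hermite_basis n x = herm (n - 1) x / sqrt (2 ^ (n - 1) * fact (n - 1) * sqrt pi)"
  by (simp add: hermite_basis_def herm_def)

lemma orthonormal_hermite_basis: "orthonormal_L2 lborel hermite_basis"
  unfolding orthonormal_L2_def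
proof (intro conjI allI impI)
  fix m n :: nat assume mn: "m \<ge> 1" "n \<ge> 1"
  have "(LINT x|lborel. hermite_basis m x * hermite_basis n x)
    = (LINT x|lborel. herm (m - 1) x * herm (n - 1) x) /
       (sqrt (2 ^ (m - 1) * fact (m - 1) * sqrt pi) * sqrt (2 ^ (n - 1) * fact (n - 1) * sqrt pi))"
    by (simp add: hermite_basis_herm)
  also have "\<dots> = (if m = n then 1 else 0)"
  proof -
    have "m - 1 = n - 1 \<longleftrightarrow> m = n" using mn by auto
    then show ?thesis unfolding integral_herm_herm by auto
  qed
  finally show "(LINT x|lborel. hermite_basis m x * hermite_basis n x) = (if m = n then 1 else 0)" .
next
  fix m :: nat
  show "square_integrable lborel (hermite_basis m)"
    using integrable_herm_herm[of 1 "m - 1" "m - 1"]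
    by (simp add: square_integrable_real hermite_basis_herm[abs_def] power_divide power2_eq_square)
qed

lemma integral_iexp_gauss:
  "(LINT x|lborel. exp (- (\<i> * of_real (\<xi> * x))) * complex_of_real (exp (- x\<^sup>2 / 2)))
    = complex_of_real (sqrt (2 * pi) * exp (- \<xi>\<^sup>2 / 2))"
proof -
  have "complex_of_real (exp (- \<xi>\<^sup>2 / 2)) = char std_normal_distribution (- \<xi>)"
    by (simp add: char_std_normal_distribution)
  also have "\<dots> = (CLINT x|lborel. std_normal_density x *\<^sub>R iexp (- \<xi> * x))"
    unfolding char_def by (subst integral_density) auto
  also have "\<dots> = (LINT x|lborel. complex_of_real (1 / sqrt (2 * pi)) * (exp (- (\<i> * of_real (\<xi> * x))) * complex_of_real (exp (- x\<^sup>2 / 2))))"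
    by (simp add: std_normal_density_def scaleR_conv_of_real mult_ac)
  also have "\<dots> = complex_of_real (1 / sqrt (2 * pi)) * (LINT x|lborel. exp (- (\<i> * of_real (\<xi> * x))) * complex_of_real (exp (- x\<^sup>2 / 2)))"
    by simp
  finally have "complex_of_real (sqrt (2 * pi)) * complex_of_real (exp (- \<xi>\<^sup>2 / 2)) =
    complex_of_real (sqrt (2 * pi)) * (complex_of_real (1 / sqrt (2 * pi)) * (LINT x|lborel. exp (- (\<i> * of_real (\<xi> * x))) * complex_of_real (exp (- x\<^sup>2 / 2))))"
    by simp
  also have "\<dots> = (LINT x|lborel. exp (- (\<i> * of_real (\<xi> * x))) * complex_of_real (exp (- x\<^sup>2 / 2)))"
    unfolding mult.assoc[symmetric] of_real_mult[symmetric] by simp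
  finally show ?thesis by simp
qed

lemma cmod_exp_i: "cmod (exp (- (\<i> * of_real r))) = 1" "cmod (exp (\<i> * of_real r)) = 1"
  by (simp_all add: norm_exp_eq_Re)

lemma integrable_iexp_herm: 
  "integrable lborel (\<lambda>x. exp (- (\<i> * of_real (\<xi> * x))) * complex_of_real (herm n x))"
  by (rule Bochner_Integration.integrable_bound[OF integrable_herm[of n]])
    (auto simp: norm_mult cmod_exp_i simp del: of_real_mult)

text \<open>
  Integrating the derivative of \<open>exp (- i \<xi> x) herm k x\<close> gives a three term recursion for the
  transforms. With the factor \<open>(- i)\<^sup>n\<close> extracted, it is the recursion of the Hermite functions.
\<close>
lemma fourier_herm:
  "(LINT x|lborel. exp (- (\<i> * of_real (\<xi> * x))) * complex_of_real (herm n x))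
    = complex_of_real (sqrt (2 * pi)) * (- \<i>) ^ n * complex_of_real (herm n \<xi>)"
proof (induction n rule: less_induct)
  case (less n)
  show ?case
  proof (cases n)
    case 0
    then show ?thesis using integral_iexp_gauss[of \<xi>] by (simp add: herm_def)
  next
    case (Suc k)
    let ?e = "\<lambda>x. exp (- (\<i> * of_real (\<xi> * x)))"
    let ?I = "\<lambda>n. LINT x|lborel. ?e x * complex_of_real (herm n x)"
    let ?f = "\<lambda>x. - \<i> * of_real \<xi> * (?e x * of_real (herm k x)) + (of_nat k * (?e x * of_real (herm (k - 1) x)) - (?e x * of_real (herm (Suc k) x)) / 2)"
    note int = integrable_iexp_herm[of \<xi>]
    have "(LINT x|lborel. ?f x) = 0"
    proof (rule integral_derivative_eq_0)
      fix x
      have e: "(?e has_vector_derivative - \<i> * of_real \<xi> * ?e x) (at x)"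
      proof -
        have "((\<lambda>z. exp (- (\<i> * (of_real \<xi> * z)))) has_field_derivative
            - \<i> * of_real \<xi> * exp (- (\<i> * (of_real \<xi> * of_real x)))) (at (of_real x))"
          by (auto intro!: derivative_eq_intros)
        from has_vector_derivative_real_field[OF this] show ?thesis by simp
      qed
      have h: "((\<lambda>x. complex_of_real (herm k x)) has_vector_derivative of_real (real k * herm (k - 1) x - herm (Suc k) x / 2)) (at x)"
        using DERIV_herm'[of k x]
        by (intro has_vector_derivative_of_real) (simp add: has_real_derivative_iff_has_vector_derivative)
      have "((\<lambda>x. ?e x * complex_of_real (herm k x)) has_vector_derivative
         (?e x * of_real (real k * herm (k - 1) x - herm (Suc k) x / 2) + (- \<i> * of_real \<xi> * ?e x) * of_real (herm k x))) (at x)"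
        by (rule has_vector_derivative_mult[OF e h])
      then show "((\<lambda>x. ?e x * complex_of_real (herm k x)) has_vector_derivative ?f x) (at x)"
        by (simp add: algebra_simps)
      show "isCont ?f x" by (intro continuous_intros isCont_herm) auto
    next
      show "integrable lborel ?f"
        using int by (intro Bochner_Integration.integrable_add Bochner_Integration.integrable_diff
            integrable_mult_right integrable_divide_zero impI)
      have "((\<lambda>x. \<bar>herm k x\<bar>) \<longlongrightarrow> 0) at_top" "((\<lambda>x. \<bar>herm k x\<bar>) \<longlongrightarrow> 0) at_bot"
        using herm_tendsto_0 tendsto_rabs_zero by blast+
      then show "((\<lambda>x. ?e x * complex_of_real (herm k x)) \<longlongrightarrow> 0) at_top"
         "((\<lambda>x. ?e x * complex_of_real (herm k x)) \<longlongrightarrow> 0) at_bot"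
        by (auto intro!: Lim_null_comparison[where g = "\<lambda>x. \<bar>herm k x\<bar>"] simp: norm_mult cmod_exp_i simp del: of_real_mult)
    qed
    moreover have "(LINT x|lborel. ?f x) = - \<i> * of_real \<xi> * ?I k + (of_nat k * ?I (k - 1) - ?I (Suc k) / 2)"
      using int by (simp del: of_real_mult)
    ultimately have rec: "?I (Suc k) = 2 * of_nat k * ?I (k - 1) - 2 * \<i> * of_real \<xi> * ?I k"
      by (simp add: field_simps)
    have Ik: "?I k = complex_of_real (sqrt (2 * pi)) * (- \<i>) ^ k * complex_of_real (herm k \<xi>)"
      using less[of k] Suc by simp
    have Ik1: "of_nat k * ?I (k - 1) = complex_of_real (sqrt (2 * pi)) * (- ((- \<i>) ^ Suc k)) * (of_nat k * complex_of_real (herm (k - 1) \<xi>))"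
    proof (cases k)
      case (Suc j)
      then have "?I j = complex_of_real (sqrt (2 * pi)) * (- \<i>) ^ j * complex_of_real (herm j \<xi>)"
        using less[of j] \<open>n = Suc k\<close> by simp
      then show ?thesis using Suc by (simp add: mult_ac)
    qed simp
    have "?I (Suc k) = complex_of_real (sqrt (2 * pi)) * (- \<i>) ^ Suc k *
        (2 * of_real \<xi> * of_real (herm k \<xi>) - 2 * (of_nat k * of_real (herm (k - 1) \<xi>)))"
      unfolding rec mult.assoc Ik1 Ik by (simp add: algebra_simps)
    also have "2 * of_real \<xi> * of_real (herm k \<xi>) - 2 * (of_nat k * of_real (herm (k - 1) \<xi>)) = complex_of_real (herm (Suc k) \<xi>)"
      by (simp add: herm_Suc)
    finally show ?thesis by (simp add: Suc)
  qed
qed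

lemma fourier_hermite_basis:
  "(LINT x|lborel. exp (- (\<i> * of_real (\<xi> * x))) * complex_of_real (hermite_basis n x))
    = complex_of_real (sqrt (2 * pi)) * (- \<i>) ^ (n - 1) * complex_of_real (hermite_basis n \<xi>)"
  using fourier_herm[of \<xi> "n - 1"] by (simp add: hermite_basis_herm)

section \<open>Completeness of the Hermite functions and Parseval on product bases\<close>

text \<open>
  The positive and negative parts of \<open>w\<close> have the same integral and the same transform. After
  normalisation they are densities of probability measures with equal characteristic functions.
\<close>
lemma zero_transform_imp_AE_zero:
  fixes w :: "real \<Rightarrow> real"
  assumes w: "integrable lborel w"
    and zero: "\<And>t. (CLINT x|lborel. iexp (t * x) * complex_of_real (w x)) = 0"
  shows "AE x in lborel. w x = 0"
proof -
  define p where "p x = max 0 (w x)" for x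
  define q where "q x = max 0 (- w x)" for x
  have [measurable]: "w \<in> borel_measurable borel" using w by auto
  have [measurable]: "p \<in> borel_measurable borel" "q \<in> borel_measurable borel"
    unfolding p_def q_def by measurable
  have int: "integrable lborel p" "integrable lborel q"
    unfolding p_def q_def using w by auto
  have w_eq: "w x = p x - q x" for x by (auto simp: p_def q_def)
  have pq0: "0 \<le> p x" "0 \<le> q x" for x by (auto simp: p_def q_def)
  have int_e: "integrable lborel (\<lambda>x. iexp (t * x) * complex_of_real (p x))"
     "integrable lborel (\<lambda>x. iexp (t * x) * complex_of_real (q x))" for t
    by (rule Bochner_Integration.integrable_bound[OF int(1)] Bochner_Integration.integrable_bound[OF int(2)];
        simp add: norm_mult cmod_exp_i del: of_real_mult)+
  have eq: "(CLINT x|lborel. iexp (t * x) * complex_of_real (p x)) = (CLINT x|lborel. iexp (t * x) * complex_of_real (q x))" for t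
  proof -
    have "(CLINT x|lborel. iexp (t * x) * complex_of_real (p x)) - (CLINT x|lborel. iexp (t * x) * complex_of_real (q x))
        = (CLINT x|lborel. iexp (t * x) * complex_of_real (w x))"
      by (subst Bochner_Integration.integral_diff[symmetric, OF int_e])
        (simp add: w_eq right_diff_distrib del: of_real_mult)
    then show ?thesis using zero[of t] by simp
  qed
  define c where "c = (LINT x|lborel. p x)"
  have cq: "(LINT x|lborel. q x) = c"
  proof -
    have "complex_of_real (LINT x|lborel. q x) = complex_of_real (LINT x|lborel. p x)"
      using eq[of 0] by simp
    then show ?thesis by (simp add: c_def)
  qed
  have c0: "0 \<le> c" unfolding c_def by (rule integral_nonneg_AE) (simp add: pq0)
  have "AE x in lborel. p x = q x"
  proof (cases "c = 0")
    case True
    then have "AE x in lborel. p x = 0" "AE x in lborel. q x = 0"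
      using integral_nonneg_eq_0_iff_AE[OF int(1)] integral_nonneg_eq_0_iff_AE[OF int(2)] cq pq0
      by (simp_all add: c_def)
    then show ?thesis by eventually_elim simp
  next
    case False
    then have c: "c > 0" using c0 by simp
    have real: "real_distribution (density lborel (\<lambda>x. ennreal (f x / c)))"
      if f: "integrable lborel f" "\<And>x. 0 \<le> f x" "(LINT x|lborel. f x) = c" for f
    proof -
      have [measurable]: "f \<in> borel_measurable borel" using f(1) by auto
      have "(\<integral>\<^sup>+x. ennreal (f x / c) \<partial>lborel) = ennreal (LINT x|lborel. f x / c)"
        using f c by (intro nn_integral_eq_integral) auto
      also have "\<dots> = 1" using f c by simp
      finally have "prob_space (density lborel (\<lambda>x. ennreal (f x / c)))"
        by (intro prob_spaceI) (simp add: emeasure_density)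
      then show ?thesis
        by (simp add: real_distribution_def real_distribution_axioms_def)
    qed
    have char: "char (density lborel (\<lambda>x. ennreal (f x / c))) t
        = (CLINT x|lborel. iexp (t * x) * complex_of_real (f x)) / c"
      if f: "integrable lborel f" "\<And>x. 0 \<le> f x" for f t
    proof -
      have [measurable]: "f \<in> borel_measurable borel" using f(1) by auto
      have "char (density lborel (\<lambda>x. ennreal (f x / c))) t = (CLINT x|lborel. (f x / c) *\<^sub>R iexp (t * x))"
        unfolding char_def using f c by (subst integral_density) auto
      also have "\<dots> = (CLINT x|lborel. (iexp (t * x) * complex_of_real (f x)) / c)"
        by (simp add: scaleR_conv_of_real mult.commute)
      finally show ?thesis by simp
    qed
    have "density lborel (\<lambda>x. ennreal (p x / c)) = density lborel (\<lambda>x. ennreal (q x / c))"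
    proof (rule Levy_uniqueness)
      show "real_distribution (density lborel (\<lambda>x. ennreal (p x / c)))"
        using int pq0 by (intro real) (auto simp: c_def)
      show "real_distribution (density lborel (\<lambda>x. ennreal (q x / c)))"
        using int pq0 cq by (intro real) auto
      show "char (density lborel (\<lambda>x. ennreal (p x / c))) = char (density lborel (\<lambda>x. ennreal (q x / c)))"
        using int pq0 eq by (simp add: char fun_eq_iff del: of_real_mult)
    qed
    then have "AE x in lborel. ennreal (p x / c) = ennreal (q x / c)"
      by (intro sigma_finite_measure.density_unique[OF sigma_finite_lborel]) auto
    then show ?thesis
    proof eventually_elim
      case (elim x)
      then have "p x / c = q x / c" using pq0 c by (subst (asm) ennreal_inj) auto
      then show ?case using c by simp
    qed
  qed
  then show ?thesis by eventually_elim (simp add: w_eq)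
qed

lemma square_integrable_gauss_exp: "square_integrable lborel (\<lambda>x::real. exp (- x\<^sup>2 / 2 + \<bar>t * x\<bar>))"
  unfolding square_integrable_real
proof
  show "integrable lborel (\<lambda>x::real. (exp (- x\<^sup>2 / 2 + \<bar>t * x\<bar>))\<^sup>2)"
  proof (rule Bochner_Integration.integrable_bound)
    show "integrable lborel (\<lambda>x::real. exp (2 * t\<^sup>2) * (x ^ 0 * exp (- x\<^sup>2 / 2)))"
      by (intro integrable_mult_right integrable_power_gauss)
    show "AE x in lborel. norm ((exp (- x\<^sup>2 / 2 + \<bar>t * x\<bar>))\<^sup>2) \<le> norm (exp (2 * t\<^sup>2) * (x ^ 0 * exp (- x\<^sup>2 / 2)))"
    proof (rule AE_I2)
      fix x :: real
      \<comment> \<open>Completing the square in \<open>2 \<bar>t x\<bar> - x\<^sup>2 / 2\<close>.\<close>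
      have "0 \<le> (2 * \<bar>t\<bar> - \<bar>x\<bar>)\<^sup>2" by simp
      then have "4 * \<bar>t * x\<bar> \<le> 4 * t\<^sup>2 + x\<^sup>2" by (simp add: power2_diff power_mult_distrib abs_mult)
      then have "2 * (- x\<^sup>2 / 2 + \<bar>t * x\<bar>) \<le> 2 * t\<^sup>2 + - x\<^sup>2 / 2" by simp
      then have "exp (2 * (- x\<^sup>2 / 2 + \<bar>t * x\<bar>)) \<le> exp (2 * t\<^sup>2 + - x\<^sup>2 / 2)"
        by (simp only: exp_le_cancel_iff)
      then have "(exp (- x\<^sup>2 / 2 + \<bar>t * x\<bar>))\<^sup>2 \<le> exp (2 * t\<^sup>2) * exp (- x\<^sup>2 / 2)"
        by (simp only: exp_double exp_add)
      then show "norm ((exp (- x\<^sup>2 / 2 + \<bar>t * x\<bar>))\<^sup>2) \<le> norm (exp (2 * t\<^sup>2) * (x ^ 0 * exp (- x\<^sup>2 / 2)))"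
        by simp
    qed
  qed simp
qed simp

text \<open>
  Multiplication by \<open>x\<close> maps the span of the Hermite functions to itself, so orthogonality to
  them makes all moments of \<open>w = h exp (- x\<^sup>2 / 2)\<close> vanish. Since \<open>w exp \<bar>t x\<bar>\<close> is integrable, the
  transform of \<open>w\<close> may be expanded into these moments.
\<close>
lemma hermite_basis_total:
  assumes h: "square_integrable lborel h"
    and orth: "\<And>m. m \<ge> 1 \<Longrightarrow> (LINT x|lborel. h x * hermite_basis m x) = 0"
  shows "AE x in lborel. h x = 0"
proof -
  define w where "w x = h x * exp (- x\<^sup>2 / 2)" for x :: real
  have [measurable]: "h \<in> borel_measurable borel" using h by (simp add: square_integrable_def)
  have sq_herm: "square_integrable lborel (\<lambda>x. x ^ k * herm n x)" for k n
  proof -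
    have "poly (monom 1 (2 * k)) x * (herm n x * herm n x) = (x ^ k * herm n x)\<^sup>2" for x :: real
      by (simp add: poly_monom power_mult_distrib mult.commute[of 2 k] power_mult) (simp add: power2_eq_square)
    then show ?thesis using integrable_herm_herm[of "monom 1 (2 * k)" n n]
      by (simp add: square_integrable_real)
  qed
  have int_hH: "integrable lborel (\<lambda>x. h x * (x ^ k * herm n x))" for k n
    by (rule square_integrable_mult[OF h sq_herm])
  have moment: "(LINT x|lborel. h x * (x ^ k * herm n x)) = 0" for k n
  proof (induction k arbitrary: n)
    case 0
    have "(LINT x|lborel. h x * hermite_basis (Suc n) x) = (LINT x|lborel. h x * herm n x) / sqrt (2 ^ n * fact n * sqrt pi)"
      by (simp add: hermite_basis_herm)
    then show ?case using orth[of "Suc n"] by simp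
  next
    case (Suc k)
    have "h x * (x ^ Suc k * herm n x) = (1 / 2) * (h x * (x ^ k * herm (Suc n) x)) + real n * (h x * (x ^ k * herm (n - 1) x))" for x
      by (simp add: herm_Suc algebra_simps)
    then show ?case using int_hH Suc by simp
  qed
  have w_int: "integrable lborel (\<lambda>x. \<bar>w x\<bar> * exp \<bar>t * x\<bar>)" for t
  proof -
    have "integrable lborel (\<lambda>x. norm (h x * exp (- x\<^sup>2 / 2 + \<bar>t * x\<bar>)))"
      by (intro integrable_norm square_integrable_mult[OF h square_integrable_gauss_exp])
    moreover have "norm (h x * exp (- x\<^sup>2 / 2 + \<bar>t * x\<bar>)) = \<bar>w x\<bar> * exp \<bar>t * x\<bar>" for x
      unfolding w_def exp_add by (simp add: abs_mult)
    ultimately show ?thesis by simp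
  qed
  have w_int0: "integrable lborel w"
  proof -
    have "integrable lborel (\<lambda>x. \<bar>w x\<bar>)" using w_int[of 0] by simp
    then show ?thesis by (rule integrable_abs_cancel) (simp add: w_def)
  qed
  have w_moment: "(LINT x|lborel. w x * x ^ k) = 0" "integrable lborel (\<lambda>x. w x * x ^ k)" for k
  proof -
    have "(\<lambda>x. h x * (x ^ k * herm 0 x)) = (\<lambda>x. w x * x ^ k)"
      by (simp add: w_def herm_def fun_eq_iff)
    then show "(LINT x|lborel. w x * x ^ k) = 0" "integrable lborel (\<lambda>x. w x * x ^ k)"
      using moment[of k 0] int_hH[of k 0] by simp_all
  qed
  have "(CLINT x|lborel. iexp (t * x) * complex_of_real (w x)) = 0" for t
  proof -
    define s where "s N x = (\<Sum>k<N. (\<i> * of_real t) ^ k / fact k * complex_of_real (w x * x ^ k))" for N x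
    have "(\<lambda>N. CLINT x|lborel. s N x) \<longlonglongrightarrow> (CLINT x|lborel. iexp (t * x) * complex_of_real (w x))"
    proof (rule integral_dominated_convergence[where w = "\<lambda>x. \<bar>w x\<bar> * exp \<bar>t * x\<bar>"])
      have s_eq: "s N x = (\<Sum>k<N. (\<i> * of_real (t * x)) ^ k /\<^sub>R fact k) * complex_of_real (w x)" for N x
        unfolding s_def sum_distrib_right
        by (rule sum.cong) (simp_all add: power_mult_distrib scaleR_conv_of_real divide_inverse mult_ac)
      show "AE x in lborel. (\<lambda>N. s N x) \<longlonglongrightarrow> iexp (t * x) * complex_of_real (w x)"
      proof (rule AE_I2)
        fix x
        have "(\<lambda>k. (\<i> * of_real (t * x)) ^ k /\<^sub>R fact k) sums iexp (t * x)" by (rule exp_converges)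
        then show "(\<lambda>N. s N x) \<longlonglongrightarrow> iexp (t * x) * complex_of_real (w x)"
          unfolding s_eq sums_def by (rule tendsto_mult_right)
      qed
      show "AE x in lborel. norm (s N x) \<le> \<bar>w x\<bar> * exp \<bar>t * x\<bar>" for N
      proof (rule AE_I2)
        fix x
        have "norm (\<Sum>k<N. (\<i> * of_real (t * x)) ^ k /\<^sub>R fact k) \<le> (\<Sum>k<N. norm ((\<i> * complex_of_real (t * x)) ^ k /\<^sub>R fact k))"
          by (rule norm_sum)
        also have "\<dots> = (\<Sum>k<N. \<bar>t * x\<bar> ^ k /\<^sub>R fact k)"
          by (simp add: norm_power norm_mult abs_mult del: of_real_mult)
        also have "\<dots> \<le> exp \<bar>t * x\<bar>"
          unfolding exp_def by (rule sum_le_suminf) (auto intro: summable_exp)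
        finally show "norm (s N x) \<le> \<bar>w x\<bar> * exp \<bar>t * x\<bar>"
          unfolding s_eq norm_mult by (simp add: mult.commute mult_left_mono)
      qed
      show "integrable lborel (\<lambda>x. \<bar>w x\<bar> * exp \<bar>t * x\<bar>)" by (rule w_int)
      show "(\<lambda>x. iexp (t * x) * complex_of_real (w x)) \<in> borel_measurable lborel"
        unfolding w_def by measurable
      show "s N \<in> borel_measurable lborel" for N
        unfolding s_def w_def by measurable
    qed
    moreover have "(CLINT x|lborel. s N x) = 0" for N
    proof -
      have "integrable lborel (\<lambda>x. (\<i> * of_real t) ^ k / fact k * complex_of_real (w x * x ^ k))" for k
        by (rule integrable_mult_right[OF integrable_of_real[OF w_moment(2)]])
      then have "(CLINT x|lborel. s N x) = (\<Sum>k<N. (CLINT x|lborel. (\<i> * of_real t) ^ k / fact k * complex_of_real (w x * x ^ k)))"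
        unfolding s_def by (rule Bochner_Integration.integral_sum)
      also have "\<dots> = 0"
      proof (intro sum.neutral ballI)
        fix k
        have "(CLINT x|lborel. complex_of_real (w x * x ^ k)) = complex_of_real (LINT x|lborel. w x * x ^ k)"
          by (rule integral_of_real[OF w_moment(2)])
        then show "(CLINT x|lborel. (\<i> * of_real t) ^ k / fact k * complex_of_real (w x * x ^ k)) = 0"
          using w_moment[of k] by (simp del: of_real_mult)
      qed
      finally show ?thesis .
    qed
    ultimately show ?thesis using LIMSEQ_unique[OF _ tendsto_const] by (simp add: LIMSEQ_const_iff)
  qed
  then have "AE x in lborel. w x = 0" by (rule zero_transform_imp_AE_zero[OF w_int0])
  then show ?thesis by eventually_elim (simp add: w_def)
qed

lemma hermite_orthonormal_basis: "orthonormal_basis_L2 lborel hermite_basis"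
  by (rule orthonormal_total_imp_basis[OF orthonormal_hermite_basis hermite_basis_total])

text \<open>
  For nonnegative terms, iterated summation and summation over growing squares agree. Squares are
  the index sets of the truncated noise.
\<close>
lemma tendsto_square_partial_sums:
  fixes s :: "nat \<Rightarrow> nat \<Rightarrow> real"
  assumes nonneg: "\<And>m n. 0 \<le> s m n"
    and inner: "\<And>m. m \<ge> 1 \<Longrightarrow> (\<lambda>N. \<Sum>n=1..N. s m n) \<longlonglongrightarrow> T m"
    and outer: "(\<lambda>N. \<Sum>m=1..N. T m) \<longlonglongrightarrow> L"
  shows "(\<lambda>N. \<Sum>m=1..N. \<Sum>n=1..N. s m n) \<longlonglongrightarrow> L"
proof (rule LIMSEQ_I)
  fix e :: real assume e: "e > 0"
  have le_T: "(\<Sum>n=1..N. s m n) \<le> T m" if "m \<ge> 1" for m N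
    by (rule incseq_le[OF _ inner[OF that]]) (auto intro!: incseq_SucI simp: nonneg)
  have T0: "0 \<le> T m" if "m \<ge> 1" for m using le_T[OF that, of 0] by simp
  have le_L: "(\<Sum>m=1..N. T m) \<le> L" for N
    by (rule incseq_le[OF _ outer]) (auto intro!: incseq_SucI T0)
  have upper: "(\<Sum>m=1..N. \<Sum>n=1..N. s m n) \<le> L" for N
    using sum_mono[of "{1..N}" "\<lambda>m. \<Sum>n=1..N. s m n" T] le_T le_L[of N] by fastforce
  obtain M where M: "L - e / 2 < (\<Sum>m=1..M. T m)"
  proof -
    have "\<forall>\<^sub>F N in sequentially. L - e / 2 < (\<Sum>m=1..N. T m)"
      using outer e by (intro order_tendstoD) auto
    then show ?thesis using that by (auto simp: eventually_sequentially)
  qed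
  have "(\<lambda>N. \<Sum>m=1..M. \<Sum>n=1..N. s m n) \<longlonglongrightarrow> (\<Sum>m=1..M. T m)"
    by (intro tendsto_sum inner) auto
  then have "\<forall>\<^sub>F N in sequentially. L - e / 2 < (\<Sum>m=1..M. \<Sum>n=1..N. s m n)"
    using M by (rule order_tendstoD)
  then obtain K where K: "\<And>N. N \<ge> K \<Longrightarrow> L - e / 2 < (\<Sum>m=1..M. \<Sum>n=1..N. s m n)"
    by (auto simp: eventually_sequentially)
  show "\<exists>no. \<forall>N\<ge>no. norm ((\<Sum>m=1..N. \<Sum>n=1..N. s m n) - L) < e"
  proof (intro exI[of _ "max M K"] allI impI)
    fix N assume N: "max M K \<le> N"
    have "(\<Sum>m=1..M. \<Sum>n=1..N. s m n) \<le> (\<Sum>m=1..N. \<Sum>n=1..N. s m n)"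
      using N by (intro sum_mono2) (auto intro!: sum_nonneg nonneg)
    then have "L - e / 2 < (\<Sum>m=1..N. \<Sum>n=1..N. s m n)" using K[of N] N by linarith
    then show "norm ((\<Sum>m=1..N. \<Sum>n=1..N. s m n) - L) < e" using upper[of N] e by simp
  qed
qed

text \<open>
  Apply Parseval in the first variable for each fixed \<open>y\<close>, and then in the second variable to each
  coefficient function. Dominated convergence joins the two steps.
\<close>
lemma parseval_product:
  fixes K :: "'b \<Rightarrow> 'a \<Rightarrow> real"
  assumes "sigma_finite_measure A" "sigma_finite_measure B"
    and e: "orthonormal_basis_L2 A e" and \<phi>: "orthonormal_basis_L2 B \<phi>"
    and K [measurable]: "case_prod K \<in> borel_measurable (B \<Otimes>\<^sub>M A)"
    and sq: "\<And>y. square_integrable A (K y)"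
    and int: "integrable B (\<lambda>y. LINT x|A. (K y x)\<^sup>2)"
  shows "m \<ge> 1 \<Longrightarrow> square_integrable B (\<lambda>y. LINT x|A. K y x * e m x)"
    and "(\<lambda>N. \<Sum>m=1..N. \<Sum>n=1..N. (LINT y|B. (LINT x|A. K y x * e m x) * \<phi> n y)\<^sup>2)
      \<longlonglongrightarrow> (LINT y|B. LINT x|A. (K y x)\<^sup>2)"
proof -
  interpret A: sigma_finite_measure A by fact
  define b where "b m y = (LINT x|A. K y x * e m x)" for m y
  have e_meas: "e m \<in> borel_measurable A" if "m \<ge> 1" for m
    using e that by (auto simp: orthonormal_basis_L2_def square_integrable_def)
  have b_meas: "b m \<in> borel_measurable B" if "m \<ge> 1" for m
    using e_meas[OF that, measurable] unfolding b_def by measurable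
  let ?G = "\<lambda>y. LINT x|A. (K y x)\<^sup>2"
  have pars: "(\<lambda>N. \<Sum>m=1..N. (b m y)\<^sup>2) \<longlonglongrightarrow> ?G y" for y
    unfolding b_def by (rule orthonormal_basis_L2_parseval[OF e sq])
  have sum_le: "(\<Sum>m=1..N. (b m y)\<^sup>2) \<le> ?G y" for N y
    by (rule incseq_le[OF _ pars]) (auto intro!: incseq_SucI)
  have b_le: "(b m y)\<^sup>2 \<le> ?G y" if "m \<ge> 1" for m y
    using sum_le[of y m] member_le_sum[of m "{1..m}" "\<lambda>m. (b m y)\<^sup>2"] that by auto
  have b_sq: "square_integrable B (b m)" if m: "m \<ge> 1" for m
    unfolding square_integrable_real
  proof
    show "integrable B (\<lambda>y. (b m y)\<^sup>2)"
      by (rule Bochner_Integration.integrable_bound[OF int])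
        (use b_meas[OF m] b_le[OF m] in \<open>auto intro: order.trans\<close>)
  qed (rule b_meas[OF m])
  then show "m \<ge> 1 \<Longrightarrow> square_integrable B (\<lambda>y. LINT x|A. K y x * e m x)"
    unfolding b_def .
  have outer: "(\<lambda>N. \<Sum>m=1..N. LINT y|B. (b m y)\<^sup>2) \<longlonglongrightarrow> (LINT y|B. ?G y)"
  proof -
    have "(\<lambda>N. LINT y|B. (\<Sum>m=1..N. (b m y)\<^sup>2)) \<longlonglongrightarrow> (LINT y|B. ?G y)"
    proof (rule integral_dominated_convergence[where w = ?G])
      show "AE y in B. norm (\<Sum>m=1..N. (b m y)\<^sup>2) \<le> ?G y" for N
        using sum_le by (auto simp: sum_nonneg)
      show "(\<lambda>y. \<Sum>m=1..N. (b m y)\<^sup>2) \<in> borel_measurable B" for N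
        using b_meas by (intro borel_measurable_sum borel_measurable_power) auto
    qed (use int pars in auto)
    moreover have "(LINT y|B. (\<Sum>m=1..N. (b m y)\<^sup>2)) = (\<Sum>m=1..N. LINT y|B. (b m y)\<^sup>2)" for N
      using b_sq by (intro Bochner_Integration.integral_sum) (auto simp: square_integrable_real)
    ultimately show ?thesis by simp
  qed
  show "(\<lambda>N. \<Sum>m=1..N. \<Sum>n=1..N. (LINT y|B. (LINT x|A. K y x * e m x) * \<phi> n y)\<^sup>2)
      \<longlonglongrightarrow> (LINT y|B. LINT x|A. (K y x)\<^sup>2)"
    unfolding b_def[symmetric]
    by (rule tendsto_square_partial_sums[OF _ orthonormal_basis_L2_parseval[OF \<phi> b_sq] outer]) simp_all
qed

section \<open>Gaussian sums and limits in mean square\<close>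

text \<open>
  A linear combination with at least one nonzero coefficient is normally distributed with variance
  \<open>v\<close>; zero coefficients are discarded first because a normal density needs a positive variance.
\<close>
lemma (in prob_space) gaussian_sum_moments:
  fixes Z :: "'i \<Rightarrow> 'a \<Rightarrow> real" and c :: "'i \<Rightarrow> real"
  assumes I: "finite I" and indep: "indep_vars (\<lambda>_. borel) Z I"
    and normal: "\<And>i. i \<in> I \<Longrightarrow> distributed M lborel (Z i) std_normal_density"
  defines "S \<equiv> \<lambda>\<omega>. \<Sum>i\<in>I. c i * Z i \<omega>" and "v \<equiv> \<Sum>i\<in>I. (c i)\<^sup>2"
  shows "has_bochner_integral M S 0"
    and "has_bochner_integral M (\<lambda>\<omega>. (S \<omega>)\<^sup>2) v"
    and "has_bochner_integral M (\<lambda>\<omega>. (S \<omega>) ^ 4) (3 * v\<^sup>2)"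
proof -
  define J where "J = {i \<in> I. c i \<noteq> 0}"
  have J: "finite J" "J \<subseteq> I" using I by (auto simp: J_def)
  have SJ: "S = (\<lambda>\<omega>. \<Sum>i\<in>J. c i * Z i \<omega>)" unfolding S_def J_def
    by (rule ext, rule sum.mono_neutral_right) (use I in auto)
  have vJ: "v = (\<Sum>i\<in>J. (c i)\<^sup>2)" unfolding v_def J_def
    by (rule sum.mono_neutral_right) (use I in auto)
  have "has_bochner_integral M S 0 \<and> has_bochner_integral M (\<lambda>\<omega>. (S \<omega>)\<^sup>2) v
    \<and> has_bochner_integral M (\<lambda>\<omega>. (S \<omega>) ^ 4) (3 * v\<^sup>2)"
  proof (cases "J = {}")
    case True
    then show ?thesis using has_bochner_integral_zero by (simp add: SJ vJ)
  next
    case False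
    define \<sigma> where "\<sigma> = sqrt v"
    have v0: "v > 0" unfolding vJ using J False by (intro sum_pos) (auto simp: J_def)
    then have \<sigma>: "\<sigma> > 0" "\<sigma>\<^sup>2 = v" by (simp_all add: \<sigma>_def)
    have "distributed M lborel (\<lambda>\<omega>. \<Sum>i\<in>J. c i * Z i \<omega>) (normal_density (\<Sum>i\<in>J. 0) (sqrt (\<Sum>i\<in>J. \<bar>c i\<bar>\<^sup>2)))"
    proof (rule sum_indep_normal[OF J(1) False])
      show "indep_vars (\<lambda>i. borel) (\<lambda>i \<omega>. c i * Z i \<omega>) J"
        by (rule indep_vars_compose2[OF indep_vars_subset[OF indep J(2)]]) simp
      show "0 < \<bar>c i\<bar>" if "i \<in> J" for i using that by (simp add: J_def)
      show "distributed M lborel (\<lambda>\<omega>. c i * Z i \<omega>) (normal_density 0 \<bar>c i\<bar>)" if "i \<in> J" for i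
        using normal_density_affine[OF normal[of i], of "c i" 0] that by (simp add: J_def)
    qed
    then have D: "distributed M lborel S (normal_density 0 \<sigma>)"
      by (simp add: SJ vJ \<sigma>_def)
    have moment: "has_bochner_integral M (\<lambda>\<omega>. S \<omega> ^ k) r"
      if "has_bochner_integral lborel (\<lambda>x. normal_density 0 \<sigma> x * x ^ k) r" for k r
      using that distributed_integrable[OF D, of "\<lambda>x. x ^ k"] distributed_integral[OF D, of "\<lambda>x. x ^ k"]
      by (simp add: has_bochner_integral_iff)
    have "has_bochner_integral lborel (\<lambda>x. normal_density 0 \<sigma> x * x ^ 1) 0"
      using normal_moment_odd[OF \<sigma>(1), of 0 0] by simp
    moreover have "has_bochner_integral lborel (\<lambda>x. normal_density 0 \<sigma> x * x ^ 2) v"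
      using normal_moment_even[OF \<sigma>(1), of 0 1] \<sigma> by (simp add: fact_numeral)
    moreover have "has_bochner_integral lborel (\<lambda>x. normal_density 0 \<sigma> x * x ^ 4) (3 * v\<^sup>2)"
      using normal_moment_even[OF \<sigma>(1), of 0 2] \<sigma>(2) by (simp add: fact_numeral power_divide)
    ultimately show ?thesis using moment[of 1 0] moment[of 2 v] moment[of 4 "3 * v\<^sup>2"] by simp
  qed
  then show "has_bochner_integral M S 0" "has_bochner_integral M (\<lambda>\<omega>. (S \<omega>)\<^sup>2) v"
    "has_bochner_integral M (\<lambda>\<omega>. (S \<omega>) ^ 4) (3 * v\<^sup>2)" by auto
qed

lemma tendsto_square_zero_cancel:
  fixes a :: "'b \<Rightarrow> real"
  assumes "((\<lambda>x. (a x)\<^sup>2) \<longlongrightarrow> 0) F"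
  shows "(a \<longlongrightarrow> 0) F"
proof -
  have "((\<lambda>x. sqrt ((a x)\<^sup>2)) \<longlongrightarrow> sqrt 0) F" by (rule tendsto_real_sqrt[OF assms])
  then show ?thesis by (intro tendsto_rabs_zero_cancel[of a]) simp
qed

lemma L2_tendsto_norm:
  fixes F :: "nat \<Rightarrow> 'a \<Rightarrow> real"
  assumes F: "\<And>N. square_integrable M (F N)" and f: "square_integrable M f"
    and lim: "(\<lambda>N. LINT x|M. (F N x - f x)\<^sup>2) \<longlonglongrightarrow> 0"
  shows "(\<lambda>N. LINT x|M. (F N x)\<^sup>2) \<longlonglongrightarrow> (LINT x|M. (f x)\<^sup>2)"
proof -
  let ?d = "\<lambda>N x. F N x - f x"
  have d: "square_integrable M (?d N)" for N by (rule square_integrable_diff[OF F f])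
  have "(\<lambda>N. (LINT x|M. f x * ?d N x)\<^sup>2) \<longlonglongrightarrow> 0"
  proof (rule tendsto_sandwich[OF _ _ tendsto_const])
    show "(\<lambda>N. (LINT x|M. (f x)\<^sup>2) * (LINT x|M. (?d N x)\<^sup>2)) \<longlonglongrightarrow> 0"
      by (rule tendsto_mult_right_zero[OF lim])
  qed (use L2_Cauchy_Schwarz[OF f d] in auto)
  then have cross: "(\<lambda>N. LINT x|M. f x * ?d N x) \<longlonglongrightarrow> 0" by (rule tendsto_square_zero_cancel)
  have "(LINT x|M. (F N x)\<^sup>2) = (LINT x|M. (f x)\<^sup>2) + 2 * (LINT x|M. f x * ?d N x) + (LINT x|M. (?d N x)\<^sup>2)" for N
  proof -
    have "(LINT x|M. (F N x)\<^sup>2) = (LINT x|M. (f x)\<^sup>2 + 2 * (f x * ?d N x) + (?d N x)\<^sup>2)"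
      by (simp add: power2_eq_square algebra_simps)
    also have "\<dots> = (LINT x|M. (f x)\<^sup>2) + 2 * (LINT x|M. f x * ?d N x) + (LINT x|M. (?d N x)\<^sup>2)"
      using f d[of N] square_integrable_mult[OF f d, of N] by (simp add: square_integrable_real)
    finally show ?thesis .
  qed
  moreover have "(\<lambda>N. (LINT x|M. (f x)\<^sup>2) + 2 * (LINT x|M. f x * ?d N x) + (LINT x|M. (?d N x)\<^sup>2))
      \<longlonglongrightarrow> (LINT x|M. (f x)\<^sup>2) + 2 * 0 + 0"
    by (intro tendsto_add tendsto_const tendsto_mult_left cross lim)
  ultimately show ?thesis by simp
qed

lemma (in prob_space) square_integrable_imp_integrable:
  fixes f :: "'a \<Rightarrow> real"
  assumes "square_integrable M f"
  shows "integrable M f"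
  using square_integrable_mult[OF assms, of "\<lambda>_. 1"] by (simp add: square_integrable_real)

lemma (in prob_space) L2_tendsto_expectation:
  fixes F :: "nat \<Rightarrow> 'a \<Rightarrow> real"
  assumes F: "\<And>N. square_integrable M (F N)" and f: "square_integrable M f"
    and lim: "(\<lambda>N. LINT x|M. (F N x - f x)\<^sup>2) \<longlonglongrightarrow> 0"
  shows "(\<lambda>N. expectation (F N)) \<longlonglongrightarrow> expectation f"
proof -
  have one: "square_integrable M (\<lambda>_. 1 :: real)" by (simp add: square_integrable_real)
  have "(expectation (F N) - expectation f)\<^sup>2 \<le> (LINT x|M. (F N x - f x)\<^sup>2)" for N
    using L2_Cauchy_Schwarz[OF square_integrable_diff[OF F f] one, of N]
      square_integrable_imp_integrable[OF F] square_integrable_imp_integrable[OF f]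
    by (simp add: prob_space)
  then have "(\<lambda>N. (expectation (F N) - expectation f)\<^sup>2) \<longlonglongrightarrow> 0"
    by (intro tendsto_sandwich[OF _ _ tendsto_const lim]) auto
  then show ?thesis by (rule LIM_zero_cancel[OF tendsto_square_zero_cancel])
qed

text \<open>
  Convergence in mean square gives almost sure convergence along a subsequence; Fatou's lemma does
  the rest.
\<close>
lemma L2_limit_fourth_moment:
  fixes F :: "nat \<Rightarrow> 'a \<Rightarrow> real"
  assumes F: "\<And>N. square_integrable M (F N)" and f: "square_integrable M f"
    and lim: "(\<lambda>N. LINT x|M. (F N x - f x)\<^sup>2) \<longlonglongrightarrow> 0"
    and bound: "\<And>N. (\<integral>\<^sup>+x. ennreal ((F N x) ^ 4) \<partial>M) \<le> ennreal (b N)" and b: "b \<longlonglongrightarrow> B"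
  shows "(\<integral>\<^sup>+x. ennreal ((f x) ^ 4) \<partial>M) \<le> ennreal B"
proof -
  have [measurable]: "F N \<in> borel_measurable M" "f \<in> borel_measurable M" for N
    using F f by (auto simp: square_integrable_def)
  have "\<exists>r::nat\<Rightarrow>nat. strict_mono r \<and> (AE x in M. (\<lambda>n. (F (r n) x - f x)\<^sup>2) \<longlonglongrightarrow> 0)"
    by (rule tendsto_L1_AE_subseq)
      (use square_integrable_diff[OF F f] lim in \<open>auto simp: square_integrable_real\<close>)
  then obtain r :: "nat \<Rightarrow> nat" where r: "strict_mono r"
    and AE: "AE x in M. (\<lambda>n. (F (r n) x - f x)\<^sup>2) \<longlonglongrightarrow> 0" by blast
  have "(\<integral>\<^sup>+x. ennreal ((f x) ^ 4) \<partial>M) = (\<integral>\<^sup>+x. liminf (\<lambda>n. ennreal ((F (r n) x) ^ 4)) \<partial>M)"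
  proof (rule nn_integral_cong_AE)
    show "AE x in M. ennreal ((f x) ^ 4) = liminf (\<lambda>n. ennreal ((F (r n) x) ^ 4))"
      using AE
    proof eventually_elim
      case (elim x)
      then have "(\<lambda>n. F (r n) x) \<longlonglongrightarrow> f x"
        by (rule LIM_zero_cancel[OF tendsto_square_zero_cancel])
      then have "(\<lambda>n. ennreal ((F (r n) x) ^ 4)) \<longlonglongrightarrow> ennreal ((f x) ^ 4)"
        by (intro tendsto_ennrealI tendsto_power)
      from lim_imp_Liminf[OF _ this] show ?case by simp
    qed
  qed
  also have "\<dots> \<le> liminf (\<lambda>n. \<integral>\<^sup>+x. ennreal ((F (r n) x) ^ 4) \<partial>M)"
    by (rule nn_integral_liminf) measurable
  also have "\<dots> \<le> liminf (\<lambda>n. ennreal (b (r n)))"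
    by (rule Liminf_mono) (simp add: bound)
  also have "\<dots> = ennreal B"
    using LIMSEQ_subseq_LIMSEQ[OF b r]
    by (intro lim_imp_Liminf tendsto_ennrealI) (simp_all add: comp_def)
  finally show ?thesis .
qed

section \<open>The Kolmogorov continuity criterion\<close>

definition dyadic_floor :: "nat \<Rightarrow> real \<Rightarrow> real" where
  "dyadic_floor k x = real_of_int \<lfloor>2 ^ k * x\<rfloor> / 2 ^ k"

lemma dyadic_floor_bounds: "dyadic_floor k x \<le> x" "x - dyadic_floor k x \<le> 1 / 2 ^ k"
proof -
  have "real_of_int \<lfloor>2 ^ k * x\<rfloor> \<le> 2 ^ k * x" "2 ^ k * x \<le> real_of_int \<lfloor>2 ^ k * x\<rfloor> + 1" by linarith+
  then have "real_of_int \<lfloor>2 ^ k * x\<rfloor> / 2 ^ k \<le> x" "x \<le> (real_of_int \<lfloor>2 ^ k * x\<rfloor> + 1) / 2 ^ k"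
    by (simp_all only: pos_le_divide_eq pos_divide_le_eq zero_less_power zero_less_numeral mult.commute)
  then show "dyadic_floor k x \<le> x" "x - dyadic_floor k x \<le> 1 / 2 ^ k"
    by (simp_all add: dyadic_floor_def add_divide_distrib)
qed

text \<open>
  Numerators of the dyadic rationals of level \<open>k\<close> in \<open>[-n, n]\<close>.
\<close>
definition dyadic_index :: "nat \<Rightarrow> nat \<Rightarrow> int set" where
  "dyadic_index n k = {- (int n * 2 ^ k)..int n * 2 ^ k}"

lemma dyadic_index_floor:
  assumes "\<bar>x\<bar> \<le> real n" shows "\<lfloor>2 ^ k * x\<rfloor> \<in> dyadic_index n k"
proof -
  have "2 ^ k * x \<le> 2 ^ k * real n" "2 ^ k * (- real n) \<le> 2 ^ k * x"
    using assms by (intro mult_left_mono; simp)+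
  moreover have "real_of_int (int n * 2 ^ k) = 2 ^ k * real n" "real_of_int (- (int n * 2 ^ k)) = 2 ^ k * (- real n)"
    by simp_all
  moreover have "real_of_int \<lfloor>2 ^ k * x\<rfloor> \<le> 2 ^ k * x" by linarith
  ultimately have "real_of_int \<lfloor>2 ^ k * x\<rfloor> \<le> real_of_int (int n * 2 ^ k)"
    "real_of_int (- (int n * 2 ^ k)) \<le> 2 ^ k * x"
    by argo+
  then have "\<lfloor>2 ^ k * x\<rfloor> \<le> int n * 2 ^ k" "- (int n * 2 ^ k) \<le> \<lfloor>2 ^ k * x\<rfloor>"
    by (simp_all only: le_floor_iff of_int_le_iff)
  then show ?thesis by (simp add: dyadic_index_def)
qed

text \<open>
  If neighbouring dyadic values of \<open>f\<close> at level \<open>k\<close> differ by at most \<open>B \<theta>\<^sup>k\<close>, then the step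
  functions \<open>x \<mapsto> f (dyadic_floor k x)\<close> converge uniformly at a geometric rate. Each of them is
  discontinuous, but moves by at most \<open>B \<theta>\<^sup>k\<close> over distances up to \<open>2\<^sup>-\<^sup>k\<close>, which makes the limit
  continuous.
\<close>
lemma continuous_on_dyadic_step_limit:
  fixes f :: "real \<Rightarrow> real"
  assumes \<theta>: "0 < \<theta>" "\<theta> < 1"
    and incr: "\<And>k j. j \<in> dyadic_index n k \<Longrightarrow> \<bar>f (real_of_int (j + 1) / 2 ^ k) - f (real_of_int j / 2 ^ k)\<bar> \<le> B * \<theta> ^ k"
  shows "continuous_on {- real n..real n} (\<lambda>x. lim (\<lambda>k. f (dyadic_floor k x)))"
proof -
  define s where "s k x = f (dyadic_floor k x)" for k x
  have B: "0 \<le> B"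
  proof -
    have "0 \<in> dyadic_index n 0" by (simp add: dyadic_index_def)
    from incr[OF this] show ?thesis by simp
  qed
  have refine: "\<bar>s (Suc k) x - s k x\<bar> \<le> B * \<theta> * \<theta> ^ k" if x: "\<bar>x\<bar> \<le> real n" for k x
  proof -
    define m where "m = \<lfloor>2 ^ k * x\<rfloor>"
    have m: "real_of_int m \<le> 2 ^ k * x" "2 ^ k * x < real_of_int m + 1" by (auto simp: m_def)
    have "\<lfloor>2 * (2 ^ k * x)\<rfloor> = 2 * m \<or> \<lfloor>2 * (2 ^ k * x)\<rfloor> = 2 * m + 1"
      using m by (auto simp: floor_eq_iff)
    then have m2: "\<lfloor>2 ^ Suc k * x\<rfloor> = 2 * m \<or> \<lfloor>2 ^ Suc k * x\<rfloor> = 2 * m + 1"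
      by (simp add: mult.assoc)
    have sk: "s k x = f (real_of_int (2 * m) / 2 ^ Suc k)"
      by (simp add: s_def dyadic_floor_def m_def)
    show ?thesis
    proof (cases "\<lfloor>2 ^ Suc k * x\<rfloor> = 2 * m")
      case True
      then have "s (Suc k) x = f (real_of_int (2 * m) / 2 ^ Suc k)"
        unfolding s_def dyadic_floor_def by (simp only:)
      then show ?thesis using B \<theta> by (simp add: sk)
    next
      case False
      then have "\<lfloor>2 ^ Suc k * x\<rfloor> = 2 * m + 1" using m2 by blast
      then have "s (Suc k) x = f (real_of_int (2 * m + 1) / 2 ^ Suc k)"
        unfolding s_def dyadic_floor_def by (simp only:)
      moreover have "2 * m \<in> dyadic_index n (Suc k)"
      proof -
        have "m \<in> dyadic_index n k" using dyadic_index_floor[OF x, of k] by (simp only: m_def)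
        then have "- (int n * 2 ^ k) \<le> m" "m \<le> int n * 2 ^ k" by (simp_all add: dyadic_index_def)
        moreover have "int n * 2 ^ Suc k = 2 * (int n * 2 ^ k)" by simp
        ultimately have "- (int n * 2 ^ Suc k) \<le> 2 * m" "2 * m \<le> int n * 2 ^ Suc k" by linarith+
        then show ?thesis by (simp only: dyadic_index_def atLeastAtMost_iff)
      qed
      ultimately show ?thesis using incr[of "2 * m" "Suc k"] unfolding sk by (simp add: mult.assoc)
    qed
  qed
  have summ: "summable (\<lambda>k. s (Suc k) x - s k x)" if x: "\<bar>x\<bar> \<le> real n" for x
    by (rule summable_comparison_test'[of "\<lambda>k. B * \<theta> * \<theta> ^ k"])
      (use refine[OF x] \<theta> in \<open>auto intro!: summable_mult summable_geometric\<close>)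
  have conv: "convergent (\<lambda>k. s k x)" if x: "\<bar>x\<bar> \<le> real n" for x
  proof -
    have "convergent (\<lambda>n. s 0 x + (\<Sum>k<n. s (Suc k) x - s k x))"
      using summ[OF x] by (intro convergent_add convergent_const) (simp add: summable_iff_convergent)
    then show ?thesis by (subst (asm) sum_lessThan_telescope) simp
  qed
  define v where "v x = lim (\<lambda>k. s k x)" for x
  have sv: "(\<lambda>k. s k x) \<longlonglongrightarrow> v x" if "\<bar>x\<bar> \<le> real n" for x
    using conv[OF that] by (simp add: v_def convergent_LIMSEQ_iff)
  have tail: "\<bar>v x - s k x\<bar> \<le> B / (1 - \<theta>) * \<theta> ^ k" if x: "\<bar>x\<bar> \<le> real n" for k x
  proof -
    have part: "\<bar>s (k + i) x - s k x\<bar> \<le> B / (1 - \<theta>) * \<theta> ^ k" for i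
    proof -
      have "\<bar>s (k + i) x - s k x\<bar> \<le> B * \<theta> ^ k * (\<Sum>l<i. \<theta> ^ l)"
      proof (induction i)
        case (Suc i)
        have "\<bar>s (k + Suc i) x - s k x\<bar> \<le> \<bar>s (Suc (k + i)) x - s (k + i) x\<bar> + \<bar>s (k + i) x - s k x\<bar>" by simp
        also have "\<dots> \<le> B * \<theta> * \<theta> ^ (k + i) + B * \<theta> ^ k * (\<Sum>l<i. \<theta> ^ l)"
          by (intro add_mono refine[OF x] Suc)
        also have "B * \<theta> * \<theta> ^ (k + i) \<le> B * 1 * \<theta> ^ (k + i)"
          using B \<theta> by (intro mult_right_mono mult_left_mono) auto
        also have "B * 1 * \<theta> ^ (k + i) + B * \<theta> ^ k * (\<Sum>l<i. \<theta> ^ l) = B * \<theta> ^ k * (\<Sum>l<Suc i. \<theta> ^ l)"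
          by (simp add: power_add algebra_simps)
        finally show ?case by simp
      qed simp
      moreover have "(\<Sum>l<i. \<theta> ^ l) \<le> 1 / (1 - \<theta>)"
      proof -
        have "(\<Sum>l<i. \<theta> ^ l) \<le> (\<Sum>l. \<theta> ^ l)"
          using \<theta> by (intro sum_le_suminf summable_geometric) auto
        then show ?thesis using \<theta> by (simp add: suminf_geometric)
      qed
      then have "B * \<theta> ^ k * (\<Sum>l<i. \<theta> ^ l) \<le> B * \<theta> ^ k * (1 / (1 - \<theta>))"
        using B \<theta> by (intro mult_left_mono) auto
      ultimately show ?thesis by simp
    qed
    have "(\<lambda>i. \<bar>s (i + k) x - s k x\<bar>) \<longlonglongrightarrow> \<bar>v x - s k x\<bar>"
      by (intro tendsto_intros LIMSEQ_ignore_initial_segment sv x)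
    then show ?thesis
      by (rule tendsto_upperbound) (use part in \<open>auto simp: add.commute\<close>)
  qed
  have near: "\<bar>s k x - s k y\<bar> \<le> B * \<theta> ^ k"
    if x: "\<bar>x\<bar> \<le> real n" and y: "\<bar>y\<bar> \<le> real n" and xy: "\<bar>x - y\<bar> \<le> 1 / 2 ^ k" for k x y
  proof -
    have *: "\<bar>s k x - s k y\<bar> \<le> B * \<theta> ^ k"
      if x: "\<bar>x\<bar> \<le> real n" and le: "x \<le> y" "y \<le> x + 1 / 2 ^ k" for x y
    proof -
      have "2 ^ k * x \<le> 2 ^ k * y" using le by (intro mult_left_mono) auto
      moreover have "2 ^ k * y \<le> 2 ^ k * x + 1" using mult_left_mono[OF le(2), of "2 ^ k"] by (simp add: distrib_left)
      ultimately have "\<lfloor>2 ^ k * y\<rfloor> = \<lfloor>2 ^ k * x\<rfloor> \<or> \<lfloor>2 ^ k * y\<rfloor> = \<lfloor>2 ^ k * x\<rfloor> + 1" by linarith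
      then show ?thesis
        using incr[OF dyadic_index_floor[OF x, of k]] B \<theta>
        by (auto simp: s_def dyadic_floor_def abs_minus_commute)
    qed
    show ?thesis
    proof (cases "x \<le> y")
      case True
      then show ?thesis using *[OF x] xy by auto
    next
      case False
      then show ?thesis using *[OF y, of x] xy by (auto simp: abs_minus_commute)
    qed
  qed
  have "continuous_on {- real n..real n} v"
    unfolding continuous_on_iff
  proof (intro ballI allI impI)
    fix x e :: real assume x: "x \<in> {- real n..real n}" and e: "e > 0"
    define C where "C = 2 * (B / (1 - \<theta>)) + B"
    have "(\<lambda>k. C * \<theta> ^ k) \<longlonglongrightarrow> C * 0"
      using \<theta> by (intro tendsto_mult_left LIMSEQ_power_zero) auto
    then have "\<forall>\<^sub>F k in sequentially. C * \<theta> ^ k < e" using e by (intro order_tendstoD) auto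
    then obtain k where k: "C * \<theta> ^ k < e" by (auto simp: eventually_sequentially)
    show "\<exists>d>0. \<forall>y\<in>{- real n..real n}. dist y x < d \<longrightarrow> dist (v y) (v x) < e"
    proof (intro exI[of _ "1 / 2 ^ k"] conjI ballI impI)
      fix y assume y: "y \<in> {- real n..real n}" and d: "dist y x < 1 / 2 ^ k"
      have xn: "\<bar>x\<bar> \<le> real n" "\<bar>y\<bar> \<le> real n" using x y by auto
      have "\<bar>v y - v x\<bar> \<le> \<bar>v y - s k y\<bar> + \<bar>s k y - s k x\<bar> + \<bar>v x - s k x\<bar>" by linarith
      also have "\<dots> \<le> B / (1 - \<theta>) * \<theta> ^ k + B * \<theta> ^ k + B / (1 - \<theta>) * \<theta> ^ k"
        using d by (intro add_mono tail near xn) (simp add: dist_real_def)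
      also have "\<dots> = C * \<theta> ^ k" by (simp add: C_def algebra_simps)
      finally show "dist (v y) (v x) < e" using k by (simp add: dist_real_def)
    qed simp
  qed
  then show "continuous_on {- real n..real n} (\<lambda>x. lim (\<lambda>k. f (dyadic_floor k x)))"
    by (simp add: v_def s_def)
qed

text \<open>
  At level \<open>k\<close> there are about \<open>2\<^sup>k\<close> dyadic increments in a bounded interval, each with fourth moment
  of order \<open>4\<^sup>-\<^sup>k\<close>. Hence the sum of their fourth powers, even weighted with \<open>\<theta>\<^sup>-\<^sup>4\<^sup>k\<close> for some \<open>\<theta>\<close> with
  \<open>2 \<theta>\<^sup>4 > 1\<close>, has finite expectation, and almost surely the increments are \<open>O(\<theta>\<^sup>k)\<close>. The limit of the
  dyadic step functions is continuous for such outcomes and almost surely agrees with \<open>X\<close> at each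
  point.
\<close>
lemma kolmogorov_chentsov:
  fixes X :: "real \<Rightarrow> 'a \<Rightarrow> real"
  assumes meas [measurable]: "\<And>x. X x \<in> borel_measurable M"
    and K: "0 \<le> K" and mom: "\<And>x y. (\<integral>\<^sup>+\<omega>. ennreal ((X x \<omega> - X y \<omega>) ^ 4) \<partial>M) \<le> ennreal (K * (x - y)\<^sup>2)"
  shows "\<exists>V. continuous_modification M X V"
proof -
  \<comment> \<open>The choice matters only through \<open>1 / 2 < \<theta>\<^sup>4\<close> and \<open>\<theta> < 1\<close>.\<close>
  define \<theta> :: real where "\<theta> = 9 / 10"
  have \<theta>: "0 < \<theta>" "\<theta> < 1" by (auto simp: \<theta>_def)
  define d where "d k j \<omega> = X (real_of_int (j + 1) / 2 ^ k) \<omega> - X (real_of_int j / 2 ^ k) \<omega>" for k :: nat and j \<omega>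
  have [measurable]: "d k j \<in> borel_measurable M" for k j unfolding d_def by measurable
  define A where "A n \<omega> = (\<Sum>k. ennreal ((1 / \<theta> ^ 4) ^ k) * (\<Sum>j\<in>dyadic_index n k. ennreal ((d k j \<omega>) ^ 4)))" for n \<omega>
  have [measurable]: "A n \<in> borel_measurable M" for n unfolding A_def by measurable
  have d_mom: "(\<integral>\<^sup>+\<omega>. ennreal ((d k j \<omega>) ^ 4) \<partial>M) \<le> ennreal (K * (1 / 4) ^ k)" for k j
  proof -
    have "real_of_int (j + 1) / 2 ^ k - real_of_int j / 2 ^ k = 1 / 2 ^ k" by (simp add: add_divide_distrib)
    moreover have "(1 / 2 ^ k)\<^sup>2 = (1 / 4 :: real) ^ k"
      by (simp add: power_divide power2_eq_square flip: power_mult_distrib)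
    ultimately show ?thesis using mom[of "real_of_int (j + 1) / 2 ^ k" "real_of_int j / 2 ^ k"] by (simp only: d_def)
  qed
  have A_fin: "AE \<omega> in M. A n \<omega> \<noteq> \<infinity>" for n
  proof -
    have "(\<integral>\<^sup>+\<omega>. A n \<omega> \<partial>M) = (\<Sum>k. ennreal ((1 / \<theta> ^ 4) ^ k) * (\<Sum>j\<in>dyadic_index n k. \<integral>\<^sup>+\<omega>. ennreal ((d k j \<omega>) ^ 4) \<partial>M))"
      unfolding A_def by (simp add: nn_integral_suminf nn_integral_cmult nn_integral_sum del: sum_ennreal)
    also have "\<dots> \<le> (\<Sum>k. ennreal ((2 * real n + 1) * K * (1 / (2 * \<theta> ^ 4)) ^ k))"
    proof (rule suminf_le)
      fix k
      have card: "real (card (dyadic_index n k)) \<le> (2 * real n + 1) * 2 ^ k"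
      proof -
        have "card (dyadic_index n k) = nat (2 * (int n * 2 ^ k) + 1)" by (simp add: dyadic_index_def)
        also have "real \<dots> = 2 * (real n * 2 ^ k) + 1" by (subst of_nat_nat) (auto intro: add_nonneg_nonneg)
        also have "\<dots> \<le> 2 * (real n * 2 ^ k) + 2 ^ k" by simp
        finally show ?thesis by (simp add: algebra_simps)
      qed
      have "(\<Sum>j\<in>dyadic_index n k. \<integral>\<^sup>+\<omega>. ennreal ((d k j \<omega>) ^ 4) \<partial>M) \<le> (\<Sum>j\<in>dyadic_index n k. ennreal (K * (1 / 4) ^ k))"
        by (intro sum_mono d_mom)
      also have "\<dots> = ennreal (real (card (dyadic_index n k)) * (K * (1 / 4) ^ k))"
        using K by (simp add: ennreal_mult ennreal_of_nat_eq_real_of_nat)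
      also have "\<dots> \<le> ennreal ((2 * real n + 1) * 2 ^ k * (K * (1 / 4) ^ k))"
        using K by (intro ennreal_leI mult_right_mono card) auto
      finally have "ennreal ((1 / \<theta> ^ 4) ^ k) * (\<Sum>j\<in>dyadic_index n k. \<integral>\<^sup>+\<omega>. ennreal ((d k j \<omega>) ^ 4) \<partial>M)
          \<le> ennreal ((1 / \<theta> ^ 4) ^ k) * ennreal ((2 * real n + 1) * 2 ^ k * (K * (1 / 4) ^ k))"
        by (intro mult_left_mono) auto
      also have "\<dots> = ennreal ((1 / \<theta> ^ 4) ^ k * ((2 * real n + 1) * 2 ^ k * (K * (1 / 4) ^ k)))"
        using \<theta> by (subst ennreal_mult[symmetric]) (auto intro!: mult_nonneg_nonneg K)
      also have "(1 / \<theta> ^ 4) ^ k * ((2 * real n + 1) * 2 ^ k * (K * (1 / 4) ^ k))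
          = (2 * real n + 1) * K * (1 / (2 * \<theta> ^ 4)) ^ k"
      proof -
        have "(1 / \<theta> ^ 4) ^ k * (2 ^ k * (1 / 4) ^ k) = (1 / (2 * \<theta> ^ 4)) ^ k"
          unfolding power_mult_distrib[symmetric] by (simp add: mult.commute)
        moreover have "a * (b * c * (K * e)) = b * K * (a * (c * e))" for a b c e :: real
          by (simp only: mult_ac)
        ultimately show ?thesis by (simp only:)
      qed
      finally show "ennreal ((1 / \<theta> ^ 4) ^ k) * (\<Sum>j\<in>dyadic_index n k. \<integral>\<^sup>+\<omega>. ennreal ((d k j \<omega>) ^ 4) \<partial>M)
        \<le> ennreal ((2 * real n + 1) * K * (1 / (2 * \<theta> ^ 4)) ^ k)" .
    qed auto
    also have "\<dots> < \<infinity>"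
    proof -
      have "summable (\<lambda>k. (2 * real n + 1) * K * (1 / (2 * \<theta> ^ 4)) ^ k)"
        by (intro summable_mult summable_geometric) (simp add: \<theta>_def power_divide)
      then show ?thesis using K by (subst suminf_ennreal2) (auto simp: \<theta>_def)
    qed
    finally show ?thesis by (intro nn_integral_PInf_AE) auto
  qed
  define G where "G = {\<omega> \<in> space M. \<forall>n. A n \<omega> \<noteq> \<infinity>}"
  have [measurable]: "G \<in> sets M" unfolding G_def by measurable
  have G_AE: "AE \<omega> in M. \<omega> \<in> G"
  proof -
    have "AE \<omega> in M. \<forall>n. A n \<omega> \<noteq> \<infinity>" using A_fin by (simp add: AE_all_countable)
    then show ?thesis using AE_space by eventually_elim (simp add: G_def)
  qed
  have incr: "\<exists>B. \<forall>k. \<forall>j\<in>dyadic_index n k. \<bar>d k j \<omega>\<bar> \<le> B * \<theta> ^ k" if \<omega>: "\<omega> \<in> G" for n \<omega>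
  proof -
    obtain a where a: "A n \<omega> = ennreal a" "a \<ge> 0"
      using \<omega> by (cases "A n \<omega>") (auto simp: G_def)
    define B where "B = max 1 a"
    have "\<bar>d k j \<omega>\<bar> \<le> B * \<theta> ^ k" if j: "j \<in> dyadic_index n k" for k j
    proof -
      have "ennreal ((1 / \<theta> ^ 4) ^ k * (d k j \<omega>) ^ 4) = ennreal ((1 / \<theta> ^ 4) ^ k) * ennreal ((d k j \<omega>) ^ 4)"
        using \<theta> by (intro ennreal_mult) auto
      also have "\<dots> \<le> ennreal ((1 / \<theta> ^ 4) ^ k) * (\<Sum>j\<in>dyadic_index n k. ennreal ((d k j \<omega>) ^ 4))"
        using j by (intro mult_left_mono member_le_sum) (auto simp: dyadic_index_def)
      also have "\<dots> \<le> A n \<omega>"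
        unfolding A_def
        using sum_le_suminf[of "\<lambda>k. ennreal ((1 / \<theta> ^ 4) ^ k) * (\<Sum>j\<in>dyadic_index n k. ennreal ((d k j \<omega>) ^ 4))" "{k}"]
        by auto
      finally have "(1 / \<theta> ^ 4) ^ k * (d k j \<omega>) ^ 4 \<le> a" using a by (simp add: ennreal_le_iff)
      then have "(d k j \<omega>) ^ 4 \<le> a * (\<theta> ^ 4) ^ k" using \<theta> by (simp add: power_divide field_simps)
      also have "\<dots> \<le> B ^ 4 * (\<theta> ^ 4) ^ k"
      proof (rule mult_right_mono)
        have "a \<le> B" "1 \<le> B" by (auto simp: B_def)
        then show "a \<le> B ^ 4" using power_increasing[of 1 4 B] by simp
      qed (use \<theta> in simp)
      also have "\<dots> = (B * \<theta> ^ k) ^ 4" by (simp add: power_mult_distrib power_mult[symmetric] mult.commute)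
      finally have "\<bar>d k j \<omega>\<bar> ^ 4 \<le> (B * \<theta> ^ k) ^ 4" by simp
      then show ?thesis
        by (rule power_le_imp_le_base[of _ 3, simplified]) (use \<theta> in \<open>simp add: B_def\<close>)
    qed
    then show ?thesis by blast
  qed
  define V where "V x \<omega> = (if \<omega> \<in> G then lim (\<lambda>k. X (dyadic_floor k x) \<omega>) else 0)" for x \<omega>
  have "continuous_modification M X V"
    unfolding continuous_modification_def
  proof (intro conjI allI ballI)
    show "V x \<in> borel_measurable M" for x unfolding V_def by measurable
  next
    fix \<omega> assume "\<omega> \<in> space M"
    show "continuous_on UNIV (\<lambda>x. V x \<omega>)"
    proof (cases "\<omega> \<in> G")
      case True
      have c: "continuous_on {- real n..real n} (\<lambda>x. lim (\<lambda>k. X (dyadic_floor k x) \<omega>))" for n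
      proof -
        obtain B where "\<And>k j. j \<in> dyadic_index n k \<Longrightarrow> \<bar>d k j \<omega>\<bar> \<le> B * \<theta> ^ k"
          using incr[OF True, of n] by blast
        then show ?thesis unfolding d_def by (rule continuous_on_dyadic_step_limit[OF \<theta>])
      qed
      have "isCont (\<lambda>x. lim (\<lambda>k. X (dyadic_floor k x) \<omega>)) x" for x
      proof -
        obtain n where n: "\<bar>x\<bar> < real n" using reals_Archimedean2 by blast
        have "x \<in> interior {- real n..real n}" using n by (auto simp: interior_atLeastAtMost_real)
        then show ?thesis using c[of n] continuous_on_interior by blast
      qed
      then show ?thesis using True by (simp add: V_def continuous_at_imp_continuous_on)
    qed (simp add: V_def)
  next
    fix x
    have "(\<integral>\<^sup>+\<omega>. (\<Sum>k. ennreal ((X (dyadic_floor k x) \<omega> - X x \<omega>) ^ 4)) \<partial>M)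
        = (\<Sum>k. \<integral>\<^sup>+\<omega>. ennreal ((X (dyadic_floor k x) \<omega> - X x \<omega>) ^ 4) \<partial>M)"
      by (rule nn_integral_suminf) measurable
    also have "\<dots> \<le> (\<Sum>k. ennreal (K * (1 / 4) ^ k))"
    proof (rule suminf_le)
      fix k
      have "(dyadic_floor k x - x)\<^sup>2 \<le> (1 / 2 ^ k)\<^sup>2"
        using dyadic_floor_bounds[where k = k and x = x] by (intro power2_le_iff_abs_le[THEN iffD2]) auto
      also have "(1 / 2 ^ k)\<^sup>2 = (1 / 4 :: real) ^ k"
        by (simp add: power_divide power2_eq_square flip: power_mult_distrib)
      finally have "K * (dyadic_floor k x - x)\<^sup>2 \<le> K * (1 / 4) ^ k" using K by (intro mult_left_mono)
      then show "(\<integral>\<^sup>+\<omega>. ennreal ((X (dyadic_floor k x) \<omega> - X x \<omega>) ^ 4) \<partial>M) \<le> ennreal (K * (1 / 4) ^ k)"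
        using mom by (blast intro: order.trans ennreal_leI)
    qed auto
    also have "\<dots> < \<infinity>" using K by (subst suminf_ennreal2) (auto intro!: summable_mult summable_geometric)
    finally have "AE \<omega> in M. (\<Sum>k. ennreal ((X (dyadic_floor k x) \<omega> - X x \<omega>) ^ 4)) \<noteq> \<infinity>"
      by (intro nn_integral_PInf_AE) auto
    with G_AE show "AE \<omega> in M. V x \<omega> = X x \<omega>"
    proof eventually_elim
      case (elim \<omega>)
      have "summable (\<lambda>k. (X (dyadic_floor k x) \<omega> - X x \<omega>) ^ 4)"
        by (rule summable_suminf_not_top) (use elim in auto)
      then have "(\<lambda>k. (X (dyadic_floor k x) \<omega> - X x \<omega>) ^ 4) \<longlonglongrightarrow> 0" by (rule summable_LIMSEQ_zero)
      then have "(\<lambda>k. root 4 ((X (dyadic_floor k x) \<omega> - X x \<omega>) ^ 4)) \<longlonglongrightarrow> root 4 0"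
        by (rule tendsto_real_root)
      moreover have "root 4 (y ^ 4) = \<bar>y\<bar>" for y :: real using root_abs_power[of 4 y] by simp
      ultimately have "(\<lambda>k. \<bar>X (dyadic_floor k x) \<omega> - X x \<omega>\<bar>) \<longlonglongrightarrow> 0" by simp
      then have "(\<lambda>k. X (dyadic_floor k x) \<omega>) \<longlonglongrightarrow> X x \<omega>"
        by (rule LIM_zero_cancel[OF tendsto_rabs_zero_cancel])
      then show ?case using elim by (simp add: V_def limI)
    qed
  qed
  then show ?thesis by blast
qed

section \<open>The truncated solution as a Gaussian sum\<close>

text \<open>
  The kernel of the Hartley transform. It replaces the complex exponential for functions of either
  parity at once and keeps all coefficients real.
\<close>
definition cas :: "real \<Rightarrow> real" where "cas \<theta> = cos \<theta> + sin \<theta>"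

lemma cas_mult: "cas a * cas b = cos (a - b) + sin (a + b)"
  by (simp add: cas_def cos_diff sin_add algebra_simps)

lemma borel_measurable_cas [measurable]: "cas \<in> borel_measurable borel"
  unfolding cas_def by measurable

lemma cas_bound: "\<bar>cas \<theta>\<bar> \<le> 2"
  using abs_cos_le_one[of \<theta>] abs_sin_le_one[of \<theta>] unfolding cas_def by linarith

lemma integrable_bounded_mult:
  fixes f w :: "real \<Rightarrow> real"
  assumes f: "integrable lborel f" and w: "w \<in> borel_measurable borel" "\<And>x. \<bar>w x\<bar> \<le> B"
  shows "integrable lborel (\<lambda>x. w x * f x)"
proof (rule Bochner_Integration.integrable_bound)
  show "integrable lborel (\<lambda>x. B * f x)" using f by simp
  show "AE x in lborel. norm (w x * f x) \<le> norm (B * f x)"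
  proof (rule AE_I2)
    fix x
    have "\<bar>w x\<bar> * \<bar>f x\<bar> \<le> \<bar>B\<bar> * \<bar>f x\<bar>" using w(2)[of x] by (intro mult_right_mono) auto
    then show "norm (w x * f x) \<le> norm (B * f x)" by (simp add: abs_mult)
  qed
qed (use f w in auto)

text \<open>
  The coefficients of the fundamental solution, cut off at time \<open>t\<close>, in the basis of the time
  variable.
\<close>
definition kernel_coeff :: "(nat \<Rightarrow> real \<Rightarrow> real) \<Rightarrow> real \<Rightarrow> nat \<Rightarrow> real \<Rightarrow> real" where
  "kernel_coeff \<psi> t m \<xi> = (LINT s:{0..t}|lborel. tricomi_C t s \<bar>\<xi>\<bar> * \<psi> m s)"

lemma kernel_coeff_even: "kernel_coeff \<psi> t m (- \<xi>) = kernel_coeff \<psi> t m \<xi>"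
  by (simp add: kernel_coeff_def)

abbreviation (input) halfline :: "real measure" where "halfline \<equiv> restrict_space lborel {0..}"

lemma integral_halfline: 
  fixes f :: "real \<Rightarrow> real"
  shows "(LINT s|halfline. indicator {0..t} s * f s) = (LINT s:{0..t}|lborel. f s)"
  by (subst integral_restrict_space)
    (auto simp: set_lebesgue_integral_def indicator_def intro!: Bochner_Integration.integral_cong)

lemma borel_measurable_tricomi_C:
  "(\<lambda>(\<xi>, s). tricomi_C t s \<bar>\<xi>\<bar>) \<in> borel_measurable (lborel \<Otimes>\<^sub>M lborel)"
proof -
  have "(\<lambda>(\<xi>, s). tricomi_C t s \<bar>\<xi>\<bar>) = (\<lambda>(\<xi>, s). if \<xi> = 0 then t - s else
     (airy_f (- (\<bar>\<xi>\<bar> powr (2/3)) * t) * airy_g (- (\<bar>\<xi>\<bar> powr (2/3)) * s)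
          - airy_g (- (\<bar>\<xi>\<bar> powr (2/3)) * t) * airy_f (- (\<bar>\<xi>\<bar> powr (2/3)) * s)) / \<bar>\<xi>\<bar> powr (2/3))"
  proof (rule ext, clarify)
    fix \<xi> s :: real
    show "tricomi_C t s \<bar>\<xi>\<bar> = (if \<xi> = 0 then t - s else
     (airy_f (- (\<bar>\<xi>\<bar> powr (2/3)) * t) * airy_g (- (\<bar>\<xi>\<bar> powr (2/3)) * s)
          - airy_g (- (\<bar>\<xi>\<bar> powr (2/3)) * t) * airy_f (- (\<bar>\<xi>\<bar> powr (2/3)) * s)) / \<bar>\<xi>\<bar> powr (2/3))"
    proof (cases "\<xi> = 0")
      case True
      then show ?thesis by (simp add: tricomi_C_def)
    next
      case False
      then show ?thesis using tricomi_C_airy[of "\<bar>\<xi>\<bar>" t s] by (simp only: if_False zero_less_abs_iff not_False_eq_True simp_thms)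
    qed
  qed
  also have "\<dots> \<in> borel_measurable (lborel \<Otimes>\<^sub>M lborel)" by measurable
  finally show ?thesis .
qed

lemma tricomi_C_truncated_square_integrable:
  "square_integrable halfline (\<lambda>s. indicator {0..t} s * tricomi_C t s \<bar>\<xi>\<bar>)"
proof -
  have c: "continuous_on UNIV (\<lambda>s. tricomi_C t s \<bar>\<xi>\<bar>)" by (rule continuous_tricomi_C) simp
  then have [measurable]: "(\<lambda>s. tricomi_C t s \<bar>\<xi>\<bar>) \<in> borel_measurable borel"
    by (rule borel_measurable_continuous_onI)
  have "set_integrable lborel {0..t} (\<lambda>s. (tricomi_C t s \<bar>\<xi>\<bar>)\<^sup>2)"
    by (rule borel_integrable_atLeastAtMost')
      (intro continuous_intros continuous_on_subset[OF c], simp)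
  then have "integrable lborel (\<lambda>s. indicator {0..} s *\<^sub>R (indicator {0..t} s * tricomi_C t s \<bar>\<xi>\<bar>)\<^sup>2)"
    unfolding set_integrable_def
    by (rule Bochner_Integration.integrable_cong[THEN iffD1, rotated 2]) (auto simp: indicator_def)
  then have "integrable halfline (\<lambda>s. (indicator {0..t} s * tricomi_C t s \<bar>\<xi>\<bar>)\<^sup>2)"
    by (subst integrable_restrict_space) (simp_all add: set_integrable_def)
  moreover have "(\<lambda>s. indicator {0..t} s * tricomi_C t s \<bar>\<xi>\<bar>) \<in> borel_measurable halfline"
    by (rule measurable_restrict_space1) measurable
  ultimately show ?thesis by (simp add: square_integrable_real)
qed

text \<open>
  Parseval's identity for \<open>(\<xi>, s) \<mapsto> w(\<xi>) C(t,s,\<bar>\<xi>\<bar>)\<close> with a bounded weight. Weights made of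
  \<^const>\<open>cas\<close> at several points give mixed moments.
\<close>
lemma kernel_coeff_parseval:
  assumes t: "t \<ge> 0" and \<psi>: "orthonormal_basis_L2 halfline \<psi>"
    and w [measurable]: "w \<in> borel_measurable borel" and wB: "\<And>\<xi>. \<bar>w \<xi>\<bar> \<le> B"
  shows "m \<ge> 1 \<Longrightarrow> square_integrable lborel (\<lambda>\<xi>. w \<xi> * kernel_coeff \<psi> t m \<xi>)"
    and "(\<lambda>N. \<Sum>m=1..N. \<Sum>n=1..N. (LINT \<xi>|lborel. w \<xi> * kernel_coeff \<psi> t m \<xi> * hermite_basis n \<xi>)\<^sup>2)
      \<longlonglongrightarrow> (LINT \<xi>|lborel. (w \<xi>)\<^sup>2 * tricomi_energy t \<xi>)"
proof -
  define K where "K \<xi> s = w \<xi> * (indicator {0..t} s * tricomi_C t s \<bar>\<xi>\<bar>)" for \<xi> s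
  have eq1: "(LINT s|halfline. K \<xi> s * \<psi> m s) = w \<xi> * kernel_coeff \<psi> t m \<xi>" for \<xi> m
    unfolding K_def kernel_coeff_def integral_halfline[symmetric] by (simp add: mult.assoc)
  have eq2: "(LINT s|halfline. (K \<xi> s)\<^sup>2) = (w \<xi>)\<^sup>2 * tricomi_energy t \<xi>" for \<xi>
  proof -
    have "(K \<xi> s)\<^sup>2 = (w \<xi>)\<^sup>2 * (indicator {0..t} s * (tricomi_C t s \<bar>\<xi>\<bar>)\<^sup>2)" for s
      by (simp add: K_def power_mult_distrib indicator_def)
    then show ?thesis unfolding tricomi_energy_def integral_halfline[symmetric] by simp
  qed
  have sets: "sigma_finite_measure halfline"
    by (rule sigma_finite_measure_restrict_space[OF sigma_finite_lborel]) simp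
  have Kmeas: "case_prod K \<in> borel_measurable (lborel \<Otimes>\<^sub>M halfline)"
  proof -
    note borel_measurable_tricomi_C[measurable]
    have m1: "(\<lambda>p. w (fst p) * (indicator {0..t} (snd p) * (\<lambda>(\<xi>, s). tricomi_C t s \<bar>\<xi>\<bar>) p)) \<in> borel_measurable (lborel \<Otimes>\<^sub>M lborel)"
      by measurable
    have m2: "(\<lambda>p. (fst p, snd p)) \<in> measurable (lborel \<Otimes>\<^sub>M halfline) (lborel \<Otimes>\<^sub>M lborel)"
      by (intro measurable_Pair measurable_fst measurable_compose[OF measurable_snd measurable_restrict_space1]) simp
    from measurable_compose[OF m2 m1] show ?thesis
      by (simp add: K_def[abs_def] case_prod_unfold)
  qed
  have Ksq: "square_integrable halfline (K \<xi>)" for \<xi>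
    unfolding K_def by (rule square_integrable_cmult[OF tricomi_C_truncated_square_integrable])
  have int: "integrable lborel (\<lambda>\<xi>. LINT s|halfline. (K \<xi> s)\<^sup>2)"
    unfolding eq2
  proof (rule integrable_bounded_mult[OF integrable_tricomi_energy[OF t]])
    show "\<bar>(w \<xi>)\<^sup>2\<bar> \<le> B\<^sup>2" for \<xi> using wB[of \<xi>] by (simp add: abs_le_square_iff[symmetric])
  qed measurable
  note P = parseval_product[OF sets sigma_finite_lborel \<psi> hermite_orthonormal_basis Kmeas Ksq int]
  show "m \<ge> 1 \<Longrightarrow> square_integrable lborel (\<lambda>\<xi>. w \<xi> * kernel_coeff \<psi> t m \<xi>)"
    using P(1) unfolding eq1 .
  show "(\<lambda>N. \<Sum>m=1..N. \<Sum>n=1..N. (LINT \<xi>|lborel. w \<xi> * kernel_coeff \<psi> t m \<xi> * hermite_basis n \<xi>)\<^sup>2)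
      \<longlonglongrightarrow> (LINT \<xi>|lborel. (w \<xi>)\<^sup>2 * tricomi_energy t \<xi>)"
    using P(2) unfolding eq1 eq2 .
qed

lemma hermite_basis_parity: "hermite_basis n (- x) = (- 1) ^ (n - 1) * hermite_basis n x"
proof -
  have "hermite_poly k (- x) = (- 1) ^ k * hermite_poly k x" for k
    by (induction k x rule: hermite_poly.induct) (simp_all add: algebra_simps)
  then show ?thesis by (simp add: hermite_basis_def)
qed

text \<open>
  For even \<open>k\<close> only the cosine part of the exponential survives and \<open>(- i)\<^sup>k\<close> is real; for odd \<open>k\<close>
  only the sine part, and its factor \<open>i\<close> makes \<open>(- i)\<^sup>k i\<close> real. In both cases the surviving part may be
  replaced by \<^const>\<open>cas\<close>.
\<close>
lemma fourier_parity:
  assumes v: "integrable lborel v" and parity: "\<And>\<xi>. v (- \<xi>) = (- 1) ^ k * v \<xi>"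
  shows "(- \<i>) ^ k * (LINT \<xi>|lborel. exp (\<i> * of_real (\<xi> * x)) * complex_of_real (v \<xi>))
    = complex_of_real ((- 1) ^ (k div 2) * (LINT \<xi>|lborel. cas (\<xi> * x) * v \<xi>))"
proof -
  have int: "integrable lborel (\<lambda>\<xi>. cos (\<xi> * x) * v \<xi>)" "integrable lborel (\<lambda>\<xi>. sin (\<xi> * x) * v \<xi>)"
    by (rule integrable_bounded_mult[OF v, of _ 1]; simp)+
  let ?c = "LINT \<xi>|lborel. cos (\<xi> * x) * v \<xi>" and ?s = "LINT \<xi>|lborel. sin (\<xi> * x) * v \<xi>"
  have "exp (\<i> * of_real (\<xi> * x)) * complex_of_real (v \<xi>)
      = complex_of_real (cos (\<xi> * x) * v \<xi>) + \<i> * complex_of_real (sin (\<xi> * x) * v \<xi>)" for \<xi>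
  proof -
    have "exp (\<i> * of_real (\<xi> * x)) = complex_of_real (cos (\<xi> * x)) + \<i> * complex_of_real (sin (\<xi> * x))"
      unfolding cis_conv_exp[symmetric] by (simp add: complex_eq_iff)
    then show ?thesis by (simp add: distrib_right mult.assoc)
  qed
  then have exp_eq: "(LINT \<xi>|lborel. exp (\<i> * of_real (\<xi> * x)) * complex_of_real (v \<xi>)) = of_real ?c + \<i> * of_real ?s"
    using integrable_of_real[OF int(1), where 'a = complex] integrable_of_real[OF int(2), where 'a = complex]
      integral_of_real[OF int(1), where 'a = complex] integral_of_real[OF int(2), where 'a = complex]
    by (simp del: of_real_mult)
  have cas_eq: "(LINT \<xi>|lborel. cas (\<xi> * x) * v \<xi>) = ?c + ?s"
    using int by (simp add: cas_def distrib_right)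
  show ?thesis
  proof (cases "even k")
    case True
    then obtain j where j: "k = 2 * j" by blast
    have "?s = 0" by (rule integral_odd) (use parity True in simp)
    moreover have "(- \<i>) ^ k = complex_of_real ((- 1) ^ j)" by (simp add: j power_mult)
    ultimately show ?thesis unfolding exp_eq cas_eq by (simp add: j)
  next
    case False
    then obtain j where j: "k = 2 * j + 1" using oddE by blast
    have "?c = 0" by (rule integral_odd) (use parity False in simp)
    moreover have "(- \<i>) ^ k * \<i> = complex_of_real ((- 1) ^ j)"
    proof -
      have "(- \<i>) ^ k * \<i> = (- \<i>) ^ (2 * j) * (- \<i> * \<i>)"
        by (simp only: j power_add power_one_right mult.assoc)
      also have "(- \<i>) ^ (2 * j) = complex_of_real ((- 1) ^ j)" by (simp add: power_mult)
      finally show ?thesis by simp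
    qed
    ultimately show ?thesis unfolding exp_eq cas_eq by (simp add: j mult.assoc[symmetric])
  qed
qed

text \<open>
  The coefficient of \<open>z m n\<close> in the truncated solution. The power of \<open>-1\<close> is what remains of the
  eigenvalue \<open>(- i)\<^sup>n\<^sup>-\<^sup>1\<close> after the imaginary unit is absorbed by parity.
\<close>
definition solution_coeff :: "(nat \<Rightarrow> real \<Rightarrow> real) \<Rightarrow> real \<Rightarrow> real \<Rightarrow> nat \<Rightarrow> nat \<Rightarrow> real" where
  "solution_coeff \<psi> t x m n = (- 1) ^ ((n - 1) div 2) / sqrt (2 * pi) *
     (LINT \<xi>|lborel. cas (\<xi> * x) * kernel_coeff \<psi> t m \<xi> * hermite_basis n \<xi>)"

lemma square_integrable_hermite_basis: "n \<ge> 1 \<Longrightarrow> square_integrable lborel (hermite_basis n)"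
  using hermite_orthonormal_basis by (simp add: orthonormal_basis_L2_def)

lemma integrable_iexp_hermite_basis: 
  "integrable lborel (\<lambda>x. exp (- (\<i> * of_real (\<xi> * x))) * complex_of_real (hermite_basis n x))"
  using integrable_iexp_herm[of \<xi> "n - 1"] by (simp add: hermite_basis_herm del: of_real_mult)

lemma noise_hat_eq:
  "noise_hat \<psi> z N \<omega> s \<xi> = (\<Sum>m=1..N. \<Sum>n=1..N. of_real (z m n \<omega>) * of_real (\<psi> m s) *
     (of_real (sqrt (2 * pi)) * (- \<i>) ^ (n - 1) * of_real (hermite_basis n \<xi>)))"
proof -
  have "noise_hat \<psi> z N \<omega> s \<xi> = (LINT x|lborel. (\<Sum>m=1..N. \<Sum>n=1..N. of_real (z m n \<omega>) * of_real (\<psi> m s) *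
      (exp (- (\<i> * of_real (\<xi> * x))) * of_real (hermite_basis n x))))"
    unfolding noise_hat_def noise_def
    by (simp add: sum_distrib_left mult_ac)
  also have "\<dots> = (\<Sum>m=1..N. \<Sum>n=1..N. of_real (z m n \<omega>) * of_real (\<psi> m s) *
      (LINT x|lborel. exp (- (\<i> * of_real (\<xi> * x))) * of_real (hermite_basis n x)))"
    using integrable_iexp_hermite_basis by (simp del: of_real_mult)
  finally show ?thesis unfolding fourier_hermite_basis .
qed

lemma integrable_kernel_basis:
  assumes \<psi>: "orthonormal_basis_L2 halfline \<psi>" and m: "m \<ge> 1"
  shows "integrable lborel (\<lambda>s. indicator {0..t} s * (tricomi_C t s \<bar>\<xi>\<bar> * \<psi> m s))"
proof -
  have "square_integrable halfline (\<psi> m)" using \<psi> m by (simp add: orthonormal_basis_L2_def)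
  from square_integrable_mult[OF tricomi_C_truncated_square_integrable this]
  have "integrable halfline (\<lambda>s. indicator {0..t} s * tricomi_C t s \<bar>\<xi>\<bar> * \<psi> m s)" .
  then have "integrable lborel (\<lambda>s. indicator {0..} s *\<^sub>R (indicator {0..t} s * tricomi_C t s \<bar>\<xi>\<bar> * \<psi> m s))"
    by (subst (asm) integrable_restrict_space) (simp_all add: set_integrable_def)
  then show ?thesis
    by (rule Bochner_Integration.integrable_cong[THEN iffD1, rotated 2]) (auto simp: indicator_def)
qed

lemma integral_double_sum:
  fixes f :: "nat \<Rightarrow> nat \<Rightarrow> real \<Rightarrow> complex"
  assumes "\<And>m n. m \<in> {1..N} \<Longrightarrow> n \<in> {1..N} \<Longrightarrow> integrable lborel (f m n)"
  shows "(LINT x|lborel. (\<Sum>m=1..N. \<Sum>n=1..N. c m n * f m n x))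
    = (\<Sum>m=1..N. \<Sum>n=1..N. c m n * (LINT x|lborel. f m n x))"
proof -
  have "(LINT x|lborel. (\<Sum>m=1..N. \<Sum>n=1..N. c m n * f m n x))
      = (\<Sum>m=1..N. LINT x|lborel. (\<Sum>n=1..N. c m n * f m n x))"
    by (intro Bochner_Integration.integral_sum Bochner_Integration.integrable_sum
        integrable_mult_right assms)
  also have "\<dots> = (\<Sum>m=1..N. \<Sum>n=1..N. LINT x|lborel. c m n * f m n x)"
    by (intro sum.cong refl Bochner_Integration.integral_sum integrable_mult_right assms)
  also have "\<dots> = (\<Sum>m=1..N. \<Sum>n=1..N. c m n * (LINT x|lborel. f m n x))"
    by (intro sum.cong refl Bochner_Integration.integral_mult_right assms)
  finally show ?thesis .
qed

text \<open>
  All sums are finite, so they pass through the three integrals of the representation formula; the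
  constant is \<open>sqrt (2 * pi) / (2 * pi) = 1 / sqrt (2 * pi)\<close>.
\<close>
lemma approx_solution_eq:
  assumes t: "t \<ge> 0" and \<psi>: "orthonormal_basis_L2 halfline \<psi>"
  shows "approx_solution \<psi> z N t x \<omega> =
    of_real (\<Sum>m=1..N. \<Sum>n=1..N. solution_coeff \<psi> t x m n * z m n \<omega>)"
proof -
  let ?b = "kernel_coeff \<psi> t" and ?h = hermite_basis
  let ?q = "\<lambda>n. complex_of_real (sqrt (2 * pi)) * (- \<i>) ^ (n - 1)"
  have inner: "(LINT s:{0..t}|lborel. of_real (tricomi_C t s \<bar>\<xi>\<bar>) * noise_hat \<psi> z N \<omega> s \<xi>)
      = (\<Sum>m=1..N. \<Sum>n=1..N. of_real (z m n \<omega>) * ?q n * of_real (?b m \<xi> * ?h n \<xi>))" for \<xi>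
  proof -
    let ?k = "\<lambda>m s. complex_of_real (indicator {0..t} s * (tricomi_C t s \<bar>\<xi>\<bar> * \<psi> m s))"
    have int: "integrable lborel (?k m)" if "m \<ge> 1" for m
      by (rule integrable_of_real[OF integrable_kernel_basis[OF \<psi> that]])
    have val: "(LINT s|lborel. ?k m s) = of_real (?b m \<xi>)" if "m \<ge> 1" for m
      using integral_of_real[OF integrable_kernel_basis[OF \<psi> that, of t \<xi>], where 'a = complex]
      by (simp add: kernel_coeff_def set_lebesgue_integral_def)
    have "(LINT s:{0..t}|lborel. of_real (tricomi_C t s \<bar>\<xi>\<bar>) * noise_hat \<psi> z N \<omega> s \<xi>)
        = (LINT s|lborel. (\<Sum>m=1..N. \<Sum>n=1..N. (of_real (z m n \<omega>) * ?q n * of_real (?h n \<xi>)) * ?k m s))"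
      unfolding set_lebesgue_integral_def noise_hat_eq
      by (simp add: sum_distrib_left scaleR_conv_of_real mult_ac)
    also have "\<dots> = (\<Sum>m=1..N. \<Sum>n=1..N. (of_real (z m n \<omega>) * ?q n * of_real (?h n \<xi>)) * (LINT s|lborel. ?k m s))"
      by (rule integral_double_sum) (rule int; simp)
    also have "\<dots> = (\<Sum>m=1..N. \<Sum>n=1..N. of_real (z m n \<omega>) * ?q n * of_real (?b m \<xi> * ?h n \<xi>))"
    proof (intro sum.cong refl)
      fix m n assume "m \<in> {1..N}"
      then have "m \<ge> 1" by simp
      then show "(of_real (z m n \<omega>) * ?q n * of_real (?h n \<xi>)) * (LINT s|lborel. ?k m s)
          = of_real (z m n \<omega>) * ?q n * of_real (?b m \<xi> * ?h n \<xi>)"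
        by (subst val, assumption) (simp only: of_real_mult mult_ac)
    qed
    finally show ?thesis .
  qed
  have bh: "integrable lborel (\<lambda>\<xi>. ?b m \<xi> * ?h n \<xi>)" if "m \<ge> 1" "n \<ge> 1" for m n
    using square_integrable_mult[OF kernel_coeff_parseval(1)[OF t \<psi>, of "\<lambda>_. 1" 1 m] square_integrable_hermite_basis[of n]] that
    by simp
  let ?f = "\<lambda>m n \<xi>. exp (\<i> * of_real (\<xi> * x)) * complex_of_real (?b m \<xi> * ?h n \<xi>)"
  have int: "integrable lborel (?f m n)" if "m \<ge> 1" "n \<ge> 1" for m n
    by (rule Bochner_Integration.integrable_bound[OF bh[OF that]])
      (use borel_measurable_integrable[OF bh[OF that]] in \<open>auto simp: norm_mult cmod_exp_i simp del: of_real_mult\<close>)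
  have coeff: "?q n * (LINT \<xi>|lborel. ?f m n \<xi>) = of_real (2 * pi * solution_coeff \<psi> t x m n)"
    if "m \<ge> 1" "n \<ge> 1" for m n
  proof -
    have par: "?b m (- \<xi>) * ?h n (- \<xi>) = (- 1) ^ (n - 1) * (?b m \<xi> * ?h n \<xi>)" for \<xi>
      unfolding kernel_coeff_even hermite_basis_parity by (rule mult.left_commute)
    have "?q n * (LINT \<xi>|lborel. ?f m n \<xi>) = of_real (sqrt (2 * pi)) * ((- \<i>) ^ (n - 1) * (LINT \<xi>|lborel. ?f m n \<xi>))"
      by (rule mult.assoc)
    also have "\<dots> = of_real (sqrt (2 * pi) * ((- 1) ^ ((n - 1) div 2) * (LINT \<xi>|lborel. cas (\<xi> * x) * (?b m \<xi> * ?h n \<xi>))))"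
      by (subst fourier_parity[OF bh[OF that] par]) (simp only: of_real_mult)
    also have "sqrt (2 * pi) * ((- 1) ^ ((n - 1) div 2) * (LINT \<xi>|lborel. cas (\<xi> * x) * (?b m \<xi> * ?h n \<xi>)))
        = 2 * pi * solution_coeff \<psi> t x m n"
    proof -
      have "2 * pi / sqrt (2 * pi) = sqrt (2 * pi)" by (rule real_div_sqrt) simp
      then have "2 * pi * (e / sqrt (2 * pi) * I) = sqrt (2 * pi) * (e * I)" for e I :: real
        by (metis mult.commute mult.left_commute times_divide_eq_right)
      then show ?thesis by (simp only: solution_coeff_def mult.assoc)
    qed
    finally show ?thesis .
  qed
  have "(LINT \<xi>|lborel. exp (\<i> * of_real (\<xi> * x)) *
        (LINT s:{0..t}|lborel. of_real (tricomi_C t s \<bar>\<xi>\<bar>) * noise_hat \<psi> z N \<omega> s \<xi>))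
      = (LINT \<xi>|lborel. (\<Sum>m=1..N. \<Sum>n=1..N. of_real (z m n \<omega>) * ?q n * ?f m n \<xi>))"
    unfolding inner by (simp add: sum_distrib_left mult_ac)
  also have "\<dots> = (\<Sum>m=1..N. \<Sum>n=1..N. of_real (z m n \<omega>) * ?q n * (LINT \<xi>|lborel. ?f m n \<xi>))"
    by (rule integral_double_sum) (rule int; simp)
  also have "\<dots> = (\<Sum>m=1..N. \<Sum>n=1..N. of_real (2 * pi) * of_real (solution_coeff \<psi> t x m n * z m n \<omega>))"
  proof (intro sum.cong refl)
    fix m n assume "m \<in> {1..N}" "n \<in> {1..N}"
    then have "?q n * (LINT \<xi>|lborel. ?f m n \<xi>) = of_real (2 * pi * solution_coeff \<psi> t x m n)"
      by (intro coeff) auto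
    then show "of_real (z m n \<omega>) * ?q n * (LINT \<xi>|lborel. ?f m n \<xi>)
        = of_real (2 * pi) * of_real (solution_coeff \<psi> t x m n * z m n \<omega>)"
      unfolding mult.assoc[of "of_real (z m n \<omega>)"] by (simp add: mult_ac)
  qed
  also have "\<dots> = of_real (2 * pi) * of_real (\<Sum>m=1..N. \<Sum>n=1..N. solution_coeff \<psi> t x m n * z m n \<omega>)"
    by (simp add: sum_distrib_left)
  finally show ?thesis unfolding approx_solution_def by simp
qed

section \<open>Covariance, correlation and continuity of the solution\<close>

text \<open>
  The covariance of the solution at time \<open>t\<close> and distance \<open>d\<close>, written over the whole line.
\<close>
definition space_covariance :: "real \<Rightarrow> real \<Rightarrow> real" where
  "space_covariance t d = (LINT \<xi>|lborel. cos (\<xi> * d) * tricomi_energy t \<xi>) / (2 * pi)"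

lemma space_covariance_halfline:
  assumes t: "t \<ge> 0"
  shows "space_covariance t d = 1 / pi * (LINT \<rho>:{0..}|lborel. cos (\<rho> * \<bar>d\<bar>) * (LINT s:{0..t}|lborel. \<bar>tricomi_C t s \<rho>\<bar>\<^sup>2))"
proof -
  have int: "integrable lborel (\<lambda>\<xi>. cos (\<xi> * d) * tricomi_energy t \<xi>)"
    by (rule integrable_bounded_mult[OF integrable_tricomi_energy[OF t], of _ 1]) simp_all
  have "has_bochner_integral lborel (\<lambda>\<xi>. cos (\<xi> * d) * tricomi_energy t \<xi>)
      (2 * (LINT \<xi>:{0..}|lborel. cos (\<xi> * d) * tricomi_energy t \<xi>))"
  proof (rule has_bochner_integral_even)
    show "(\<lambda>\<xi>. cos (\<xi> * d) * tricomi_energy t \<xi>) \<in> borel_measurable lborel" using int by auto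
    show "set_integrable lborel {0<..} (\<lambda>\<xi>. cos (\<xi> * d) * tricomi_energy t \<xi>)"
      unfolding set_integrable_def by (rule integrable_mult_indicator[OF _ int]) simp
  qed (simp add: tricomi_energy_even)
  then have "space_covariance t d = 1 / pi * (LINT \<xi>:{0..}|lborel. cos (\<xi> * d) * tricomi_energy t \<xi>)"
    by (simp add: space_covariance_def has_bochner_integral_integral_eq)
  also have "(LINT \<xi>:{0..}|lborel. cos (\<xi> * d) * tricomi_energy t \<xi>)
      = (LINT \<rho>:{0..}|lborel. cos (\<rho> * \<bar>d\<bar>) * (LINT s:{0..t}|lborel. \<bar>tricomi_C t s \<rho>\<bar>\<^sup>2))"
  proof (rule set_lebesgue_integral_cong)
    have "cos (\<xi> * d) = cos (\<xi> * \<bar>d\<bar>)" for \<xi> by (cases "d \<ge> 0") auto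
    then show "\<forall>\<xi>. \<xi> \<in> {0..} \<longrightarrow> cos (\<xi> * d) * tricomi_energy t \<xi>
        = cos (\<xi> * \<bar>d\<bar>) * (LINT s:{0..t}|lborel. \<bar>tricomi_C t s \<xi>\<bar>\<^sup>2)"
      by (simp add: tricomi_energy_def)
  qed simp
  finally show ?thesis .
qed

text \<open>
  The term \<open>sin (\<xi> (x + y))\<close>, the only one not depending on \<open>x - y\<close>, is odd and integrates to
  zero.
\<close>
lemma integral_cas_cas_energy:
  assumes t: "t \<ge> 0"
  shows "(LINT \<xi>|lborel. cas (\<xi> * x) * cas (\<xi> * y) * tricomi_energy t \<xi>) = 2 * pi * space_covariance t (x - y)"
proof -
  note E = integrable_tricomi_energy[OF t]
  have int: "integrable lborel (\<lambda>\<xi>. cos (\<xi> * (x - y)) * tricomi_energy t \<xi>)"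
    "integrable lborel (\<lambda>\<xi>. sin (\<xi> * (x + y)) * tricomi_energy t \<xi>)"
    by (rule integrable_bounded_mult[OF E, of _ 1]; simp)+
  have "(LINT \<xi>|lborel. cas (\<xi> * x) * cas (\<xi> * y) * tricomi_energy t \<xi>)
    = (LINT \<xi>|lborel. cos (\<xi> * (x - y)) * tricomi_energy t \<xi> + sin (\<xi> * (x + y)) * tricomi_energy t \<xi>)"
    by (simp add: cas_mult distrib_right distrib_left right_diff_distrib)
  also have "\<dots> = (LINT \<xi>|lborel. cos (\<xi> * (x - y)) * tricomi_energy t \<xi>) + (LINT \<xi>|lborel. sin (\<xi> * (x + y)) * tricomi_energy t \<xi>)"
    by (rule Bochner_Integration.integral_add[OF int])
  also have "(LINT \<xi>|lborel. sin (\<xi> * (x + y)) * tricomi_energy t \<xi>) = 0"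
    by (rule integral_odd) (simp add: tricomi_energy_even)
  finally show ?thesis by (simp add: space_covariance_def)
qed

lemma integral_cas_combination_energy:
  assumes t: "t \<ge> 0"
  shows "(LINT \<xi>|lborel. (cas (\<xi> * x) + c * cas (\<xi> * y))\<^sup>2 * tricomi_energy t \<xi>)
    = 2 * pi * ((1 + c\<^sup>2) * space_covariance t 0 + 2 * c * space_covariance t (x - y))"
proof -
  let ?E = "tricomi_energy t"
  have int: "integrable lborel (\<lambda>\<xi>. cas (\<xi> * a) * cas (\<xi> * b) * ?E \<xi>)" for a b
  proof (rule integrable_bounded_mult[OF integrable_tricomi_energy[OF t]])
    show "\<bar>cas (\<xi> * a) * cas (\<xi> * b)\<bar> \<le> 2 * 2" for \<xi>
      unfolding abs_mult by (intro mult_mono cas_bound) auto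
  qed measurable
  have "(LINT \<xi>|lborel. (cas (\<xi> * x) + c * cas (\<xi> * y))\<^sup>2 * ?E \<xi>)
    = (LINT \<xi>|lborel. cas (\<xi> * x) * cas (\<xi> * x) * ?E \<xi> + (2 * c) * (cas (\<xi> * x) * cas (\<xi> * y) * ?E \<xi>)
        + c\<^sup>2 * (cas (\<xi> * y) * cas (\<xi> * y) * ?E \<xi>))"
    by (rule Bochner_Integration.integral_cong) (simp_all add: power2_eq_square algebra_simps)
  also have "\<dots> = (LINT \<xi>|lborel. cas (\<xi> * x) * cas (\<xi> * x) * ?E \<xi>)
     + (2 * c) * (LINT \<xi>|lborel. cas (\<xi> * x) * cas (\<xi> * y) * ?E \<xi>)
     + c\<^sup>2 * (LINT \<xi>|lborel. cas (\<xi> * y) * cas (\<xi> * y) * ?E \<xi>)"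
    by (simp add: int)
  finally show ?thesis unfolding integral_cas_cas_energy[OF t] by (simp add: algebra_simps)
qed

text \<open>
  Squares of sums suffice: \<open>c = 1\<close> and \<open>c = 0\<close> give the covariance by polarisation, \<open>c = -1\<close> the
  variance of an increment.
\<close>
lemma solution_coeff_parseval:
  assumes t: "t \<ge> 0" and \<psi>: "orthonormal_basis_L2 halfline \<psi>"
  shows "(\<lambda>N. \<Sum>m=1..N. \<Sum>n=1..N. (solution_coeff \<psi> t x m n + c * solution_coeff \<psi> t y m n)\<^sup>2)
    \<longlonglongrightarrow> (1 + c\<^sup>2) * space_covariance t 0 + 2 * c * space_covariance t (x - y)"
proof -
  define w where "w \<xi> = cas (\<xi> * x) + c * cas (\<xi> * y)" for \<xi>
  have w [measurable]: "w \<in> borel_measurable borel" unfolding w_def by measurable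
  have wB: "\<bar>w \<xi>\<bar> \<le> 2 + \<bar>c\<bar> * 2" for \<xi>
  proof -
    have "\<bar>w \<xi>\<bar> \<le> \<bar>cas (\<xi> * x)\<bar> + \<bar>c * cas (\<xi> * y)\<bar>" unfolding w_def by (rule abs_triangle_ineq)
    also have "\<dots> \<le> 2 + \<bar>c\<bar> * 2" unfolding abs_mult by (intro add_mono mult_left_mono cas_bound) auto
    finally show ?thesis .
  qed
  let ?b = "kernel_coeff \<psi> t" and ?h = hermite_basis
  note P = kernel_coeff_parseval[OF t \<psi> w wB]
  have int: "integrable lborel (\<lambda>\<xi>. cas (\<xi> * x) * ?b m \<xi> * ?h n \<xi>)" if "m \<ge> 1" "n \<ge> 1" for m n x
    using square_integrable_mult[OF kernel_coeff_parseval(1)[OF t \<psi> _ _ that(1), of "\<lambda>\<xi>. cas (\<xi> * x)" 2]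
        square_integrable_hermite_basis[OF that(2)]] cas_bound
    by simp
  have eq: "(solution_coeff \<psi> t x m n + c * solution_coeff \<psi> t y m n)\<^sup>2
      = (LINT \<xi>|lborel. w \<xi> * ?b m \<xi> * ?h n \<xi>)\<^sup>2 / (2 * pi)" if "m \<ge> 1" "n \<ge> 1" for m n
  proof -
    have "(LINT \<xi>|lborel. w \<xi> * ?b m \<xi> * ?h n \<xi>)
      = (LINT \<xi>|lborel. cas (\<xi> * x) * ?b m \<xi> * ?h n \<xi> + c * (cas (\<xi> * y) * ?b m \<xi> * ?h n \<xi>))"
      by (rule Bochner_Integration.integral_cong) (simp_all add: w_def algebra_simps)
    also have "\<dots> = (LINT \<xi>|lborel. cas (\<xi> * x) * ?b m \<xi> * ?h n \<xi>) + c * (LINT \<xi>|lborel. cas (\<xi> * y) * ?b m \<xi> * ?h n \<xi>)"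
      by (simp add: int[OF that])
    finally have I: "(LINT \<xi>|lborel. w \<xi> * ?b m \<xi> * ?h n \<xi>)
      = (LINT \<xi>|lborel. cas (\<xi> * x) * ?b m \<xi> * ?h n \<xi>) + c * (LINT \<xi>|lborel. cas (\<xi> * y) * ?b m \<xi> * ?h n \<xi>)" .
    have "solution_coeff \<psi> t x m n + c * solution_coeff \<psi> t y m n
      = (- 1) ^ ((n - 1) div 2) / sqrt (2 * pi) * (LINT \<xi>|lborel. w \<xi> * ?b m \<xi> * ?h n \<xi>)"
      unfolding I solution_coeff_def by (simp only: distrib_left mult_ac)
    moreover have "((- 1) ^ ((n - 1) div 2) / sqrt (2 * pi) * r)\<^sup>2 = r\<^sup>2 / (2 * pi)" for r :: real
      by (simp add: power_mult_distrib power_divide power_even_eq[symmetric] flip: power_mult)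
    ultimately show ?thesis by (simp only:)
  qed
  have "(\<lambda>N. (\<Sum>m=1..N. \<Sum>n=1..N. (LINT \<xi>|lborel. w \<xi> * ?b m \<xi> * ?h n \<xi>)\<^sup>2) / (2 * pi))
    \<longlonglongrightarrow> (LINT \<xi>|lborel. (w \<xi>)\<^sup>2 * tricomi_energy t \<xi>) / (2 * pi)"
    by (intro tendsto_divide P tendsto_const) simp
  moreover have "(\<Sum>m=1..N. \<Sum>n=1..N. (LINT \<xi>|lborel. w \<xi> * ?b m \<xi> * ?h n \<xi>)\<^sup>2) / (2 * pi)
     = (\<Sum>m=1..N. \<Sum>n=1..N. (solution_coeff \<psi> t x m n + c * solution_coeff \<psi> t y m n)\<^sup>2)" for N
    unfolding sum_divide_distrib by (intro sum.cong refl) (simp add: eq)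
  moreover have "(LINT \<xi>|lborel. (w \<xi>)\<^sup>2 * tricomi_energy t \<xi>) / (2 * pi)
     = (1 + c\<^sup>2) * space_covariance t 0 + 2 * c * space_covariance t (x - y)"
    unfolding w_def integral_cas_combination_energy[OF t] by simp
  ultimately show ?thesis by simp
qed

context prob_space
begin

context
  fixes \<psi> :: "nat \<Rightarrow> real \<Rightarrow> real" and z :: "nat \<Rightarrow> nat \<Rightarrow> 'a \<Rightarrow> real" and U :: "real \<Rightarrow> real \<Rightarrow> 'a \<Rightarrow> real"
    and t :: real
  assumes \<psi>: "orthonormal_basis_L2 halfline \<psi>"
    and normal: "\<And>m n. m \<ge> 1 \<Longrightarrow> n \<ge> 1 \<Longrightarrow> distributed M lborel (z m n) std_normal_density"
    and indep: "indep_vars (\<lambda>_. borel) (\<lambda>(m, n). z m n) ({1..} \<times> {1..})"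
    and sol: "tricomi_solution M \<psi> z U"
    and t: "t \<ge> 0"
begin

lemma noise_combination_moments:
  fixes c :: "nat \<Rightarrow> nat \<Rightarrow> real" and N :: nat
  defines "S \<equiv> \<lambda>\<omega>. \<Sum>m=1..N. \<Sum>n=1..N. c m n * z m n \<omega>" and "v \<equiv> \<Sum>m=1..N. \<Sum>n=1..N. (c m n)\<^sup>2"
  shows "has_bochner_integral M S 0"
    and "has_bochner_integral M (\<lambda>\<omega>. (S \<omega>)\<^sup>2) v"
    and "has_bochner_integral M (\<lambda>\<omega>. (S \<omega>) ^ 4) (3 * v\<^sup>2)"
proof -
  let ?I = "{1..N} \<times> {1..N}"
  have ind: "indep_vars (\<lambda>_. borel) (\<lambda>(m, n). z m n) ?I"
    by (rule indep_vars_subset[OF indep]) auto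
  have nrm: "distributed M lborel ((\<lambda>(m, n). z m n) i) std_normal_density" if "i \<in> ?I" for i
    using that normal by auto
  have S: "S = (\<lambda>\<omega>. \<Sum>i\<in>?I. (\<lambda>(m, n). c m n) i * (\<lambda>(m, n). z m n) i \<omega>)"
    and v: "v = (\<Sum>i\<in>?I. ((\<lambda>(m, n). c m n) i)\<^sup>2)"
    unfolding S_def v_def by (simp_all add: sum.cartesian_product case_prod_unfold)
  note G = gaussian_sum_moments[OF _ ind nrm, where c = "\<lambda>(m, n). c m n"]
  show "has_bochner_integral M S 0" "has_bochner_integral M (\<lambda>\<omega>. (S \<omega>)\<^sup>2) v"
    "has_bochner_integral M (\<lambda>\<omega>. (S \<omega>) ^ 4) (3 * v\<^sup>2)"
    unfolding S v by (rule G; simp)+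
qed

abbreviation truncated :: "nat \<Rightarrow> real \<Rightarrow> 'a \<Rightarrow> real" where
  "truncated N x \<equiv> \<lambda>\<omega>. \<Sum>m=1..N. \<Sum>n=1..N. solution_coeff \<psi> t x m n * z m n \<omega>"

lemma square_integrable_noise_combination:
  "square_integrable M (\<lambda>\<omega>. \<Sum>m=1..N. \<Sum>n=1..N. c m n * z m n \<omega>)"
  using noise_combination_moments(1,2)[where N = N and c = c]
  by (auto simp: square_integrable_real has_bochner_integral_iff)

lemma square_integrable_solution: "square_integrable M (U t x)"
  using sol t by (auto simp: tricomi_solution_def tendsto_L2_def square_integrable_def)

lemma truncated_tendsto: "(\<lambda>N. LINT \<omega>|M. (truncated N x \<omega> - U t x \<omega>)\<^sup>2) \<longlonglongrightarrow> 0"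
proof -
  have "(\<lambda>N. LINT \<omega>|M. (norm (approx_solution \<psi> z N t x \<omega> - complex_of_real (U t x \<omega>)))\<^sup>2) \<longlonglongrightarrow> 0"
    using sol t by (auto simp: tricomi_solution_def tendsto_L2_def)
  moreover have "norm (approx_solution \<psi> z N t x \<omega> - complex_of_real (U t x \<omega>)) = \<bar>truncated N x \<omega> - U t x \<omega>\<bar>" for N \<omega>
    unfolding approx_solution_eq[OF t \<psi>] by (simp only: of_real_diff[symmetric] norm_of_real)
  ultimately show ?thesis by simp
qed

lemma combination_tendsto:
  "(\<lambda>N. LINT \<omega>|M. ((truncated N x \<omega> + c * truncated N y \<omega>) - (U t x \<omega> + c * U t y \<omega>))\<^sup>2) \<longlonglongrightarrow> 0"
proof (rule tendsto_sandwich[OF _ _ tendsto_const])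
  let ?D = "\<lambda>N x \<omega>. truncated N x \<omega> - U t x \<omega>"
  have D: "square_integrable M (?D N x)" for N x
    by (rule square_integrable_diff[OF square_integrable_noise_combination square_integrable_solution])
  have Dsq: "integrable M (\<lambda>\<omega>. (?D N x \<omega>)\<^sup>2)" for N x
    using D unfolding square_integrable_real by blast
  show "(\<lambda>N. 2 * (LINT \<omega>|M. (?D N x \<omega>)\<^sup>2) + 2 * c\<^sup>2 * (LINT \<omega>|M. (?D N y \<omega>)\<^sup>2)) \<longlonglongrightarrow> 0"
    using tendsto_add[OF tendsto_mult_right_zero[OF truncated_tendsto] tendsto_mult_right_zero[OF truncated_tendsto]]
    by simp
  have "(LINT \<omega>|M. ((truncated N x \<omega> + c * truncated N y \<omega>) - (U t x \<omega> + c * U t y \<omega>))\<^sup>2)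
      \<le> (LINT \<omega>|M. 2 * (?D N x \<omega>)\<^sup>2 + 2 * c\<^sup>2 * (?D N y \<omega>)\<^sup>2)" for N
  proof (rule integral_mono')
    show "integrable M (\<lambda>\<omega>. 2 * (?D N x \<omega>)\<^sup>2 + 2 * c\<^sup>2 * (?D N y \<omega>)\<^sup>2)"
      by (intro Bochner_Integration.integrable_add integrable_mult_right Dsq)
    fix \<omega>
    have "(a + c * b)\<^sup>2 \<le> 2 * a\<^sup>2 + 2 * c\<^sup>2 * b\<^sup>2" for a b :: real
    proof -
      have "0 \<le> (a - c * b)\<^sup>2" by simp
      then show ?thesis by (simp add: power2_eq_square algebra_simps)
    qed
    moreover have "(truncated N x \<omega> + c * truncated N y \<omega>) - (U t x \<omega> + c * U t y \<omega>) = ?D N x \<omega> + c * ?D N y \<omega>"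
      by (simp only: right_diff_distrib)
    ultimately show "((truncated N x \<omega> + c * truncated N y \<omega>) - (U t x \<omega> + c * U t y \<omega>))\<^sup>2
       \<le> 2 * (?D N x \<omega>)\<^sup>2 + 2 * c\<^sup>2 * (?D N y \<omega>)\<^sup>2"
      by (simp only:)
  qed simp
  also have "(LINT \<omega>|M. 2 * (?D N x \<omega>)\<^sup>2 + 2 * c\<^sup>2 * (?D N y \<omega>)\<^sup>2)
      = 2 * (LINT \<omega>|M. (?D N x \<omega>)\<^sup>2) + 2 * c\<^sup>2 * (LINT \<omega>|M. (?D N y \<omega>)\<^sup>2)" for N
  proof -
    have i: "integrable M (\<lambda>\<omega>. (?D N x \<omega>)\<^sup>2)" "integrable M (\<lambda>\<omega>. (?D N y \<omega>)\<^sup>2)"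
      by (rule Dsq)+
    show ?thesis
      by (subst Bochner_Integration.integral_add[OF integrable_mult_right[OF i(1)] integrable_mult_right[OF i(2)]])
        (simp only: Bochner_Integration.integral_mult_right[OF i(1)] Bochner_Integration.integral_mult_right[OF i(2)])
  qed
  finally show "\<forall>\<^sub>F N in sequentially. (LINT \<omega>|M. ((truncated N x \<omega> + c * truncated N y \<omega>) - (U t x \<omega> + c * U t y \<omega>))\<^sup>2)
      \<le> 2 * (LINT \<omega>|M. (?D N x \<omega>)\<^sup>2) + 2 * c\<^sup>2 * (LINT \<omega>|M. (?D N y \<omega>)\<^sup>2)"
    by (intro always_eventually allI)
qed simp

abbreviation combination_coeff :: "real \<Rightarrow> real \<Rightarrow> real \<Rightarrow> nat \<Rightarrow> nat \<Rightarrow> real" where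
  "combination_coeff c x y m n \<equiv> solution_coeff \<psi> t x m n + c * solution_coeff \<psi> t y m n"

abbreviation combination :: "nat \<Rightarrow> real \<Rightarrow> real \<Rightarrow> real \<Rightarrow> 'a \<Rightarrow> real" where
  "combination N c x y \<omega> \<equiv> \<Sum>m=1..N. \<Sum>n=1..N. combination_coeff c x y m n * z m n \<omega>"

lemma truncated_combination:
  "truncated N x \<omega> + c * truncated N y \<omega> =
    combination N c x y \<omega>"
  by (simp add: sum_distrib_left sum.distrib distrib_right mult.assoc)

lemma combination_tendsto':
  "(\<lambda>N. LINT \<omega>|M. (combination N c x y \<omega>
      - (U t x \<omega> + c * U t y \<omega>))\<^sup>2) \<longlonglongrightarrow> 0"
  using combination_tendsto[of x c y] unfolding truncated_combination .

lemma square_integrable_combination: "square_integrable M (\<lambda>\<omega>. U t x \<omega> + c * U t y \<omega>)"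
  by (intro square_integrable_add square_integrable_cmult square_integrable_solution)

lemma combination_second_moment:
  "(LINT \<omega>|M. (U t x \<omega> + c * U t y \<omega>)\<^sup>2)
    = (1 + c\<^sup>2) * space_covariance t 0 + 2 * c * space_covariance t (x - y)"
proof (rule LIMSEQ_unique)
  show "(\<lambda>N. LINT \<omega>|M. (combination N c x y \<omega>)\<^sup>2)
     \<longlonglongrightarrow> (LINT \<omega>|M. (U t x \<omega> + c * U t y \<omega>)\<^sup>2)"
    by (rule L2_tendsto_norm[OF square_integrable_noise_combination square_integrable_combination combination_tendsto'])
  show "(\<lambda>N. LINT \<omega>|M. (combination N c x y \<omega>)\<^sup>2)
     \<longlonglongrightarrow> (1 + c\<^sup>2) * space_covariance t 0 + 2 * c * space_covariance t (x - y)"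
    unfolding has_bochner_integral_integral_eq[OF noise_combination_moments(2)]
    by (rule solution_coeff_parseval[OF t \<psi>])
qed

lemma solution_expectation: "expectation (U t x) = 0"
proof (rule LIMSEQ_unique)
  show "(\<lambda>N. expectation (truncated N x)) \<longlonglongrightarrow> expectation (U t x)"
    by (rule L2_tendsto_expectation[OF square_integrable_noise_combination square_integrable_solution truncated_tendsto])
  show "(\<lambda>N. expectation (truncated N x)) \<longlonglongrightarrow> 0"
    unfolding has_bochner_integral_integral_eq[OF noise_combination_moments(1)] by (rule tendsto_const)
qed

lemma solution_covariance: "covariance M (U t x) (U t y) = space_covariance t (x - y)"
proof -
  have sq: "integrable M (\<lambda>\<omega>. (U t x \<omega>)\<^sup>2)" for x
    using square_integrable_solution by (simp add: square_integrable_real)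
  have pr: "integrable M (\<lambda>\<omega>. U t x \<omega> * U t y \<omega>)"
    by (rule square_integrable_mult[OF square_integrable_solution square_integrable_solution])
  have self: "(LINT \<omega>|M. (U t x \<omega>)\<^sup>2) = space_covariance t 0" for x
    using combination_second_moment[of x 0 x] by simp
  have "(LINT \<omega>|M. (U t x \<omega> + 1 * U t y \<omega>)\<^sup>2)
     = (LINT \<omega>|M. (U t x \<omega>)\<^sup>2 + (U t y \<omega>)\<^sup>2 + 2 * (U t x \<omega> * U t y \<omega>))"
    by (simp add: power2_sum mult.assoc)
  also have "\<dots> = (LINT \<omega>|M. (U t x \<omega>)\<^sup>2) + (LINT \<omega>|M. (U t y \<omega>)\<^sup>2) + 2 * (LINT \<omega>|M. U t x \<omega> * U t y \<omega>)"
    using sq pr by simp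
  finally have "(LINT \<omega>|M. U t x \<omega> * U t y \<omega>) = space_covariance t (x - y)"
    unfolding combination_second_moment self by simp
  then show ?thesis by (simp add: covariance_def solution_expectation)
qed

text \<open>
  The variance \<open>Q\<close> of the increment is \<open>1 / pi\<close> times the integral of
  \<open>(1 - cos (\<xi> (x - y))) E(\<xi>)\<close>, which is at most \<open>pi \<bar>x - y\<bar>\<close>.
\<close>
lemma increment_fourth_moment:
  "(\<integral>\<^sup>+\<omega>. ennreal ((U t x \<omega> - U t y \<omega>) ^ 4) \<partial>M) \<le> ennreal (3 * (x - y)\<^sup>2)"
proof -
  define Q where "Q = (1 + (- 1)\<^sup>2) * space_covariance t 0 + 2 * (- 1) * space_covariance t (x - y)"
  let ?c = "combination_coeff (- 1) x y"
  have "(\<integral>\<^sup>+\<omega>. ennreal ((U t x \<omega> + (- 1) * U t y \<omega>) ^ 4) \<partial>M) \<le> ennreal (3 * Q\<^sup>2)"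
  proof (rule L2_limit_fourth_moment[OF square_integrable_noise_combination square_integrable_combination combination_tendsto'])
    fix N
    have "(\<integral>\<^sup>+\<omega>. ennreal (combination N (- 1) x y \<omega> ^ 4) \<partial>M)
      = ennreal (LINT \<omega>|M. combination N (- 1) x y \<omega> ^ 4)"
      by (intro nn_integral_eq_integral integrable.intros[OF noise_combination_moments(3)]) simp
    also have "\<dots> = ennreal (3 * (\<Sum>m=1..N. \<Sum>n=1..N. (?c m n)\<^sup>2)\<^sup>2)"
      by (simp only: has_bochner_integral_integral_eq[OF noise_combination_moments(3)])
    finally show "(\<integral>\<^sup>+\<omega>. ennreal (combination N (- 1) x y \<omega> ^ 4) \<partial>M)
      \<le> ennreal (3 * (\<Sum>m=1..N. \<Sum>n=1..N. (?c m n)\<^sup>2)\<^sup>2)" by simp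
  next
    show "(\<lambda>N. 3 * (\<Sum>m=1..N. \<Sum>n=1..N. (?c m n)\<^sup>2)\<^sup>2) \<longlonglongrightarrow> 3 * Q\<^sup>2"
      unfolding Q_def
      by (intro tendsto_mult_left tendsto_power solution_coeff_parseval t \<psi>)
  qed
  also have "3 * Q\<^sup>2 \<le> 3 * (x - y)\<^sup>2"
  proof -
    have "0 \<le> Q"
      unfolding Q_def combination_second_moment[symmetric] by (rule integral_nonneg_AE) simp
    moreover have "Q \<le> \<bar>x - y\<bar>"
    proof -
      have i: "integrable lborel (\<lambda>\<xi>. cos (\<xi> * (x - y)) * tricomi_energy t \<xi>)"
        by (rule integrable_bounded_mult[OF integrable_tricomi_energy[OF t], of _ 1]) simp_all
      have "Q = (LINT \<xi>|lborel. (1 - cos (\<xi> * (x - y))) * tricomi_energy t \<xi>) / pi"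
        using i integrable_tricomi_energy[OF t]
        by (simp add: Q_def space_covariance_def left_diff_distrib diff_divide_distrib)
      also have "\<dots> \<le> pi * \<bar>x - y\<bar> / pi"
        by (intro divide_right_mono integral_one_minus_cos_energy_le t) simp
      finally show ?thesis by simp
    qed
    ultimately have "Q\<^sup>2 \<le> \<bar>x - y\<bar>\<^sup>2" by (intro power_mono)
    then show ?thesis by simp
  qed
  finally show ?thesis by (simp add: ennreal_leI)
qed

end

end

lemma space_covariance_increment:
  assumes t: "t > 0"
  shows "((\<lambda>h. (space_covariance t 0 - space_covariance t h) / \<bar>h\<bar>) \<longlongrightarrow> 1 / 2) (at 0)"
proof -
  have "((\<lambda>h. (LINT \<rho>|lborel. (1 - cos (\<rho> * h)) * tricomi_energy t \<rho>) / \<bar>h\<bar> / (2 * pi)) \<longlongrightarrow> pi / (2 * pi)) (at 0)"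
    by (intro tendsto_divide integral_one_minus_cos_energy_asymp t tendsto_const) simp
  moreover have "(LINT \<rho>|lborel. (1 - cos (\<rho> * h)) * tricomi_energy t \<rho>) / \<bar>h\<bar> / (2 * pi)
      = (space_covariance t 0 - space_covariance t h) / \<bar>h\<bar>" for h
  proof -
    have i: "integrable lborel (\<lambda>\<xi>. cos (\<xi> * h) * tricomi_energy t \<xi>)"
      by (rule integrable_bounded_mult[OF integrable_tricomi_energy, of _ _ 1]) (use t in simp_all)
    then have "(LINT \<rho>|lborel. (1 - cos (\<rho> * h)) * tricomi_energy t \<rho>)
        = (LINT \<rho>|lborel. tricomi_energy t \<rho>) - (LINT \<rho>|lborel. cos (\<rho> * h) * tricomi_energy t \<rho>)"
      using integrable_tricomi_energy[of t] t by (simp add: left_diff_distrib)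
    then show ?thesis by (simp add: space_covariance_def diff_divide_distrib mult.commute)
  qed
  ultimately show ?thesis by simp
qed

theorem corollary1p2:
  fixes M :: "'w measure"
    and \<psi> :: "nat \<Rightarrow> real \<Rightarrow> real"
    and z :: "nat \<Rightarrow> nat \<Rightarrow> 'w \<Rightarrow> real"
    and U :: "real \<Rightarrow> real \<Rightarrow> 'w \<Rightarrow> real"
    and t :: real
  assumes "prob_space M"
    and "orthonormal_basis_L2 (restrict_space lborel {0..}) \<psi>"
    and "\<And>m. m \<ge> 1 \<Longrightarrow> smooth_halfline (\<psi> m)"
    and "\<And>m n. m \<ge> 1 \<Longrightarrow> n \<ge> 1 \<Longrightarrow> distributed M lborel (z m n) std_normal_density"
    and "prob_space.indep_vars M (\<lambda>_. borel) (\<lambda>(m, n). z m n) ({1..} \<times> {1..})"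
    and "tricomi_solution M \<psi> z U"
    and "t > 0"
  shows "second_order_stationary M (U t)
    \<and> (\<forall>x. integral\<^sup>L M (U t x) = 0)
    \<and> (\<forall>x y. covariance M (U t x) (U t y) =
          1 / pi * (LINT \<rho>:{0..}|lborel. cos (\<rho> * \<bar>x - y\<bar>) *
            (LINT s:{0..t}|lborel. \<bar>tricomi_C t s \<rho>\<bar>\<^sup>2)))
    \<and> (\<forall>x. (\<lambda>h. correlation M U t x h - (1 - tricomi_alpha t * \<bar>h\<bar>)) \<in> o[at 0](\<lambda>h. \<bar>h\<bar>))
    \<and> (\<exists>V. continuous_modification M (U t) V)"
proof -
  interpret prob_space M by fact
  have t: "t \<ge> 0" using \<open>t > 0\<close> by simp
  note hyps = assms(2,4,5,6) t
  note sq = square_integrable_solution[OF hyps]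
    and mean = solution_expectation[OF hyps]
    and cov = solution_covariance[OF hyps]
    and incr = increment_fourth_moment[OF hyps]
  let ?R = "space_covariance t"
  have stat: "second_order_stationary M (U t)"
    unfolding second_order_stationary_def using sq mean cov by blast
  have R0: "?R 0 > 0"
    using integral_tricomi_energy_pos[OF \<open>t > 0\<close>] by (simp add: space_covariance_def)
  have alpha: "tricomi_alpha t = 1 / (2 * ?R 0)"
    unfolding tricomi_alpha_def space_covariance_halfline[OF t] by simp
  have "(\<lambda>h. correlation M U t x h - (1 - tricomi_alpha t * \<bar>h\<bar>)) \<in> o[at 0](\<lambda>h. \<bar>h\<bar>)" for x
  proof (rule smalloI_tendsto)
    have corr: "correlation M U t x h = ?R h / ?R 0" for h
    proof -
      have "prob_space.variance M (U t x) = covariance M (U t x) (U t x)"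
        by (simp add: covariance_def power2_eq_square)
      then show ?thesis by (simp add: correlation_def cov)
    qed
    have "((\<lambda>h. tricomi_alpha t - (?R 0 - ?R h) / \<bar>h\<bar> / ?R 0) \<longlongrightarrow> tricomi_alpha t - (1 / 2) / ?R 0) (at 0)"
      by (intro tendsto_diff tendsto_divide tendsto_const space_covariance_increment \<open>t > 0\<close>) (use R0 in simp)
    moreover have "tricomi_alpha t - (1 / 2) / ?R 0 = 0" by (simp add: alpha)
    ultimately have lim: "((\<lambda>h. tricomi_alpha t - (?R 0 - ?R h) / \<bar>h\<bar> / ?R 0) \<longlongrightarrow> 0) (at 0)" by simp
    have "tricomi_alpha t - (?R 0 - ?R h) / \<bar>h\<bar> / ?R 0
        = (correlation M U t x h - (1 - tricomi_alpha t * \<bar>h\<bar>)) / \<bar>h\<bar>" if "h \<noteq> 0" for h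
      unfolding corr using R0 that by (simp add: field_simps)
    then have ev: "\<forall>\<^sub>F h in at 0. tricomi_alpha t - (?R 0 - ?R h) / \<bar>h\<bar> / ?R 0
        = (correlation M U t x h - (1 - tricomi_alpha t * \<bar>h\<bar>)) / \<bar>h\<bar>"
      by (simp add: eventually_at_filter)
    show "((\<lambda>h. (correlation M U t x h - (1 - tricomi_alpha t * \<bar>h\<bar>)) / \<bar>h\<bar>) \<longlongrightarrow> 0) (at 0)"
      by (rule Lim_transform_eventually[OF lim ev])
    show "\<forall>\<^sub>F h in at 0. \<bar>h\<bar> \<noteq> (0::real)" by (simp add: eventually_at_filter)
  qed
  moreover have "\<exists>V. continuous_modification M (U t) V"
    by (rule kolmogorov_chentsov[where K = 3]) (use sq incr in \<open>auto simp: square_integrable_def\<close>)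
  moreover have "covariance M (U t x) (U t y) =
          1 / pi * (LINT \<rho>:{0..}|lborel. cos (\<rho> * \<bar>x - y\<bar>) *
            (LINT s:{0..t}|lborel. \<bar>tricomi_C t s \<rho>\<bar>\<^sup>2))" for x y
    by (rule trans[OF cov space_covariance_halfline[OF t]])
  ultimately show ?thesis using stat mean by blast
qed

end
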